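(* Let $G$ be a second countable locally compact group, and let $B_{\rho}(G)$ be its reduced Fourier-Stieltjes algebra, regarded as the dual Banach space $C^{*}_{\rho}(G)^{*}$ of the reduced group C*-algebra. If $B_{\rho}(G)$ has the weak* fixed point property, then $G$ is compact.
   Context: Locally compact groups are Hausdorff, with a fixed left Haar measure. The left regular representation is $\rho: L^{1}(G)\to \mathcal{B}(L^{2}(G))$, $\rho(f)(h)=f\ast h$ (convolution). The reduced group C*-algebra $C^{*}_{\rho}(G)$ is the norm closure of $\rho(L^{1}(G))$ in $\mathcal{B}(L^{2}(G))$. The reduced Fourier-Stieltjes algebra $B_{\rho}(G)$ is the dual Banach space $C^{*}_{\rho}(G)^{*}$, with the dual norm; its weak* topology is $\sigma(B_{\rho}(G),C^{*}_{\rho}(G))$. A self mapping $T$ on a subset $K$ of a Banach space is non-expansive if $\|T(x)-T(y)\|\leq\|x-y\|$ for all $x,y\in K$. A dual Banach space $E$ (with a fixed predual) has the weak* fixed point property if for every non-empty weak* compact convex subset $K$ of $E$, every non-expansive mapping $T:K\to K$ has a fixed point. *)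

theory Defs
  imports "HOL-Analysis.Analysis"
begin

section \<open>Complex normed spaces given by a carrier\<close>

text \<open>The spaces below depend on a Haar measure, which is a term, so they are sets with
  operations rather than types.  The operations matter on the carrier only.\<close>

record 'v cnormed =
  points :: "'v set"
  plus_of :: "'v \<Rightarrow> 'v \<Rightarrow> 'v"
  scale_of :: "complex \<Rightarrow> 'v \<Rightarrow> 'v"
  norm_of :: "'v \<Rightarrow> real"

definition dist_of :: "'v cnormed \<Rightarrow> 'v \<Rightarrow> 'v \<Rightarrow> real" where
  "dist_of E x y = norm_of E (plus_of E x (scale_of E (-1) y))"

definition norm_closure_of :: "'v cnormed \<Rightarrow> 'v set \<Rightarrow> 'v set" where
  "norm_closure_of E X = {x \<in> points E. \<forall>e>0. \<exists>y\<in>X. dist_of E x y < e}"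

text \<open>Operators are extensional functions (undefined off the carrier of \<open>E\<close>), so that equality of
  HOL functions is equality of operators.\<close>

definition bounded_ops :: "'v cnormed \<Rightarrow> 'w cnormed \<Rightarrow> ('v \<Rightarrow> 'w) set" where
  "bounded_ops E F = {T \<in> points E \<rightarrow>\<^sub>E points F.
     (\<forall>x\<in>points E. \<forall>y\<in>points E. T (plus_of E x y) = plus_of F (T x) (T y)) \<and>
     (\<forall>c. \<forall>x\<in>points E. T (scale_of E c x) = scale_of F c (T x)) \<and>
     (\<exists>K. \<forall>x\<in>points E. norm_of F (T x) \<le> K * norm_of E x)}"

definition op_space :: "'v cnormed \<Rightarrow> 'w cnormed \<Rightarrow> ('v \<Rightarrow> 'w) cnormed" where
  "op_space E F = \<lparr>
     points = bounded_ops E F,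
     plus_of = (\<lambda>S T. restrict (\<lambda>x. plus_of F (S x) (T x)) (points E)),
     scale_of = (\<lambda>c T. restrict (\<lambda>x. scale_of F c (T x)) (points E)),
     norm_of = (\<lambda>T. Sup {norm_of F (T x) | x. x \<in> points E \<and> norm_of E x \<le> 1})\<rparr>"

definition complex_line :: "complex cnormed" where
  "complex_line = \<lparr>points = UNIV, plus_of = (+), scale_of = (*), norm_of = cmod\<rparr>"

definition dual_space :: "'v cnormed \<Rightarrow> ('v \<Rightarrow> complex) cnormed" where
  "dual_space E = op_space E complex_line"

text \<open>The product topology restricts to the topology of pointwise convergence on the dual.\<close>

definition weak_star_topology :: "'v cnormed \<Rightarrow> ('v \<Rightarrow> complex) topology" where
  "weak_star_topology E =
     subtopology (product_topology (\<lambda>_. euclidean) (points E)) (points (dual_space E))"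

definition convex_in :: "'v cnormed \<Rightarrow> 'v set \<Rightarrow> bool" where
  "convex_in E K \<longleftrightarrow> (\<forall>x\<in>K. \<forall>y\<in>K. \<forall>t::real. 0 \<le> t \<and> t \<le> 1 \<longrightarrow>
     plus_of E (scale_of E (of_real t) x) (scale_of E (of_real (1 - t)) y) \<in> K)"

definition nonexpansive_on :: "'v cnormed \<Rightarrow> 'v set \<Rightarrow> ('v \<Rightarrow> 'v) \<Rightarrow> bool" where
  "nonexpansive_on E K T \<longleftrightarrow> (\<forall>x\<in>K. \<forall>y\<in>K. dist_of E (T x) (T y) \<le> dist_of E x y)"

text \<open>The argument is the predual; the property is one of its dual.\<close>

definition dual_has_weak_star_fpp :: "'v cnormed \<Rightarrow> bool" where
  "dual_has_weak_star_fpp E \<longleftrightarrow>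
     (\<forall>K. K \<noteq> {} \<and> compactin (weak_star_topology E) K \<and> convex_in (dual_space E) K \<longrightarrow>
       (\<forall>T \<in> K \<rightarrow> K. nonexpansive_on (dual_space E) K T \<longrightarrow> (\<exists>x\<in>K. T x = x)))"


section \<open>Haar measure and the reduced group C*-algebra\<close>

text \<open>Groups are written additively to use the class \<^class>\<open>topological_group_add\<close>; the class
  \<^class>\<open>group_add\<close> below it is not assumed commutative.\<close>

definition left_haar_measure :: "'g::{topological_group_add, t2_space} measure \<Rightarrow> bool" where
  "left_haar_measure \<mu> \<longleftrightarrow>
     sets \<mu> = sets borel \<and>
     emeasure \<mu> UNIV \<noteq> 0 \<and>
     (\<forall>K. compact K \<longrightarrow> emeasure \<mu> K < \<infinity>) \<and>
     (\<forall>A\<in>sets borel. emeasure \<mu> A = (INF U\<in>{U. open U \<and> A \<subseteq> U}. emeasure \<mu> U)) \<and>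
     (\<forall>U. open U \<longrightarrow> emeasure \<mu> U = (SUP K\<in>{K. compact K \<and> K \<subseteq> U}. emeasure \<mu> K)) \<and>
     (\<forall>a. \<forall>A\<in>sets borel. emeasure \<mu> ((+) a ` A) = emeasure \<mu> A)"

definition L1_fun :: "'g measure \<Rightarrow> ('g \<Rightarrow> complex) set" where
  "L1_fun \<mu> = {f. integrable \<mu> f}"

definition L2_fun :: "'g measure \<Rightarrow> ('g \<Rightarrow> complex) set" where
  "L2_fun \<mu> = {h \<in> borel_measurable \<mu>. integrable \<mu> (\<lambda>x. (cmod (h x))\<^sup>2)}"

definition L2_rel :: "'g measure \<Rightarrow> (('g \<Rightarrow> complex) \<times> ('g \<Rightarrow> complex)) set" where
  "L2_rel \<mu> = {(h, k). h \<in> L2_fun \<mu> \<and> k \<in> L2_fun \<mu> \<and> (AE x in \<mu>. h x = k x)}"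

definition L2_space :: "'g measure \<Rightarrow> ('g \<Rightarrow> complex) set cnormed" where
  "L2_space \<mu> = \<lparr>
     points = L2_fun \<mu> // L2_rel \<mu>,
     plus_of = (\<lambda>H K. \<Union>h\<in>H. \<Union>k\<in>K. L2_rel \<mu> `` {\<lambda>x. h x + k x}),
     scale_of = (\<lambda>c H. \<Union>h\<in>H. L2_rel \<mu> `` {\<lambda>x. c * h x}),
     norm_of = (\<lambda>H. the_elem ((\<lambda>h. sqrt (LINT x|\<mu>. (cmod (h x))\<^sup>2)) ` H))\<rparr>"

text \<open>In multiplicative notation, \<open>(f * h)(x) = \<integral> f(y) h(y\<inverse>x) dy\<close>.  For \<open>f\<close> in $L^1$ and \<open>h\<close> in $L^2$
  the integrand is integrable for almost all \<open>x\<close>; at the other points the value is 0.\<close>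

definition convolution ::
  "'g::group_add measure \<Rightarrow> ('g \<Rightarrow> complex) \<Rightarrow> ('g \<Rightarrow> complex) \<Rightarrow> 'g \<Rightarrow> complex" where
  "convolution \<mu> f h x = (LINT y|\<mu>. f y * h (- y + x))"

text \<open>The operator depends only on the almost-everywhere class of \<open>f\<close>, so its range over functions
  is its range over $L^1$.\<close>

definition left_regular ::
  "'g::group_add measure \<Rightarrow> ('g \<Rightarrow> complex) \<Rightarrow> ('g \<Rightarrow> complex) set \<Rightarrow> ('g \<Rightarrow> complex) set" where
  "left_regular \<mu> f =
     restrict (\<lambda>H. \<Union>h\<in>H. L2_rel \<mu> `` {convolution \<mu> f h}) (points (L2_space \<mu>))"

definition reduced_cstar ::
  "'g::group_add measure \<Rightarrow> (('g \<Rightarrow> complex) set \<Rightarrow> ('g \<Rightarrow> complex) set) cnormed" where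
  "reduced_cstar \<mu> = (let B = op_space (L2_space \<mu>) (L2_space \<mu>) in
     B\<lparr>points := norm_closure_of B (left_regular \<mu> ` L1_fun \<mu>)\<rparr>)"

text \<open>The reduced Fourier-Stieltjes algebra is \<open>dual_space (reduced_cstar \<mu>)\<close>.\<close>

end

theory Submission
  imports Defs "HOL-Computational_Algebra.Fundamental_Theorem_Algebra"
begin

text \<open>The proof is by contraposition: if \<open>G\<close> is not compact, a fixed point free nonexpansive map is
  constructed on a weak* compact convex set of functionals.

  The operator behind it is left convolution \<open>b\<close> by \<open>F * F\<close>, where \<open>F\<close> is integrable, positive almost
  everywhere, and \<open>F d\<mu>\<close> is invariant under inversion (\<open>symmetric_density\<close>).  It is a positive operator
  in the reduced C*-algebra.  Let \<open>r\<close> be the supremum of its spectrum.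

  If the spectrum has a gap below \<open>r\<close>, the powers of \<open>b / r\<close> converge geometrically, and their limit
  produces a nonnegative eigenfunction \<open>\<xi>\<close> in \<open>L\<^sup>2\<close> with eigenvalue \<open>r\<close> (\<open>gap_imp_finite\<close>).  Since \<open>b\<close> has a kernel
  that is positive almost everywhere and commutes with right translations, an argument of Perron-Frobenius type
  makes every right translate of \<open>\<xi>\<close> a multiple of \<open>\<xi>\<close>; left invariance of \<open>\<mu>\<close> then forces
  \<open>\<xi>\<close> to be constant (\<open>eigenfunction_imp_finite\<close>).  As \<open>\<xi>\<close> is square integrable, \<open>\<mu>\<close> is finite and the
  group is compact (\<open>finite_imp_compact\<close>).

  Otherwise the spectrum contains a strictly increasing sequence \<open>\<lambda>\<^sub>0 < \<lambda>\<^sub>1 < \<dots>\<close> of positive numbers.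
  Choose states \<open>\<sigma>\<^sub>n\<close> with \<open>\<sigma>\<^sub>n(p(b)) = p(\<lambda>\<^bsub>n+1\<^esub>)\<close> for all polynomials \<open>p\<close> with \<open>p(0) = 0\<close>, and continuous functions \<open>h\<^sub>m\<close>,
  decreasing in \<open>m\<close>,
  with values in \<open>[0, 1]\<close> that are \<open>0\<close> up to \<open>\<lambda>\<^sub>m\<close> and \<open>1\<close> from \<open>\<lambda>\<^bsub>m+1\<^esub>\<close> on.  For a functional \<open>\<phi>\<close> put
  \<open>L\<^sub>m = \<phi>(h\<^sub>m(b))\<close>.  Because \<open>\<Sum>\<^bsub>m<N\<^esub> \<epsilon>\<^sub>m (h\<^sub>m - h\<^bsub>m+1\<^esub>) + \<epsilon>\<^sub>N h\<^sub>N\<close> is bounded by \<open>1\<close> for unimodular \<open>\<epsilon>\<^sub>m\<close>, the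
  numbers \<open>L\<^sub>m - L\<^bsub>m+1\<^esub>\<close> and \<open>L\<^sub>\<infinity> = lim L\<^sub>m\<close> have absolute sum at most \<open>\<parallel>\<phi>\<parallel>\<close>.  Hence
  \<open>\<phi> \<mapsto> L\<^sub>\<infinity> \<sigma>\<^sub>0 + \<Sum>\<^sub>m (L\<^sub>m - L\<^bsub>m+1\<^esub>) \<sigma>\<^bsub>m+1\<^esub>\<close> is nonexpansive.  It maps the weak* compact convex set of
  all \<open>\<phi>\<close> in the unit ball with \<open>L\<^sub>0 = 1\<close> to itself.  A fixed point would satisfy \<open>L\<^bsub>m+1\<^esub> = L\<^sub>m - L\<^sub>\<infinity>\<close> for all \<open>m\<close>,
  so \<open>L\<^sub>\<infinity> = 0\<close> and \<open>L\<^sub>m = 1\<close> for all \<open>m\<close>, which is absurd (\<open>no_weak_star_fpp\<close>).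

  No functional calculus beyond polynomials is used: \<open>h\<^sub>m\<close> enters only through polynomial approximations,
  and the estimate of \<open>p(b)\<close> by the values of \<open>p\<close> on the spectrum (\<open>polyop_le_spectral\<close>) comes from factoring a
  polynomial over the complex numbers.\<close>

section \<open>A fixed point free nonexpansive map on the dual\<close>

lemma closedin_Collect_ball:
  assumes "\<And>i. i \<in> I \<Longrightarrow> closedin X {x \<in> topspace X. P i x}"
  shows "closedin X {x \<in> topspace X. \<forall>i\<in>I. P i x}"
proof (cases "I = {}")
  case False
  have "{x \<in> topspace X. \<forall>i\<in>I. P i x} = (\<Inter>i\<in>I. {x \<in> topspace X. P i x})" using False by auto
  then show ?thesis using assms False by (simp add: closedin_INT)
qed simp

lemma dual_space_points:
  "points (dual_space A) = {\<phi> \<in> points A \<rightarrow>\<^sub>E UNIV.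
     (\<forall>x\<in>points A. \<forall>y\<in>points A. \<phi> (plus_of A x y) = \<phi> x + \<phi> y) \<and>
     (\<forall>c. \<forall>x\<in>points A. \<phi> (scale_of A c x) = c * \<phi> x) \<and>
     (\<exists>K. \<forall>x\<in>points A. cmod (\<phi> x) \<le> K * norm_of A x)}"
  by (simp add: dual_space_def op_space_def bounded_ops_def complex_line_def)

lemma dist_of_dual_space:
  "dist_of (dual_space A) \<phi> \<psi> = Sup {cmod (\<phi> x - \<psi> x) | x. x \<in> points A \<and> norm_of A x \<le> 1}"
proof -
  have "{cmod (restrict (\<lambda>x. \<phi> x + restrict (\<lambda>x. - 1 * \<psi> x) (points A) x) (points A) x) |x. x \<in> points A \<and> norm_of A x \<le> 1}
     = {cmod (\<phi> x - \<psi> x) | x. x \<in> points A \<and> norm_of A x \<le> 1}" by auto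
  then show ?thesis by (simp add: dist_of_def dual_space_def op_space_def complex_line_def)
qed

text \<open>The closed unit ball of the dual space.  The norm condition is stated as \<open>\<bar>\<phi> x\<bar> \<le> \<parallel>x\<parallel>\<close> for all \<open>x\<close>; this is a
  pointwise closed condition and needs no norm axioms for \<open>A\<close>.\<close>

definition unit_dual :: "'v cnormed \<Rightarrow> ('v \<Rightarrow> complex) set" where
  "unit_dual A = {\<phi> \<in> points A \<rightarrow>\<^sub>E UNIV.
     (\<forall>x\<in>points A. \<forall>y\<in>points A. \<phi> (plus_of A x y) = \<phi> x + \<phi> y) \<and>
     (\<forall>c. \<forall>x\<in>points A. \<phi> (scale_of A c x) = c * \<phi> x) \<and>
     (\<forall>x\<in>points A. cmod (\<phi> x) \<le> norm_of A x)}"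

lemma unit_dual_subset: "unit_dual A \<subseteq> points (dual_space A)"
  unfolding unit_dual_def dual_space_points by (auto intro!: exI[of _ 1])

text \<open>The topology whose restriction to the dual is the weak* topology.\<close>

abbreviation pointwise_topology :: "'v cnormed \<Rightarrow> ('v \<Rightarrow> complex) topology" where
  "pointwise_topology A \<equiv> product_topology (\<lambda>_. euclidean) (points A)"

lemma continuous_map_eval:
  "continuous_map (pointwise_topology A) euclidean (\<lambda>\<phi>. \<phi> x)"
proof (cases "x \<in> points A")
  case False
  then have "undefined = \<phi> x" if "\<phi> \<in> topspace (pointwise_topology A)" for \<phi>
    using that by (auto simp: PiE_def extensional_def)
  moreover have "continuous_map (pointwise_topology A) euclidean (\<lambda>_. undefined)" by simp
  ultimately show ?thesis by (rule continuous_map_eq[rotated])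
qed (rule continuous_map_product_projection)

lemma closedin_eval_cond:
  assumes "closed C" "continuous_map (pointwise_topology A) euclidean f"
  shows "closedin (pointwise_topology A) {\<phi> \<in> topspace (pointwise_topology A). f \<phi> \<in> C}"
  using assms by (intro closedin_continuous_map_preimage[of _ euclidean]) auto

lemma closedin_unit_dual: "closedin (pointwise_topology A) (unit_dual A)"
proof -
  let ?X = "pointwise_topology A"
  have 1: "closedin ?X {\<phi> \<in> topspace ?X. \<forall>x\<in>points A. \<forall>y\<in>points A. \<phi> (plus_of A x y) = \<phi> x + \<phi> y}"
  proof (intro closedin_Collect_ball)
    fix x y
    have "closedin ?X {\<phi> \<in> topspace ?X. \<phi> (plus_of A x y) - (\<phi> x + \<phi> y) \<in> {0}}"
      by (intro closedin_eval_cond continuous_map_diff continuous_map_add continuous_map_eval) auto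
    then show "closedin ?X {\<phi> \<in> topspace ?X. \<phi> (plus_of A x y) = \<phi> x + \<phi> y}" by simp
  qed
  have 2: "closedin ?X {\<phi> \<in> topspace ?X. \<forall>c\<in>UNIV. \<forall>x\<in>points A. \<phi> (scale_of A c x) = c * \<phi> x}"
  proof (intro closedin_Collect_ball)
    fix c x
    have "continuous_map ?X euclidean (\<lambda>\<phi>. c * \<phi> x)"
      using continuous_map_compose[OF continuous_map_eval[of A x], of euclidean "(*) c"]
      by (simp add: o_def continuous_on_mult_left)
    then have "continuous_map ?X euclidean (\<lambda>\<phi>. \<phi> (scale_of A c x) - c * \<phi> x)"
      by (intro continuous_map_diff continuous_map_eval)
    then have "closedin ?X {\<phi> \<in> topspace ?X. \<phi> (scale_of A c x) - c * \<phi> x \<in> {0}}"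
      by (intro closedin_eval_cond) auto
    then show "closedin ?X {\<phi> \<in> topspace ?X. \<phi> (scale_of A c x) = c * \<phi> x}" by simp
  qed
  have 3: "closedin ?X {\<phi> \<in> topspace ?X. \<forall>x\<in>points A. cmod (\<phi> x) \<le> norm_of A x}"
  proof (intro closedin_Collect_ball)
    fix x
    have "closedin ?X {\<phi> \<in> topspace ?X. \<phi> x \<in> cball 0 (norm_of A x)}"
      by (intro closedin_eval_cond continuous_map_eval) auto
    then show "closedin ?X {\<phi> \<in> topspace ?X. cmod (\<phi> x) \<le> norm_of A x}" by simp
  qed
  have "unit_dual A = {\<phi> \<in> topspace ?X. \<forall>x\<in>points A. \<forall>y\<in>points A. \<phi> (plus_of A x y) = \<phi> x + \<phi> y} \<inter>
     ({\<phi> \<in> topspace ?X. \<forall>c\<in>UNIV. \<forall>x\<in>points A. \<phi> (scale_of A c x) = c * \<phi> x} \<inter>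
      {\<phi> \<in> topspace ?X. \<forall>x\<in>points A. cmod (\<phi> x) \<le> norm_of A x})"
    unfolding unit_dual_def by auto
  then show ?thesis using 1 2 3 by (simp add: closedin_Int)
qed

text \<open>Banach-Alaoglu.\<close>

lemma compactin_unit_dual: "compactin (pointwise_topology A) (unit_dual A)"
proof (rule closed_compactin)
  show "compactin (pointwise_topology A) (PiE (points A) (\<lambda>x. cball 0 (norm_of A x)))"
    by (subst compactin_PiE) auto
  show "unit_dual A \<subseteq> PiE (points A) (\<lambda>x. cball 0 (norm_of A x))"
    unfolding unit_dual_def by (auto simp: PiE_iff extensional_def)
qed (rule closedin_unit_dual)

text \<open>If a sequence in the unit ball converges on some elements, the limits are attained by a functional in the ball.\<close>

lemma unit_dual_cluster:
  fixes f :: "'i \<Rightarrow> 'v"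
  assumes \<phi>: "\<And>j. \<phi> j \<in> unit_dual A" and lim: "\<And>p. (\<lambda>j. \<phi> j (f p)) \<longlonglongrightarrow> c p"
  shows "\<exists>\<psi>\<in>unit_dual A. \<forall>p. \<psi> (f p) = c p"
proof (rule ccontr)
  let ?X = "pointwise_topology A"
  assume no: "\<not> (\<exists>\<psi>\<in>unit_dual A. \<forall>p. \<psi> (f p) = c p)"
  define U where "U = (\<lambda>(p, k::nat). {\<psi> \<in> topspace ?X. dist (\<psi> (f p)) (c p) > 1 / Suc k})"
  have op: "openin ?X (U pk)" for pk
  proof -
    obtain p k where pk: "pk = (p, k)" by fastforce
    have "openin ?X {\<psi> \<in> topspace ?X. \<psi> (f p) \<in> - cball (c p) (1 / Suc k)}"
      by (rule openin_continuous_map_preimage[OF continuous_map_eval]) auto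
    then show ?thesis unfolding pk U_def by (simp add: dist_commute not_le)
  qed
  have cov: "unit_dual A \<subseteq> \<Union>(range U)"
  proof
    fix \<psi> assume \<psi>: "\<psi> \<in> unit_dual A"
    then obtain p where "\<psi> (f p) \<noteq> c p" using no by blast
    then have "dist (\<psi> (f p)) (c p) > 0" by simp
    then obtain k where "1 / Suc k < dist (\<psi> (f p)) (c p)" by (metis nat_approx_posE)
    moreover have "\<psi> \<in> topspace ?X" using \<psi> by (auto simp: unit_dual_def)
    ultimately have "\<psi> \<in> U (p, k)" by (simp add: U_def)
    then show "\<psi> \<in> \<Union>(range U)" by blast
  qed
  obtain F where "finite F" "F \<subseteq> range U" "unit_dual A \<subseteq> \<Union>F"
    using compactinD[OF compactin_unit_dual _ cov] op by blast
  then obtain I where I: "finite I" "unit_dual A \<subseteq> \<Union>(U ` I)"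
    by (metis finite_subset_image)
  have "\<forall>\<^sub>F j in sequentially. \<phi> j \<notin> U pk" for pk
  proof -
    obtain p k where pk: "pk = (p, k)" by fastforce
    have "\<forall>\<^sub>F j in sequentially. dist (\<phi> j (f p)) (c p) < 1 / Suc k"
      using lim[of p] by (rule tendstoD) simp
    then show ?thesis by eventually_elim (auto simp: pk U_def)
  qed
  then have "\<forall>\<^sub>F j in sequentially. \<forall>pk\<in>I. \<phi> j \<notin> U pk" using I(1) by (simp add: eventually_ball_finite)
  then obtain j where "\<forall>pk\<in>I. \<phi> j \<notin> U pk" by (auto simp: eventually_sequentially)
  then show False using I(2) \<phi>[of j] by blast
qed

text \<open>A representation of polynomials in \<open>A\<close>.  The element \<open>Q p\<close> stands for \<open>a p(a)\<close>, where \<open>a\<close> is a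
  positive operator with spectrum in \<open>[0, r]\<close>; the factor \<open>a\<close> is built in because \<open>A\<close> may have no unit.
  Accordingly the norm of \<open>Q p\<close> is controlled by \<open>t p(t)\<close>.\<close>

locale poly_repr =
  fixes A :: "'v cnormed" and Q :: "complex poly \<Rightarrow> 'v" and r :: real
  assumes Q_mem: "\<And>p. Q p \<in> points A"
    and Q_add: "\<And>p q. Q (p + q) = plus_of A (Q p) (Q q)"
    and Q_smult: "\<And>c p. Q (smult c p) = scale_of A c (Q p)"
    and Q_norm: "\<And>p C. (\<And>t. 0 \<le> t \<Longrightarrow> t \<le> r \<Longrightarrow> cmod (of_real t * poly p (of_real t)) \<le> C) \<Longrightarrow>
        norm_of A (Q p) \<le> C"
    and r_nonneg: "0 \<le> r"
begin

text \<open>Functionals that are linear on the image of \<open>Q\<close> and of norm at most \<open>d\<close> there, the norm of \<open>Q p\<close> being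
  measured by the supremum of \<open>t p(t)\<close>.\<close>

definition bounded_repr :: "real \<Rightarrow> ('v \<Rightarrow> complex) \<Rightarrow> bool" where
  "bounded_repr d \<theta> \<longleftrightarrow> (\<forall>p q. \<theta> (Q (p + q)) = \<theta> (Q p) + \<theta> (Q q)) \<and>
     (\<forall>c p. \<theta> (Q (smult c p)) = c * \<theta> (Q p)) \<and>
     (\<forall>p C. (\<forall>t. 0 \<le> t \<and> t \<le> r \<longrightarrow> cmod (of_real t * poly p (of_real t)) \<le> C) \<longrightarrow> cmod (\<theta> (Q p)) \<le> d * C)"

lemma bounded_reprD:
  assumes "bounded_repr d \<theta>"
  shows "\<theta> (Q (p + q)) = \<theta> (Q p) + \<theta> (Q q)" "\<theta> (Q (smult c p)) = c * \<theta> (Q p)"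
    "(\<And>t. 0 \<le> t \<Longrightarrow> t \<le> r \<Longrightarrow> cmod (of_real t * poly p (of_real t)) \<le> C) \<Longrightarrow> cmod (\<theta> (Q p)) \<le> d * C"
  using assms unfolding bounded_repr_def by auto

lemma bounded_repr_0: assumes "bounded_repr d \<theta>" shows "\<theta> (Q 0) = 0"
  using bounded_reprD(2)[OF assms, of 0 0] by simp

lemma bounded_repr_diff: assumes "bounded_repr d \<theta>" shows "\<theta> (Q (p - q)) = \<theta> (Q p) - \<theta> (Q q)"
  using bounded_reprD(1)[OF assms, of p "smult (-1) q"] bounded_reprD(2)[OF assms, of "-1" q] by simp

lemma bounded_repr_sum: assumes "bounded_repr d \<theta>" shows "\<theta> (Q (\<Sum>i\<in>I. p i)) = (\<Sum>i\<in>I. \<theta> (Q (p i)))"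
  by (induction I rule: infinite_finite_induct)
     (auto simp: bounded_repr_0[OF assms] bounded_reprD(1)[OF assms])

lemma unit_dual_bounded_repr: "\<phi> \<in> unit_dual A \<Longrightarrow> bounded_repr 1 \<phi>"
proof -
  assume \<phi>: "\<phi> \<in> unit_dual A"
  have "cmod (\<phi> (Q p)) \<le> C"
    if "\<forall>t. 0 \<le> t \<and> t \<le> r \<longrightarrow> cmod (of_real t * poly p (of_real t)) \<le> C" for p C
  proof -
    have "cmod (\<phi> (Q p)) \<le> norm_of A (Q p)" using \<phi> Q_mem by (auto simp: unit_dual_def)
    also have "\<dots> \<le> C" using that by (intro Q_norm) auto
    finally show ?thesis .
  qed
  then show ?thesis
    using \<phi> Q_mem unfolding bounded_repr_def unit_dual_def by (auto simp: Q_add Q_smult)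
qed

lemma unit_dual_diff_bounded_repr:
  assumes "\<phi> \<in> unit_dual A" "\<psi> \<in> unit_dual A"
  shows "bounded_repr (dist_of (dual_space A) \<phi> \<psi>) (\<lambda>x. \<phi> x - \<psi> x)"
proof -
  let ?S = "{cmod (\<phi> x - \<psi> x) | x. x \<in> points A \<and> norm_of A x \<le> 1}"
  have bd: "bdd_above ?S"
  proof (rule bdd_aboveI[of _ 2], clarify)
    fix x assume x: "x \<in> points A" "norm_of A x \<le> 1"
    have "cmod (\<phi> x) \<le> norm_of A x" "cmod (\<psi> x) \<le> norm_of A x"
      using assms x by (auto simp: unit_dual_def)
    then show "cmod (\<phi> x - \<psi> x) \<le> 2" using x norm_triangle_ineq4[of "\<phi> x" "\<psi> x"] by linarith
  qed
  have up: "cmod (\<phi> x - \<psi> x) \<le> dist_of (dual_space A) \<phi> \<psi>" if "x \<in> points A" "norm_of A x \<le> 1" for x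
    unfolding dist_of_dual_space using that by (intro cSup_upper bd) auto
  have a: "bounded_repr 1 \<phi>" "bounded_repr 1 \<psi>" using assms unit_dual_bounded_repr by auto
  have b: "cmod (\<phi> (Q p) - \<psi> (Q p)) \<le> dist_of (dual_space A) \<phi> \<psi> * C"
    if C: "\<forall>t. 0 \<le> t \<and> t \<le> r \<longrightarrow> cmod (of_real t * poly p (of_real t)) \<le> C" for p C
  proof (cases "C = 0")
    case True
    then have C0: "cmod (of_real t * poly p (of_real t)) \<le> 0" if "0 \<le> t" "t \<le> r" for t
      using C that by blast
    have "cmod (\<phi> (Q p)) \<le> 1 * 0" by (rule bounded_reprD(3)[OF a(1)]) (rule C0)
    moreover have "cmod (\<psi> (Q p)) \<le> 1 * 0" by (rule bounded_reprD(3)[OF a(2)]) (rule C0)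
    ultimately show ?thesis using True by simp
  next
    case False
    have "0 \<le> cmod (of_real 0 * poly p (of_real 0))" by simp
    also have "\<dots> \<le> C" using C r_nonneg by blast
    finally have Cp: "C > 0" using False by simp
    have "norm_of A (Q (smult (of_real (1 / C)) p)) \<le> 1"
    proof (rule Q_norm)
      fix t assume t: "0 \<le> t" "t \<le> r"
      have "cmod (of_real t * poly (smult (of_real (1 / C)) p) (of_real t)) = cmod (of_real t * poly p (of_real t)) / C"
        using Cp by (simp add: norm_mult norm_divide)
      also have "\<dots> \<le> 1" using C t Cp by (simp add: divide_le_eq)
      finally show "cmod (of_real t * poly (smult (of_real (1 / C)) p) (of_real t)) \<le> 1" .
    qed
    then have "cmod (\<phi> (Q (smult (of_real (1 / C)) p)) - \<psi> (Q (smult (of_real (1 / C)) p))) \<le> dist_of (dual_space A) \<phi> \<psi>"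
      by (intro up Q_mem)
    then have "cmod (of_real (1 / C) * (\<phi> (Q p) - \<psi> (Q p))) \<le> dist_of (dual_space A) \<phi> \<psi>"
      by (simp only: bounded_reprD(2)[OF a(1)] bounded_reprD(2)[OF a(2)] right_diff_distrib)
    then show ?thesis using Cp by (simp add: norm_divide divide_le_eq)
  qed
  show ?thesis unfolding bounded_repr_def
    using b by (auto simp: bounded_reprD(1,2)[OF a(1)] bounded_reprD(1,2)[OF a(2)] algebra_simps)
qed

end

text \<open>The continuous piecewise linear function that is \<open>0\<close> up to \<open>lam m\<close> and \<open>1\<close> from \<open>lam (Suc m)\<close> on.\<close>

definition ramp :: "(nat \<Rightarrow> real) \<Rightarrow> nat \<Rightarrow> real \<Rightarrow> real" where
  "ramp lam m t = max 0 (min 1 ((t - lam m) / (lam (Suc m) - lam m)))"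

text \<open>States \<open>sig n\<close> that evaluate \<open>a p(a)\<close> at the point \<open>lam (Suc n)\<close>, and polynomials \<open>q m k\<close> such that
  \<open>t \<cdot> q m k\<close> approximates the \<open>m\<close>-th ramp.  With the shift by one in the index, the \<open>m\<close>-th ramp takes the value
  \<open>1\<close> at the point of \<open>sig n\<close> exactly when \<open>m \<le> n\<close>, so the ramp with number \<open>0\<close> has value \<open>1\<close> in every state.\<close>

locale spectral_states = poly_repr +
  fixes lam :: "nat \<Rightarrow> real" and q :: "nat \<Rightarrow> nat \<Rightarrow> complex poly" and sig :: "nat \<Rightarrow> 'a \<Rightarrow> complex"
  assumes lam_less: "\<And>n. lam n < lam (Suc n)" and lam_pos: "\<And>n. 0 < lam n" and lam_le: "\<And>n. lam n \<le> r"
    and q_approx: "\<And>m k t. 0 \<le> t \<Longrightarrow> t \<le> r \<Longrightarrow>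
       cmod (of_real t * poly (q m k) (of_real t) - of_real (ramp lam m t)) \<le> 1 / Suc k"
    and sig_mem: "\<And>n. sig n \<in> unit_dual A"
    and sig_Q: "\<And>n p. sig n (Q p) = of_real (lam (Suc n)) * poly p (of_real (lam (Suc n)))"
begin

lemma ramp_bounds: "0 \<le> ramp lam m t" "ramp lam m t \<le> 1"
  by (auto simp: ramp_def)

lemma ramp_antimono: "ramp lam (Suc m) t \<le> ramp lam m t"
proof (cases "t \<le> lam (Suc m)")
  case True
  then have "(t - lam (Suc m)) / (lam (Suc (Suc m)) - lam (Suc m)) \<le> 0"
    using lam_less[of "Suc m"] by (intro divide_nonpos_pos) auto
  then have "ramp lam (Suc m) t = 0" by (simp add: ramp_def)
  then show ?thesis using ramp_bounds by simp
next
  case False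
  then have "(t - lam m) / (lam (Suc m) - lam m) \<ge> 1"
    using lam_less[of m] by (simp add: le_divide_eq)
  then have "ramp lam m t = 1" by (simp add: ramp_def)
  then show ?thesis using ramp_bounds by simp
qed

lemma lam_mono: "strict_mono lam"
  using lam_less by (simp add: strict_mono_Suc_iff)

lemma ramp_lam: "ramp lam m (lam j) = (if m < j then 1 else 0)"
proof (cases "m < j")
  case True
  then have "lam (Suc m) \<le> lam j" using lam_mono by (simp add: strict_mono_less_eq Suc_le_eq)
  then have "(lam j - lam m) / (lam (Suc m) - lam m) \<ge> 1"
    using lam_less[of m] by (simp add: le_divide_eq)
  then show ?thesis using True by (simp add: ramp_def)
next
  case False
  then have "lam j \<le> lam m" using lam_mono by (simp add: strict_mono_less_eq)
  then have "(lam j - lam m) / (lam (Suc m) - lam m) \<le> 0"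
    using lam_less[of m] by (intro divide_nonpos_pos) auto
  then show ?thesis using False by (simp add: ramp_def)
qed

text \<open>The value of a functional on the \<open>m\<close>-th ramp function of \<open>a\<close>, defined through the approximating polynomials.\<close>

definition L :: "nat \<Rightarrow> ('a \<Rightarrow> complex) \<Rightarrow> complex" where
  "L m \<theta> = lim (\<lambda>k. \<theta> (Q (q m k)))"

lemma L_Cauchy:
  assumes "bounded_repr d \<theta>"
  shows "cmod (\<theta> (Q (q m k)) - \<theta> (Q (q m l))) \<le> d * (1 / Suc k + 1 / Suc l)"
proof -
  have "cmod (\<theta> (Q (q m k - q m l))) \<le> d * (1 / Suc k + 1 / Suc l)"
  proof (rule bounded_reprD(3)[OF assms])
    fix t assume t: "0 \<le> t" "t \<le> r"
    have "of_real t * poly (q m k - q m l) (of_real t) =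
       (of_real t * poly (q m k) (of_real t) - of_real (ramp lam m t)) - (of_real t * poly (q m l) (of_real t) - of_real (ramp lam m t))"
      by (simp add: algebra_simps)
    then show "cmod (of_real t * poly (q m k - q m l) (of_real t)) \<le> 1 / Suc k + 1 / Suc l"
      using norm_triangle_ineq4 q_approx[OF t, of m k] q_approx[OF t, of m l] by (smt (verit))
  qed
  then show ?thesis by (simp add: bounded_repr_diff[OF assms])
qed

lemma one_over_Suc_tendsto: "(\<lambda>k. 1 / real (Suc k)) \<longlonglongrightarrow> 0"
  using LIMSEQ_inverse_real_of_nat by (simp add: inverse_eq_divide)

lemma L_tendsto:
  assumes "bounded_repr d \<theta>"
  shows "(\<lambda>k. \<theta> (Q (q m k))) \<longlonglongrightarrow> L m \<theta>"
proof -
  have d: "0 \<le> d"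
    using order_trans[OF norm_ge_zero L_Cauchy[OF assms, of 0 0 0]] by simp
  have "Cauchy (\<lambda>k. \<theta> (Q (q m k)))"
  proof (rule metric_CauchyI)
    fix e :: real assume e: "e > 0"
    have "(\<lambda>k. 2 * d * (1 / real (Suc k))) \<longlonglongrightarrow> 2 * d * 0"
      by (intro tendsto_intros one_over_Suc_tendsto)
    then have "\<forall>\<^sub>F k in sequentially. 2 * d * (1 / real (Suc k)) < e"
      using e by (auto dest: order_tendstoD(2))
    then obtain M where M: "2 * d * (1 / real (Suc M)) < e" by (auto simp: eventually_sequentially)
    have "dist (\<theta> (Q (q m k))) (\<theta> (Q (q m l))) < e" if "k \<ge> M" "l \<ge> M" for k l
    proof -
      have "dist (\<theta> (Q (q m k))) (\<theta> (Q (q m l))) \<le> d * (1 / Suc k + 1 / Suc l)"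
        unfolding dist_norm by (rule L_Cauchy[OF assms])
      also have "\<dots> \<le> d * (1 / Suc M + 1 / Suc M)"
        using that d by (intro mult_left_mono add_mono divide_left_mono) auto
      also have "\<dots> = 2 * d * (1 / Suc M)" by simp
      finally show ?thesis using M by linarith
    qed
    then show "\<exists>M. \<forall>m'\<ge>M. \<forall>n\<ge>M. dist (\<theta> (Q (q m m'))) (\<theta> (Q (q m n))) < e" by blast
  qed
  then show ?thesis unfolding L_def by (simp add: Cauchy_convergent_iff convergent_LIMSEQ_iff)
qed

lemma L_approx:
  assumes "bounded_repr d \<theta>"
  shows "cmod (\<theta> (Q (q m k)) - L m \<theta>) \<le> d * (1 / Suc k)"
proof (rule LIMSEQ_le)
  show "(\<lambda>l. cmod (\<theta> (Q (q m k)) - \<theta> (Q (q m l)))) \<longlonglongrightarrow> cmod (\<theta> (Q (q m k)) - L m \<theta>)"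
    by (intro tendsto_intros L_tendsto[OF assms])
  have "(\<lambda>l. d * (1 / Suc k + 1 / Suc l)) \<longlonglongrightarrow> d * (1 / Suc k + 0)"
    by (intro tendsto_intros one_over_Suc_tendsto)
  then show "(\<lambda>l. d * (1 / Suc k + 1 / Suc l)) \<longlonglongrightarrow> d * (1 / Suc k)" by simp
qed (use L_Cauchy[OF assms] in blast)

text \<open>The ramps decrease with values in \<open>[0, 1]\<close>, so combinations of their differences with unimodular coefficients have
  supremum norm at most \<open>1\<close>.  This bounds the values of a functional on the differences in the \<open>\<ell>\<^sup>1\<close> norm.\<close>

lemma L_variation:
  assumes "bounded_repr d \<theta>"
  shows "(\<Sum>n<N. cmod (L n \<theta> - L (Suc n) \<theta>)) + cmod (L N \<theta>) \<le> d"
proof -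
  \<comment> \<open>the phases that turn the values of \<open>\<theta>\<close> into their moduli\<close>
  define e where "e n = cnj (sgn (if n < N then L n \<theta> - L (Suc n) \<theta> else L n \<theta>))" for n
  have sg: "cnj (sgn z) * z = of_real (cmod z)" for z :: complex
  proof (cases "z = 0")
    case False
    have "cnj (sgn z) * z = cnj z * z / of_real (cmod z)" by (simp add: sgn_eq)
    also have "\<dots> = of_real ((cmod z)\<^sup>2) / of_real (cmod z)"
      by (simp only: complex_norm_square mult.commute)
    finally show ?thesis using False by (simp add: power2_eq_square)
  qed simp
  have e1: "cmod (e n) \<le> 1" for n by (simp add: e_def norm_sgn)
  define p where "p k = (\<Sum>n<N. smult (e n) (q n k - q (Suc n) k)) + smult (e N) (q N k)" for k
  have pe: "\<theta> (Q (p k)) = (\<Sum>n<N. e n * (\<theta> (Q (q n k)) - \<theta> (Q (q (Suc n) k)))) + e N * \<theta> (Q (q N k))" for k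
    by (simp add: p_def bounded_reprD(1,2)[OF assms] bounded_repr_sum[OF assms] bounded_repr_diff[OF assms])
  have bound: "cmod (\<theta> (Q (p k))) \<le> d * (1 + (2 * N + 1) * (1 / Suc k))" for k
  proof (rule bounded_reprD(3)[OF assms])
    fix t assume t: "0 \<le> t" "t \<le> r"
    let ?\<epsilon> = "1 / real (Suc k)"
    define a where "a n = of_real t * poly (q n k) (of_real t)" for n
    have a: "cmod (a n - of_real (ramp lam n t)) \<le> ?\<epsilon>" for n
      unfolding a_def by (rule q_approx[OF t])
    have d1: "cmod (a n - a (Suc n)) \<le> (ramp lam n t - ramp lam (Suc n) t) + 2 * ?\<epsilon>" for n
    proof -
      have "a n - a (Suc n) = (a n - of_real (ramp lam n t)) - (a (Suc n) - of_real (ramp lam (Suc n) t)) + of_real (ramp lam n t - ramp lam (Suc n) t)"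
        by simp
      also have "cmod \<dots> \<le> cmod ((a n - of_real (ramp lam n t)) - (a (Suc n) - of_real (ramp lam (Suc n) t))) + \<bar>ramp lam n t - ramp lam (Suc n) t\<bar>"
        using norm_triangle_ineq[of _ "of_real (ramp lam n t - ramp lam (Suc n) t) :: complex"] by (simp only: norm_of_real)
      also have "\<dots> \<le> cmod (a n - of_real (ramp lam n t)) + cmod (a (Suc n) - of_real (ramp lam (Suc n) t)) + \<bar>ramp lam n t - ramp lam (Suc n) t\<bar>"
        by (intro add_right_mono norm_triangle_ineq4)
      finally have "cmod (a n - a (Suc n)) \<le> cmod (a n - of_real (ramp lam n t)) + cmod (a (Suc n) - of_real (ramp lam (Suc n) t)) + \<bar>ramp lam n t - ramp lam (Suc n) t\<bar>" .
      then show ?thesis using a[of n] a[of "Suc n"] ramp_antimono[of n t] by linarith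
    qed
    have d2: "cmod (a N) \<le> ramp lam N t + ?\<epsilon>"
    proof -
      have "cmod (a N) \<le> cmod (a N - of_real (ramp lam N t)) + cmod (of_real (ramp lam N t))"
        using norm_triangle_ineq[of "a N - of_real (ramp lam N t)" "of_real (ramp lam N t)"] by simp
      then show ?thesis using a[of N] ramp_bounds(1)[of N t] by simp
    qed
    have "of_real t * poly (p k) (of_real t) = (\<Sum>n<N. e n * (a n - a (Suc n))) + e N * a N"
      by (simp add: p_def a_def poly_sum sum_distrib_left algebra_simps)
    then have "cmod (of_real t * poly (p k) (of_real t)) \<le> (\<Sum>n<N. cmod (e n * (a n - a (Suc n)))) + cmod (e N * a N)"
      by (simp add: norm_triangle_le norm_sum)
    also have "\<dots> \<le> (\<Sum>n<N. (ramp lam n t - ramp lam (Suc n) t) + 2 * ?\<epsilon>) + (ramp lam N t + ?\<epsilon>)"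
    proof (intro add_mono sum_mono)
      show "cmod (e n * (a n - a (Suc n))) \<le> (ramp lam n t - ramp lam (Suc n) t) + 2 * ?\<epsilon>" for n
        using mult_mono[OF e1[of n] d1[of n]] by (simp add: norm_mult)
      show "cmod (e N * a N) \<le> ramp lam N t + ?\<epsilon>"
        using mult_mono[OF e1[of N] d2] by (simp add: norm_mult)
    qed
    also have "\<dots> = ramp lam 0 t + (2 * N + 1) * ?\<epsilon>"
    proof -
      have "(\<Sum>n<N. (ramp lam n t - ramp lam (Suc n) t) + 2 * ?\<epsilon>) = (\<Sum>n<N. ramp lam n t - ramp lam (Suc n) t) + N * (2 * ?\<epsilon>)"
        by (simp only: sum.distrib) simp
      moreover have "(\<Sum>n<N. ramp lam n t - ramp lam (Suc n) t) = ramp lam 0 t - ramp lam N t"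
        by (rule sum_lessThan_telescope')
      moreover have "real (2 * N + 1) * ?\<epsilon> = N * (2 * ?\<epsilon>) + ?\<epsilon>" by (simp add: field_simps)
      ultimately show ?thesis by linarith
    qed
    also have "\<dots> \<le> 1 + (2 * N + 1) * ?\<epsilon>" using ramp_bounds(2)[of 0 t] by simp
    finally show "cmod (of_real t * poly (p k) (of_real t)) \<le> 1 + (2 * N + 1) * ?\<epsilon>" by simp
  qed
  have lim: "(\<lambda>k. \<theta> (Q (p k))) \<longlonglongrightarrow> (\<Sum>n<N. e n * (L n \<theta> - L (Suc n) \<theta>)) + e N * L N \<theta>"
    unfolding pe by (intro tendsto_intros L_tendsto[OF assms])
  have "(\<Sum>n<N. e n * (L n \<theta> - L (Suc n) \<theta>)) + e N * L N \<theta>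
     = of_real ((\<Sum>n<N. cmod (L n \<theta> - L (Suc n) \<theta>)) + cmod (L N \<theta>))"
    by (simp add: e_def sg)
  then have eq: "cmod ((\<Sum>n<N. e n * (L n \<theta> - L (Suc n) \<theta>)) + e N * L N \<theta>)
     = (\<Sum>n<N. cmod (L n \<theta> - L (Suc n) \<theta>)) + cmod (L N \<theta>)"
    by (simp only: norm_of_real) (simp add: sum_nonneg)
  have "(\<lambda>k. d * (1 + (2 * N + 1) * (1 / Suc k))) \<longlonglongrightarrow> d * (1 + real (2 * N + 1) * 0)"
    by (intro tendsto_intros one_over_Suc_tendsto)
  then have "(\<lambda>k. d * (1 + (2 * N + 1) * (1 / Suc k))) \<longlonglongrightarrow> d" by simp
  then have "cmod ((\<Sum>n<N. e n * (L n \<theta> - L (Suc n) \<theta>)) + e N * L N \<theta>) \<le> d"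
    using bound by (intro LIMSEQ_le[OF tendsto_norm[OF lim]]) auto
  then show ?thesis unfolding eq .
qed

text \<open>The part of a functional that lives beyond all ramps.\<close>

definition Linf :: "('a \<Rightarrow> complex) \<Rightarrow> complex" where
  "Linf \<theta> = lim (\<lambda>m. L m \<theta>)"

lemma L_variation_summable:
  assumes "bounded_repr d \<theta>"
  shows "summable (\<lambda>n. cmod (L n \<theta> - L (Suc n) \<theta>))"
proof (rule bounded_imp_summable[where B = d])
  show "(\<Sum>n\<le>N. cmod (L n \<theta> - L (Suc n) \<theta>)) \<le> d" for N
    using L_variation[OF assms, of "Suc N"] norm_ge_zero[of "L (Suc N) \<theta>"]
    by (simp only: lessThan_Suc_atMost)
qed simp

lemma Linf_tendsto:
  assumes "bounded_repr d \<theta>"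
  shows "(\<lambda>m. L m \<theta>) \<longlonglongrightarrow> Linf \<theta>"
proof -
  have "summable (\<lambda>n. L n \<theta> - L (Suc n) \<theta>)"
    using L_variation_summable[OF assms] by (rule summable_norm_cancel)
  then have "convergent (\<lambda>N. \<Sum>n<N. L n \<theta> - L (Suc n) \<theta>)"
    by (simp add: summable_iff_convergent)
  then obtain l where "(\<lambda>N. \<Sum>n<N. L n \<theta> - L (Suc n) \<theta>) \<longlonglongrightarrow> l" by (auto simp: convergent_def)
  then have "(\<lambda>N. L 0 \<theta> - L N \<theta>) \<longlonglongrightarrow> l" by (simp only: sum_lessThan_telescope'[of "\<lambda>n. L n \<theta>"])
  then have "(\<lambda>N. L 0 \<theta> - (L 0 \<theta> - L N \<theta>)) \<longlonglongrightarrow> L 0 \<theta> - l" by (intro tendsto_intros)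
  then have "convergent (\<lambda>N. L N \<theta>)" by (auto simp: convergent_def)
  then show ?thesis unfolding Linf_def by (simp add: convergent_LIMSEQ_iff)
qed

lemma coeff_sums:
  assumes "bounded_repr d \<theta>"
  shows "(\<lambda>n. L (n + m) \<theta> - L (Suc (n + m)) \<theta>) sums (L m \<theta> - Linf \<theta>)"
proof -
  have "(\<lambda>n. L (n + m) \<theta>) \<longlonglongrightarrow> Linf \<theta>"
    using Linf_tendsto[OF assms] by (rule LIMSEQ_ignore_initial_segment)
  from telescope_sums'[OF this] show ?thesis by simp
qed

lemma Linf_variation:
  assumes "bounded_repr d \<theta>"
  shows "cmod (Linf \<theta>) + (\<Sum>n. cmod (L n \<theta> - L (Suc n) \<theta>)) \<le> d"
proof -
  have "(\<lambda>N. (\<Sum>n<N. cmod (L n \<theta> - L (Suc n) \<theta>)) + cmod (L N \<theta>)) \<longlonglongrightarrow>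
     (\<Sum>n. cmod (L n \<theta> - L (Suc n) \<theta>)) + cmod (Linf \<theta>)"
    by (intro tendsto_intros Linf_tendsto[OF assms] summable_LIMSEQ L_variation_summable[OF assms])
  then have "(\<Sum>n. cmod (L n \<theta> - L (Suc n) \<theta>)) + cmod (Linf \<theta>) \<le> d"
    by (rule LIMSEQ_le_const2) (use L_variation[OF assms] in blast)
  then show ?thesis by simp
qed

text \<open>The fixed point free map.  It moves the mass of the \<open>n\<close>-th ramp difference to the state \<open>sig (Suc n)\<close>, one step
  beyond \<open>sig n\<close>, and brings the mass at infinity back to \<open>sig 0\<close>.\<close>

definition shift :: "('a \<Rightarrow> complex) \<Rightarrow> ('a \<Rightarrow> complex)" where
  "shift \<phi> = (\<lambda>x. Linf \<phi> * sig 0 x + (\<Sum>n. (L n \<phi> - L (Suc n) \<phi>) * sig (Suc n) x))"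

text \<open>The weak* compact convex set on which \<open>shift\<close> acts.\<close>

definition slice :: "('a \<Rightarrow> complex) set" where
  "slice = {\<phi> \<in> unit_dual A. L 0 \<phi> = 1}"

lemma sig_bound: "x \<in> points A \<Longrightarrow> cmod (sig n x) \<le> norm_of A x"
  using sig_mem[of n] by (simp add: unit_dual_def)

lemma summable_weighted:
  assumes "bounded_repr d \<theta>" "\<And>n. cmod (z n) \<le> B"
  shows "summable (\<lambda>n. cmod ((L n \<theta> - L (Suc n) \<theta>) * z n))"
proof (rule summable_comparison_test)
  show "\<exists>N. \<forall>n\<ge>N. norm (cmod ((L n \<theta> - L (Suc n) \<theta>) * z n)) \<le> cmod (L n \<theta> - L (Suc n) \<theta>) * B"
    using assms(2) by (simp add: norm_mult mult_left_mono)
  show "summable (\<lambda>n. cmod (L n \<theta> - L (Suc n) \<theta>) * B)"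
    by (intro summable_mult2 L_variation_summable[OF assms(1)])
qed

text \<open>The estimate behind both the invariance of the set \<open>slice\<close> and the nonexpansiveness of \<open>shift\<close>.\<close>

lemma weighted_bound:
  assumes \<theta>: "bounded_repr d \<theta>" and z: "\<And>n. cmod (z n) \<le> B"
  shows "cmod (Linf \<theta> * z 0 + (\<Sum>n. (L n \<theta> - L (Suc n) \<theta>) * z (Suc n))) \<le> d * B"
proof -
  have B: "0 \<le> B" using z[of 0] norm_ge_zero order_trans by blast
  let ?c = "\<lambda>n. L n \<theta> - L (Suc n) \<theta>"
  have s: "summable (\<lambda>n. cmod (?c n * z (Suc n)))"
    by (rule summable_weighted[OF \<theta>]) (rule z)
  have "cmod (Linf \<theta> * z 0 + (\<Sum>n. ?c n * z (Suc n))) \<le> cmod (Linf \<theta>) * B + (\<Sum>n. cmod (?c n * z (Suc n)))"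
    using norm_triangle_ineq[of "Linf \<theta> * z 0" "\<Sum>n. ?c n * z (Suc n)"] summable_norm[OF s]
      mult_left_mono[OF z[of 0], of "cmod (Linf \<theta>)"] by (simp add: norm_mult)
  also have "(\<Sum>n. cmod (?c n * z (Suc n))) \<le> (\<Sum>n. cmod (?c n) * B)"
    using z by (intro suminf_le s summable_mult2 L_variation_summable[OF \<theta>]) (simp add: norm_mult mult_left_mono)
  also have "\<dots> = (\<Sum>n. cmod (?c n)) * B"
    by (rule suminf_mult2[symmetric, OF L_variation_summable[OF \<theta>]])
  also have "cmod (Linf \<theta>) * B + (\<Sum>n. cmod (?c n)) * B \<le> d * B"
    using mult_right_mono[OF Linf_variation[OF \<theta>] B] by (simp add: algebra_simps)
  finally show ?thesis by simp
qed

lemma suminf_shift_add: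
  assumes "bounded_repr d \<theta>" "\<And>n. cmod (z n) \<le> B" "\<And>n. cmod (w n) \<le> B'"
  shows "(\<Sum>n. (L n \<theta> - L (Suc n) \<theta>) * (z n + w n)) =
    (\<Sum>n. (L n \<theta> - L (Suc n) \<theta>) * z n) + (\<Sum>n. (L n \<theta> - L (Suc n) \<theta>) * w n)"
  unfolding distrib_left
  by (rule suminf_add[symmetric])
     (use summable_weighted[OF assms(1,2)] summable_weighted[OF assms(1,3)] in \<open>auto intro: summable_norm_cancel\<close>)

lemma L_sig: "L m (sig n) = (if m \<le> n then 1 else 0)"
proof -
  have b: "bounded_repr 1 (sig n)" by (rule unit_dual_bounded_repr[OF sig_mem])
  have "(\<lambda>k. sig n (Q (q m k)) - of_real (ramp lam m (lam (Suc n)))) \<longlonglongrightarrow> 0"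
  proof (rule Lim_null_comparison)
    show "\<forall>\<^sub>F k in sequentially. cmod (sig n (Q (q m k)) - of_real (ramp lam m (lam (Suc n)))) \<le> 1 / Suc k"
      using q_approx[of "lam (Suc n)"] lam_pos[of "Suc n"] lam_le[of "Suc n"] by (simp add: sig_Q)
  qed (rule one_over_Suc_tendsto)
  then have "(\<lambda>k. sig n (Q (q m k))) \<longlonglongrightarrow> of_real (ramp lam m (lam (Suc n)))"
    by (simp add: LIM_zero_iff)
  then have "L m (sig n) = of_real (ramp lam m (lam (Suc n)))"
    using L_tendsto[OF b] LIMSEQ_unique by blast
  then show ?thesis by (auto simp: ramp_lam)
qed

lemma shift_L:
  assumes \<phi>: "bounded_repr d \<phi>"
  shows "L m (shift \<phi>) = Linf \<phi> * L m (sig 0) + (\<Sum>n. (L n \<phi> - L (Suc n) \<phi>) * L m (sig (Suc n)))"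
proof -
  have ev: "cmod (shift \<phi> (Q (q m k)) -
     (Linf \<phi> * L m (sig 0) + (\<Sum>n. (L n \<phi> - L (Suc n) \<phi>) * L m (sig (Suc n))))) \<le> d * (1 / Suc k)" for k
  proof -
    define z where "z n = sig n (Q (q m k)) - L m (sig n)" for n
    have z: "cmod (z n) \<le> 1 / Suc k" for n
      using L_approx[OF unit_dual_bounded_repr[OF sig_mem]] by (simp add: z_def)
    have l: "cmod (L m (sig n)) \<le> 1" for n by (simp add: L_sig)
    have "(\<Sum>n. (L n \<phi> - L (Suc n) \<phi>) * sig (Suc n) (Q (q m k))) =
        (\<Sum>n. (L n \<phi> - L (Suc n) \<phi>) * (z (Suc n) + L m (sig (Suc n))))"
      by (simp add: z_def)
    also have "\<dots> = (\<Sum>n. (L n \<phi> - L (Suc n) \<phi>) * z (Suc n)) + (\<Sum>n. (L n \<phi> - L (Suc n) \<phi>) * L m (sig (Suc n)))"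
      by (rule suminf_shift_add[OF \<phi>]) (rule z, rule l)
    finally have "shift \<phi> (Q (q m k)) - (Linf \<phi> * L m (sig 0) + (\<Sum>n. (L n \<phi> - L (Suc n) \<phi>) * L m (sig (Suc n))))
      = Linf \<phi> * z 0 + (\<Sum>n. (L n \<phi> - L (Suc n) \<phi>) * z (Suc n))"
      by (simp add: shift_def z_def algebra_simps)
    then show ?thesis using weighted_bound[OF \<phi> z] by simp
  qed
  have "(\<lambda>k. d * (1 / real (Suc k))) \<longlonglongrightarrow> 0"
    by (rule tendsto_mult_right_zero[OF one_over_Suc_tendsto])
  then have "(\<lambda>k. shift \<phi> (Q (q m k)) -
     (Linf \<phi> * L m (sig 0) + (\<Sum>n. (L n \<phi> - L (Suc n) \<phi>) * L m (sig (Suc n))))) \<longlonglongrightarrow> 0"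
    by (rule Lim_null_comparison[OF always_eventually[OF allI[OF ev]]])
  then show ?thesis unfolding L_def[of m "shift \<phi>"] by (simp add: LIM_zero_iff limI)
qed

lemma shift_L_0:
  assumes "bounded_repr d \<phi>"
  shows "L 0 (shift \<phi>) = L 0 \<phi>"
  using coeff_sums[OF assms, of 0] by (simp add: shift_L[OF assms] L_sig sums_iff)

lemma shift_L_Suc:
  assumes \<phi>: "bounded_repr d \<phi>"
  shows "L (Suc m) (shift \<phi>) = L m \<phi> - Linf \<phi>"
proof -
  let ?c = "\<lambda>n. L n \<phi> - L (Suc n) \<phi>"
  let ?f = "\<lambda>n. ?c n * L (Suc m) (sig (Suc n))"
  have "(\<lambda>n. ?f (n + m)) = (\<lambda>n. L (n + m) \<phi> - L (Suc (n + m)) \<phi>)" by (simp add: L_sig)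
  then have "(\<lambda>n. ?f (n + m)) sums (L m \<phi> - Linf \<phi>)" using coeff_sums[OF \<phi>, of m] by simp
  then have "?f sums (L m \<phi> - Linf \<phi> + (\<Sum>n<m. ?f n))"
    by (subst (asm) sums_iff_shift)
  then have "?f sums (L m \<phi> - Linf \<phi>)" by (simp add: L_sig)
  then show ?thesis by (simp add: shift_L[OF \<phi>] L_sig sums_iff)
qed

lemma shift_mem:
  assumes \<phi>: "\<phi> \<in> slice"
  shows "shift \<phi> \<in> slice"
proof -
  have b: "bounded_repr 1 \<phi>" and L0: "L 0 \<phi> = 1"
    using \<phi> unit_dual_bounded_repr by (auto simp: slice_def)
  have add: "shift \<phi> (plus_of A x y) = shift \<phi> x + shift \<phi> y" if "x \<in> points A" "y \<in> points A" for x y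
  proof -
    have s: "sig n (plus_of A x y) = sig n x + sig n y" for n
      using sig_mem[of n] that by (simp add: unit_dual_def)
    show ?thesis unfolding shift_def s
      by (subst suminf_shift_add[OF b, where B="norm_of A x" and B'="norm_of A y"])
         (use that sig_bound in \<open>auto simp: algebra_simps\<close>)
  qed
  have scale: "shift \<phi> (scale_of A c x) = c * shift \<phi> x" if "x \<in> points A" for c x
  proof -
    have s: "sig n (scale_of A c x) = c * sig n x" for n
      using sig_mem[of n] that by (simp add: unit_dual_def)
    have "summable (\<lambda>n. (L n \<phi> - L (Suc n) \<phi>) * sig (Suc n) x)"
      by (rule summable_norm_cancel, rule summable_weighted[OF b]) (rule sig_bound[OF that])
    from suminf_mult[OF this, of c]
    show ?thesis unfolding shift_def s by (simp add: algebra_simps)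
  qed
  have bd: "cmod (shift \<phi> x) \<le> norm_of A x" if "x \<in> points A" for x
    using weighted_bound[OF b, of "\<lambda>n. sig n x"] sig_bound[OF that] by (simp add: shift_def)
  \<comment> \<open>off the carrier all states have the value \<open>undefined\<close>, and the coefficients sum to \<open>L 0 \<phi> = 1\<close>\<close>
  have ext: "shift \<phi> x = undefined" if x: "x \<notin> points A" for x
  proof -
    have s: "sig n x = undefined" for n
      using sig_mem[of n] x by (auto simp: unit_dual_def PiE_def extensional_def)
    have "(\<lambda>n. (L n \<phi> - L (Suc n) \<phi>) * undefined) sums ((L 0 \<phi> - Linf \<phi>) * undefined)"
      using sums_mult2[OF coeff_sums[OF b, of 0]] by simp
    then show ?thesis unfolding shift_def s by (simp add: sums_iff L0 algebra_simps)
  qed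
  have "shift \<phi> \<in> unit_dual A"
    unfolding unit_dual_def using add scale bd ext by (auto simp: PiE_def extensional_def)
  then show ?thesis using shift_L_0[OF b] L0 by (simp add: slice_def)
qed

lemma L_diff:
  assumes "bounded_repr d \<phi>" "bounded_repr d' \<psi>"
  shows "L m (\<lambda>x. \<phi> x - \<psi> x) = L m \<phi> - L m \<psi>"
  unfolding L_def[of m "\<lambda>x. \<phi> x - \<psi> x"]
  by (intro limI tendsto_diff L_tendsto[OF assms(1)] L_tendsto[OF assms(2)])

lemma Linf_diff:
  assumes "bounded_repr d \<phi>" "bounded_repr d' \<psi>"
  shows "Linf (\<lambda>x. \<phi> x - \<psi> x) = Linf \<phi> - Linf \<psi>"
  unfolding Linf_def[of "\<lambda>x. \<phi> x - \<psi> x"] L_diff[OF assms]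
  by (intro limI tendsto_diff Linf_tendsto[OF assms(1)] Linf_tendsto[OF assms(2)])

lemma shift_nonexpansive: "nonexpansive_on (dual_space A) slice shift"
  unfolding nonexpansive_on_def
proof (intro ballI)
  fix \<phi> \<psi> assume \<phi>: "\<phi> \<in> slice" and \<psi>: "\<psi> \<in> slice"
  then have u: "\<phi> \<in> unit_dual A" "\<psi> \<in> unit_dual A" by (auto simp: slice_def)
  note b = unit_dual_bounded_repr[OF u(1)] unit_dual_bounded_repr[OF u(2)]
  note bd = unit_dual_diff_bounded_repr[OF u]
  let ?d = "dist_of (dual_space A) \<phi> \<psi>"
  let ?\<theta> = "\<lambda>x. \<phi> x - \<psi> x"
  have "0 \<le> (\<Sum>n. cmod (L n ?\<theta> - L (Suc n) ?\<theta>))"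
    by (intro suminf_nonneg L_variation_summable[OF bd]) simp
  then have d0: "0 \<le> ?d" using Linf_variation[OF bd] norm_ge_zero[of "Linf ?\<theta>"] by linarith
  have "cmod (shift \<phi> x - shift \<psi> x) \<le> ?d" if x: "x \<in> points A" "norm_of A x \<le> 1" for x
  proof -
    have s: "summable (\<lambda>n. (L n \<theta> - L (Suc n) \<theta>) * sig (Suc n) x)" if "bounded_repr 1 \<theta>" for \<theta>
      by (rule summable_norm_cancel, rule summable_weighted[OF that]) (rule sig_bound[OF x(1)])
    have "shift \<phi> x - shift \<psi> x = Linf ?\<theta> * sig 0 x + (\<Sum>n. (L n ?\<theta> - L (Suc n) ?\<theta>) * sig (Suc n) x)"
      unfolding shift_def L_diff[OF b] Linf_diff[OF b]
      using suminf_diff[OF s[OF b(1)] s[OF b(2)]] by (simp add: algebra_simps)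
    then have "cmod (shift \<phi> x - shift \<psi> x) \<le> ?d * norm_of A x"
      using weighted_bound[OF bd, of "\<lambda>n. sig n x"] sig_bound[OF x(1)] by simp
    also have "\<dots> \<le> ?d" using x(2) d0 by (simp add: mult_left_le)
    finally show ?thesis .
  qed
  moreover have "norm_of A (Q 0) \<le> 1" by (rule Q_norm) simp
  ultimately show "dist_of (dual_space A) (shift \<phi>) (shift \<psi>) \<le> ?d"
    unfolding dist_of_dual_space[of A "shift \<phi>"] using Q_mem by (intro cSup_least) auto
qed

lemma shift_no_fixed_point:
  assumes \<phi>: "\<phi> \<in> slice"
  shows "shift \<phi> \<noteq> \<phi>"
proof
  assume fp: "shift \<phi> = \<phi>"
  have b: "bounded_repr 1 \<phi>" and L0: "L 0 \<phi> = 1"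
    using \<phi> unit_dual_bounded_repr by (auto simp: slice_def)
  have step: "L (Suc m) \<phi> = L m \<phi> - Linf \<phi>" for m
    using shift_L_Suc[OF b, of m] fp by simp
  have "(\<lambda>m. L m \<phi> - L (Suc m) \<phi>) \<longlonglongrightarrow> Linf \<phi> - Linf \<phi>"
    by (intro tendsto_diff LIMSEQ_Suc Linf_tendsto[OF b])
  then have "(\<lambda>m::nat. Linf \<phi>) \<longlonglongrightarrow> 0" by (simp add: step)
  then have z: "Linf \<phi> = 0" by (simp add: LIMSEQ_const_iff)
  have "L m \<phi> = 1" for m by (induction m) (simp_all add: L0 step z)
  then have "(\<lambda>m::nat. 1) \<longlonglongrightarrow> Linf \<phi>" using Linf_tendsto[OF b] by simp
  then show False using z by (simp add: LIMSEQ_const_iff)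
qed

text \<open>The condition \<open>L 0 \<phi> = 1\<close> involves a limit; on the unit ball it amounts to a family of conditions that are closed
  for pointwise convergence.\<close>

lemma slice_eq: "slice = unit_dual A \<inter>
    {\<phi> \<in> topspace (pointwise_topology A). \<forall>k\<in>UNIV. cmod (\<phi> (Q (q 0 k)) - 1) \<le> 1 / Suc k}"
proof (intro equalityI subsetI)
  fix \<phi> assume \<phi>: "\<phi> \<in> slice"
  then have "\<phi> \<in> topspace (pointwise_topology A)" by (auto simp: slice_def unit_dual_def)
  moreover have "cmod (\<phi> (Q (q 0 k)) - 1) \<le> 1 / Suc k" for k
    using \<phi> L_approx[OF unit_dual_bounded_repr, of \<phi> 0 k] by (simp add: slice_def)
  ultimately show "\<phi> \<in> unit_dual A \<inter>
    {\<phi> \<in> topspace (pointwise_topology A). \<forall>k\<in>UNIV. cmod (\<phi> (Q (q 0 k)) - 1) \<le> 1 / Suc k}"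
    using \<phi> by (simp add: slice_def)
next
  fix \<phi> assume \<phi>: "\<phi> \<in> unit_dual A \<inter>
    {\<phi> \<in> topspace (pointwise_topology A). \<forall>k\<in>UNIV. cmod (\<phi> (Q (q 0 k)) - 1) \<le> 1 / Suc k}"
  then have "(\<lambda>k. \<phi> (Q (q 0 k)) - 1) \<longlonglongrightarrow> 0"
    by (intro Lim_null_comparison[OF _ one_over_Suc_tendsto]) auto
  then have "L 0 \<phi> = 1" unfolding L_def by (simp add: LIM_zero_iff limI)
  then show "\<phi> \<in> slice" using \<phi> by (simp add: slice_def)
qed

lemma slice_compact: "compactin (weak_star_topology A) slice"
proof -
  let ?X = "pointwise_topology A"
  have "closedin ?X {\<phi> \<in> topspace ?X. \<forall>k\<in>UNIV. cmod (\<phi> (Q (q 0 k)) - 1) \<le> 1 / Suc k}"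
  proof (rule closedin_Collect_ball)
    fix k
    have "closedin ?X {\<phi> \<in> topspace ?X. \<phi> (Q (q 0 k)) \<in> cball 1 (1 / Suc k)}"
      by (intro closedin_eval_cond continuous_map_eval) auto
    then show "closedin ?X {\<phi> \<in> topspace ?X. cmod (\<phi> (Q (q 0 k)) - 1) \<le> 1 / Suc k}"
      by (simp add: dist_norm norm_minus_commute)
  qed
  then have "closedin ?X slice" unfolding slice_eq by (intro closedin_Int closedin_unit_dual)
  then have "compactin ?X slice"
    by (rule closed_compactin[OF compactin_unit_dual, rotated]) (auto simp: slice_def)
  moreover have "slice \<subseteq> points (dual_space A)" using unit_dual_subset by (auto simp: slice_def)
  ultimately show ?thesis unfolding weak_star_topology_def by (simp add: compactin_subtopology)
qed

lemma slice_convex: "convex_in (dual_space A) slice"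
  unfolding convex_in_def
proof (intro ballI allI impI)
  fix \<phi> \<psi> and t :: real assume \<phi>: "\<phi> \<in> slice" and \<psi>: "\<psi> \<in> slice" and t: "0 \<le> t \<and> t \<le> 1"
  define \<eta> where "\<eta> = (\<lambda>x. of_real t * \<phi> x + of_real (1 - t) * \<psi> x)"
  have u: "\<phi> \<in> unit_dual A" "\<psi> \<in> unit_dual A" using \<phi> \<psi> by (auto simp: slice_def)
  have ext: "\<eta> x = undefined" if "x \<notin> points A" for x
    using u that by (simp add: \<eta>_def unit_dual_def PiE_def extensional_def algebra_simps)
  have eq: "plus_of (dual_space A) (scale_of (dual_space A) (of_real t) \<phi>) (scale_of (dual_space A) (of_real (1 - t)) \<psi>) = \<eta>"
    using ext by (auto simp: dual_space_def op_space_def complex_line_def \<eta>_def fun_eq_iff restrict_def)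
  have bd: "cmod (\<eta> x) \<le> norm_of A x" if "x \<in> points A" for x
  proof -
    have "cmod (\<eta> x) \<le> t * cmod (\<phi> x) + (1 - t) * cmod (\<psi> x)"
      unfolding \<eta>_def using norm_triangle_ineq[of "of_real t * \<phi> x" "of_real (1 - t) * \<psi> x"] t
      by (simp only: norm_mult norm_of_real) simp
    also have "\<dots> \<le> t * norm_of A x + (1 - t) * norm_of A x"
      using u that t by (intro add_mono mult_left_mono) (auto simp: unit_dual_def)
    finally show ?thesis by (simp add: algebra_simps)
  qed
  have "\<eta> \<in> unit_dual A"
    unfolding unit_dual_def using ext bd u
    by (auto simp: PiE_def extensional_def) (auto simp: \<eta>_def unit_dual_def algebra_simps)
  moreover have "L 0 \<eta> = of_real t * L 0 \<phi> + of_real (1 - t) * L 0 \<psi>"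
    unfolding L_def[of 0 \<eta>] unfolding \<eta>_def
    by (intro limI tendsto_add tendsto_mult_left L_tendsto[OF unit_dual_bounded_repr[OF u(1)]] L_tendsto[OF unit_dual_bounded_repr[OF u(2)]])
  ultimately show "plus_of (dual_space A) (scale_of (dual_space A) (of_real t) \<phi>) (scale_of (dual_space A) (of_real (1 - t)) \<psi>) \<in> slice"
    unfolding eq using \<phi> \<psi> by (simp add: slice_def)
qed

lemma no_weak_star_fpp: "\<not> dual_has_weak_star_fpp A"
proof
  assume fpp: "dual_has_weak_star_fpp A"
  have "sig 0 \<in> slice" using sig_mem by (simp add: slice_def L_sig)
  then have "slice \<noteq> {}" by blast
  moreover have "shift \<in> slice \<rightarrow> slice" using shift_mem by blast
  ultimately obtain \<phi> where "\<phi> \<in> slice" "shift \<phi> = \<phi>"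
    using fpp slice_compact slice_convex shift_nonexpansive unfolding dual_has_weak_star_fpp_def by blast
  then show False using shift_no_fixed_point by blast
qed

end

text \<open>By the Weierstrass theorem applied to the quotient of the ramp by \<open>t\<close>, which is continuous as the ramp vanishes near \<open>0\<close>.\<close>

lemma poly_approx_ramp:
  fixes a c r e :: real
  assumes "0 < a" "a < c" "e > 0"
  shows "\<exists>p. \<forall>t. 0 \<le> t \<and> t \<le> r \<longrightarrow>
    cmod (of_real t * poly p (of_real t) - of_real (max 0 (min 1 ((t - a) / (c - a))))) \<le> e"
proof -
  define h where "h t = max 0 (min 1 ((t - a) / (c - a)))" for t
  \<comment> \<open>equal to \<open>h t / t\<close> wherever \<open>h t\<close> is nonzero, and continuous on the whole line\<close>
  define g where "g t = h t / max t a" for t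
  have hg: "t * g t = h t" for t
  proof (cases "t \<le> a")
    case True
    then have "(t - a) / (c - a) \<le> 0" using assms by (intro divide_nonpos_pos) auto
    then show ?thesis by (simp add: g_def h_def)
  next
    case False
    then show ?thesis using assms by (simp add: g_def max_def)
  qed
  have cont: "continuous_on {0..r} g"
    unfolding g_def h_def using assms by (intro continuous_intros) auto
  define e' where "e' = e / (\<bar>r\<bar> + 1)"
  have e': "e' > 0" using assms by (simp add: e'_def)
  obtain f where f: "real_polynomial_function f" "\<And>t. t \<in> {0..r} \<Longrightarrow> \<bar>g t - f t\<bar> < e'"
    using Stone_Weierstrass_real_polynomial_function[OF compact_Icc cont e'] by auto
  obtain b n where f_eq: "f = (\<lambda>x. \<Sum>i\<le>n. b i * x ^ i)"
    using f(1) by (auto simp: real_polynomial_function_iff_sum)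
  define p where "p = (\<Sum>i\<le>n. monom (of_real (b i) :: complex) i)"
  have p: "poly p (of_real t) = of_real (f t)" for t
    by (simp add: p_def f_eq poly_sum poly_monom)
  show ?thesis
  proof (intro exI[of _ p] allI impI)
    fix t assume t: "0 \<le> t \<and> t \<le> r"
    have "of_real t * poly p (of_real t) - of_real (h t) = (of_real (t * f t - t * g t) :: complex)"
      by (simp add: p hg)
    then have "cmod (of_real t * poly p (of_real t) - of_real (h t)) = \<bar>t * f t - t * g t\<bar>"
      by (simp only: norm_of_real)
    also have "\<dots> = t * \<bar>g t - f t\<bar>" using t by (simp add: abs_mult right_diff_distrib[symmetric] abs_minus_commute)
    also have "\<dots> \<le> (\<bar>r\<bar> + 1) * e'" using t f(2)[of t] by (intro mult_mono) auto
    also have "\<dots> = e" by (simp add: e'_def)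
    finally show "cmod (of_real t * poly p (of_real t) - of_real (max 0 (min 1 ((t - a) / (c - a))))) \<le> e"
      by (simp add: h_def)
  qed
qed

theorem (in poly_repr) no_weak_star_fpp:
  assumes lam: "\<And>n. lam n < lam (Suc n)" "\<And>n. 0 < lam n" "\<And>n. lam n \<le> r"
    and states: "\<And>n. \<exists>\<phi>. (\<forall>j. \<phi> j \<in> unit_dual A) \<and>
       (\<forall>p. (\<lambda>j::nat. \<phi> j (Q p)) \<longlonglongrightarrow> of_real (lam n) * poly p (of_real (lam n)))"
  shows "\<not> dual_has_weak_star_fpp A"
proof -
  have "\<exists>\<psi>\<in>unit_dual A. \<forall>p. \<psi> (Q p) = of_real (lam n) * poly p (of_real (lam n))" for n
  proof -
    obtain \<phi> where "\<And>j. \<phi> j \<in> unit_dual A"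
      "\<And>p. (\<lambda>j::nat. \<phi> j (Q p)) \<longlonglongrightarrow> of_real (lam n) * poly p (of_real (lam n))"
      using states[of n] by auto
    then show ?thesis by (rule unit_dual_cluster)
  qed
  then have "\<forall>n. \<exists>\<psi>. \<psi> \<in> unit_dual A \<and>
      (\<forall>p. \<psi> (Q p) = of_real (lam (Suc n)) * poly p (of_real (lam (Suc n))))" by blast
  from choice[OF this] obtain sig where sig: "\<And>n. sig n \<in> unit_dual A"
    "\<And>n p. sig n (Q p) = of_real (lam (Suc n)) * poly p (of_real (lam (Suc n)))"
    by blast
  have "\<forall>m k. \<exists>p. \<forall>t. 0 \<le> t \<and> t \<le> r \<longrightarrow>
    cmod (of_real t * poly p (of_real t) - of_real (max 0 (min 1 ((t - lam m) / (lam (Suc m) - lam m))))) \<le> 1 / Suc k"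
    by (intro allI poly_approx_ramp) (use lam in auto)
  then have "\<exists>q. \<forall>m k. \<forall>t. 0 \<le> t \<and> t \<le> r \<longrightarrow>
    cmod (of_real t * poly (q m k) (of_real t) - of_real (max 0 (min 1 ((t - lam m) / (lam (Suc m) - lam m))))) \<le> 1 / Suc k"
    by (simp only: choice_iff)
  then obtain q where q: "\<And>m k t. 0 \<le> t \<Longrightarrow> t \<le> r \<Longrightarrow>
    cmod (of_real t * poly (q m k) (of_real t) - of_real (max 0 (min 1 ((t - lam m) / (lam (Suc m) - lam m))))) \<le> 1 / Suc k"
    by blast
  interpret spectral_states A Q r lam q sig
  proof unfold_locales
    show "\<And>m k t. 0 \<le> t \<Longrightarrow> t \<le> r \<Longrightarrow> cmod (of_real t * poly (q m k) (of_real t) -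
        of_real (ramp lam m t)) \<le> 1 / Suc k" unfolding ramp_def by (rule q)
  qed (rule lam sig)+
  show ?thesis by (rule no_weak_star_fpp)
qed

section \<open>Positive operators on a semi-inner product space\<close>

text \<open>A space \<open>V\<close> of functions with a positive semidefinite Hermitian form.  Functions are not identified when they
  differ by a vector of norm zero; the form is conjugate linear in the second argument.  Operators on \<open>V\<close> are only
  expected to be linear up to vectors of norm zero, and equalities between vectors are stated through \<open>ip\<close>.\<close>

locale semi_inner =
  fixes V :: "('x \<Rightarrow> complex) set" and ip :: "('x \<Rightarrow> complex) \<Rightarrow> ('x \<Rightarrow> complex) \<Rightarrow> complex"
  assumes zero_mem: "(\<lambda>x. 0) \<in> V"
    and add_mem: "\<And>h k. h \<in> V \<Longrightarrow> k \<in> V \<Longrightarrow> (\<lambda>x. h x + k x) \<in> V"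
    and scale_mem: "\<And>c h. h \<in> V \<Longrightarrow> (\<lambda>x. c * h x) \<in> V"
    and ip_add: "\<And>h k l. h \<in> V \<Longrightarrow> k \<in> V \<Longrightarrow> l \<in> V \<Longrightarrow> ip (\<lambda>x. h x + k x) l = ip h l + ip k l"
    and ip_scale: "\<And>c h l. h \<in> V \<Longrightarrow> l \<in> V \<Longrightarrow> ip (\<lambda>x. c * h x) l = c * ip h l"
    and ip_sym: "\<And>h k. h \<in> V \<Longrightarrow> k \<in> V \<Longrightarrow> ip k h = cnj (ip h k)"
    and ip_pos: "\<And>h. h \<in> V \<Longrightarrow> 0 \<le> Re (ip h h)"
begin

text \<open>The seminorm of the form \<open>ip\<close>.\<close>

definition nrm :: "('x \<Rightarrow> complex) \<Rightarrow> real" where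
  "nrm h = sqrt (Re (ip h h))"

lemma nrm_nonneg: "h \<in> V \<Longrightarrow> 0 \<le> nrm h"
  by (simp add: nrm_def ip_pos)

lemma ip_self: "h \<in> V \<Longrightarrow> ip h h = of_real ((nrm h)\<^sup>2)"
proof -
  assume h: "h \<in> V"
  have "Im (ip h h) = 0" using arg_cong[OF ip_sym[OF h h], of Im] by simp
  then show ?thesis using ip_pos[OF h] by (simp add: nrm_def complex_eq_iff)
qed

lemma lin_mem: "h \<in> V \<Longrightarrow> k \<in> V \<Longrightarrow> (\<lambda>x. h x + c * k x) \<in> V"
  using add_mem scale_mem by blast

lemma diff_mem: "h \<in> V \<Longrightarrow> k \<in> V \<Longrightarrow> (\<lambda>x. h x - c * k x) \<in> V"
  using lin_mem[of h k "-c"] by simp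

lemma sub_mem: "h \<in> V \<Longrightarrow> k \<in> V \<Longrightarrow> (\<lambda>x. h x - k x) \<in> V"
  using diff_mem[of h k 1] by simp

lemma ip_diff: "h \<in> V \<Longrightarrow> k \<in> V \<Longrightarrow> l \<in> V \<Longrightarrow> ip (\<lambda>x. h x - c * k x) l = ip h l - c * ip k l"
  using ip_add[of h "\<lambda>x. - c * k x" l] ip_scale[of k l "-c"] scale_mem[of k "-c"] by simp

lemma ip_diff_right:
  assumes "h \<in> V" "k \<in> V" "l \<in> V"
  shows "ip l (\<lambda>x. h x - c * k x) = ip l h - cnj c * ip l k"
  unfolding ip_sym[OF diff_mem[OF assms(1,2)] assms(3)] ip_diff[OF assms]
    ip_sym[OF assms(1,3)] ip_sym[OF assms(2,3)] by simp

lemma nrm_sq_diff: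
  assumes "h \<in> V" "k \<in> V"
  shows "(nrm (\<lambda>x. h x - c * k x))\<^sup>2 = (nrm h)\<^sup>2 - 2 * Re (cnj c * ip h k) + (cmod c)\<^sup>2 * (nrm k)\<^sup>2"
proof -
  let ?d = "\<lambda>x. h x - c * k x"
  have d: "?d \<in> V" using assms by (rule diff_mem)
  have "of_real ((nrm ?d)\<^sup>2) = ip ?d ?d" using ip_self[OF d] by simp
  also have "\<dots> = ip h h - cnj c * ip h k - c * (ip k h - cnj c * ip k k)"
    using assms d by (simp add: ip_diff ip_diff_right)
  also have "\<dots> = of_real ((nrm h)\<^sup>2) - cnj c * ip h k - c * cnj (ip h k) + (c * cnj c) * of_real ((nrm k)\<^sup>2)"
    using assms by (simp add: ip_self ip_sym[of h k] algebra_simps)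
  also have "\<dots> = of_real ((nrm h)\<^sup>2) - (cnj c * ip h k + cnj (cnj c * ip h k)) + of_real ((cmod c)\<^sup>2 * (nrm k)\<^sup>2)"
    by (simp add: complex_norm_square[symmetric] flip: of_real_power)
  also have "\<dots> = of_real ((nrm h)\<^sup>2 - 2 * Re (cnj c * ip h k) + (cmod c)\<^sup>2 * (nrm k)\<^sup>2)"
    by (simp only: complex_add_cnj) simp
  finally show ?thesis using of_real_eq_iff by blast
qed

lemma Cauchy_Schwarz:
  assumes h: "h \<in> V" and k: "k \<in> V"
  shows "cmod (ip h k) \<le> nrm h * nrm k"
proof -
  let ?z = "ip h k"
  have key: "0 \<le> (nrm h)\<^sup>2 - 2 * t * (cmod ?z)\<^sup>2 + t\<^sup>2 * (cmod ?z)\<^sup>2 * (nrm k)\<^sup>2" for t :: real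
  proof -
    have "Re (cnj (of_real t * ?z) * ?z) = t * (cmod ?z)\<^sup>2"
      by (simp only: cmod_power2) (simp add: power2_eq_square algebra_simps)
    then have "(nrm h)\<^sup>2 - 2 * t * (cmod ?z)\<^sup>2 + t\<^sup>2 * (cmod ?z)\<^sup>2 * (nrm k)\<^sup>2
       = (nrm (\<lambda>x. h x - (of_real t * ?z) * k x))\<^sup>2"
      unfolding nrm_sq_diff[OF h k] by (simp add: norm_mult power_mult_distrib)
    then show ?thesis by simp
  qed
  show ?thesis
  proof (cases "nrm k = 0")
    case True
    have "cmod ?z = 0"
    proof (rule ccontr)
      assume nz: "cmod ?z \<noteq> 0"
      then have p: "(cmod ?z)\<^sup>2 > 0" by simp
      have "2 * (((nrm h)\<^sup>2 + 1) / (2 * (cmod ?z)\<^sup>2)) * (cmod ?z)\<^sup>2 = (nrm h)\<^sup>2 + 1"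
        using nz by simp
      then show False using key[of "((nrm h)\<^sup>2 + 1) / (2 * (cmod ?z)\<^sup>2)"] True by simp
    qed
    then show ?thesis using nrm_nonneg[OF h] nrm_nonneg[OF k] by simp
  next
    case False
    then have p: "(nrm k)\<^sup>2 > 0" by simp
    have "(1 / (nrm k)\<^sup>2)\<^sup>2 * (cmod ?z)\<^sup>2 * (nrm k)\<^sup>2 = (cmod ?z)\<^sup>2 / (nrm k)\<^sup>2"
      using p by (simp add: power2_eq_square field_simps)
    then have "(cmod ?z)\<^sup>2 / (nrm k)\<^sup>2 \<le> (nrm h)\<^sup>2" using key[of "1 / (nrm k)\<^sup>2"] by simp
    then have "(cmod ?z)\<^sup>2 \<le> (nrm h * nrm k)\<^sup>2" using p by (simp add: pos_divide_le_eq power_mult_distrib)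
    then show ?thesis
      by (rule power2_le_imp_le) (auto intro!: mult_nonneg_nonneg nrm_nonneg h k)
  qed
qed

lemma nrm_scale: "h \<in> V \<Longrightarrow> nrm (\<lambda>x. c * h x) = cmod c * nrm h"
proof -
  assume h: "h \<in> V"
  have "(nrm (\<lambda>x. 0 - c * h x))\<^sup>2 = (cmod c * nrm h)\<^sup>2"
    unfolding nrm_sq_diff[OF zero_mem h]
    using ip_scale[OF zero_mem h, of 0] ip_scale[OF zero_mem zero_mem, of 0]
    by (simp add: power_mult_distrib nrm_def)
  moreover have "(\<lambda>x. 0 - (- c) * h x) = (\<lambda>x. c * h x)" by simp
  moreover have "(nrm (\<lambda>x. 0 - (- c) * h x))\<^sup>2 = (cmod (-c) * nrm h)\<^sup>2"
    unfolding nrm_sq_diff[OF zero_mem h]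
    using ip_scale[OF zero_mem h, of 0] ip_scale[OF zero_mem zero_mem, of 0]
    by (simp add: power_mult_distrib nrm_def)
  ultimately have "(nrm (\<lambda>x. c * h x))\<^sup>2 = (cmod c * nrm h)\<^sup>2" by simp
  then show ?thesis
    by (rule power2_eq_imp_eq) (auto intro!: mult_nonneg_nonneg nrm_nonneg scale_mem h)
qed

lemma nrm_triangle_diff:
  assumes h: "h \<in> V" and k: "k \<in> V"
  shows "nrm (\<lambda>x. h x - c * k x) \<le> nrm h + cmod c * nrm k"
proof -
  have "- Re (cnj c * ip h k) \<le> cmod (cnj c * ip h k)"
    using abs_Re_le_cmod[of "cnj c * ip h k"] by linarith
  also have "\<dots> \<le> cmod c * (nrm h * nrm k)"
    by (simp add: norm_mult mult_left_mono Cauchy_Schwarz h k)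
  finally have "(nrm (\<lambda>x. h x - c * k x))\<^sup>2 \<le> (nrm h + cmod c * nrm k)\<^sup>2"
    unfolding nrm_sq_diff[OF h k] by (simp add: power2_sum power_mult_distrib algebra_simps)
  then show ?thesis
    by (rule power2_le_imp_le) (auto intro!: add_nonneg_nonneg mult_nonneg_nonneg nrm_nonneg h k)
qed

lemma nrm_triangle:
  assumes h: "h \<in> V" and k: "k \<in> V"
  shows "nrm (\<lambda>x. h x + k x) \<le> nrm h + nrm k"
  using nrm_triangle_diff[OF h k, of "-1"] by simp

lemma nrm_triangle_lower:
  assumes h: "h \<in> V" and k: "k \<in> V"
  shows "nrm h - nrm k \<le> nrm (\<lambda>x. h x - k x)"
  using nrm_triangle[OF sub_mem[OF h k] k] by simp

lemma nrm_diff_eq_0: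
  assumes h: "h \<in> V" and k: "k \<in> V" and "\<And>l. l \<in> V \<Longrightarrow> ip h l = ip k l"
  shows "nrm (\<lambda>x. h x - k x) = 0"
  using assms(3)[OF sub_mem[OF h k]] ip_diff[OF h k sub_mem[OF h k], of 1]
  by (simp add: nrm_def)

lemma nrm_cong:
  assumes h: "h \<in> V" and k: "k \<in> V" and "\<And>l. l \<in> V \<Longrightarrow> ip h l = ip k l"
  shows "nrm h = nrm k"
proof -
  have "nrm (\<lambda>x. h x - k x) = 0" by (rule nrm_diff_eq_0[OF h k assms(3)])
  moreover have "nrm (\<lambda>x. k x - h x) = 0" by (rule nrm_diff_eq_0[OF k h assms(3)[symmetric]])
  ultimately show ?thesis using nrm_triangle_lower[OF h k] nrm_triangle_lower[OF k h] by simp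
qed

lemma sum_mem: "finite I \<Longrightarrow> (\<And>i. i \<in> I \<Longrightarrow> f i \<in> V) \<Longrightarrow> (\<lambda>x. \<Sum>i\<in>I. c i * f i x) \<in> V"
  by (induction I rule: finite_induct) (auto simp: zero_mem intro!: add_mem scale_mem)

lemma ip_zero: "l \<in> V \<Longrightarrow> ip (\<lambda>x. 0) l = 0"
  using ip_scale[OF zero_mem, of l 0] by simp

lemma ip_sum: "finite I \<Longrightarrow> (\<And>i. i \<in> I \<Longrightarrow> f i \<in> V) \<Longrightarrow> l \<in> V \<Longrightarrow>
   ip (\<lambda>x. \<Sum>i\<in>I. c i * f i x) l = (\<Sum>i\<in>I. c i * ip (f i) l)"
proof (induction I rule: finite_induct)
  case (insert i I)
  have "ip (\<lambda>x. c i * f i x + (\<Sum>i\<in>I. c i * f i x)) l = c i * ip (f i) l + (\<Sum>i\<in>I. c i * ip (f i) l)"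
    using insert by (subst ip_add) (auto intro!: scale_mem sum_mem simp: ip_scale)
  then show ?case using insert by simp
qed (simp add: ip_zero)

end

text \<open>A positive operator \<open>b\<close> with norm at most \<open>B\<close>.  Linearity up to vectors of norm zero follows from \<open>b_sa\<close>.\<close>

locale pos_operator = semi_inner V ip for V :: "('x \<Rightarrow> complex) set" and ip +
  fixes b :: "('x \<Rightarrow> complex) \<Rightarrow> ('x \<Rightarrow> complex)" and B :: real
  assumes b_mem: "\<And>h. h \<in> V \<Longrightarrow> b h \<in> V"
    and b_sa: "\<And>h k. h \<in> V \<Longrightarrow> k \<in> V \<Longrightarrow> ip (b h) k = ip h (b k)"
    and b_pos: "\<And>h. h \<in> V \<Longrightarrow> 0 \<le> Re (ip (b h) h)"
    and b_bdd: "\<And>h. h \<in> V \<Longrightarrow> nrm (b h) \<le> B * nrm h"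
begin

text \<open>The operator \<open>p(b)\<close>.\<close>

definition polyop :: "complex poly \<Rightarrow> ('x \<Rightarrow> complex) \<Rightarrow> ('x \<Rightarrow> complex)" where
  "polyop p h = (\<lambda>x. \<Sum>k\<le>degree p. coeff p k * (b ^^ k) h x)"

lemma funpow_mem: "h \<in> V \<Longrightarrow> (b ^^ k) h \<in> V"
  by (induction k) (auto simp: b_mem)

lemma polyop_mem: "h \<in> V \<Longrightarrow> polyop p h \<in> V"
  unfolding polyop_def by (auto intro!: sum_mem funpow_mem)

lemma ip_polyop:
  assumes "h \<in> V" "l \<in> V" "degree p \<le> n"
  shows "ip (polyop p h) l = (\<Sum>k\<le>n. coeff p k * ip ((b ^^ k) h) l)"
proof -
  have "ip (polyop p h) l = (\<Sum>k\<le>degree p. coeff p k * ip ((b ^^ k) h) l)"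
    unfolding polyop_def using assms by (subst ip_sum) (auto intro!: funpow_mem)
  also have "\<dots> = (\<Sum>k\<le>n. coeff p k * ip ((b ^^ k) h) l)"
    using assms(3) by (intro sum.mono_neutral_left) (auto simp: coeff_eq_0)
  finally show ?thesis .
qed

lemma ip_polyop_0: "h \<in> V \<Longrightarrow> l \<in> V \<Longrightarrow> ip (polyop 0 h) l = 0"
  by (simp add: ip_polyop[where n=0])

lemma ip_polyop_add:
  assumes "h \<in> V" "l \<in> V"
  shows "ip (polyop (p + q) h) l = ip (polyop p h) l + ip (polyop q h) l"
proof -
  let ?n = "max (degree p) (degree q)"
  show ?thesis
    using assms by (simp add: ip_polyop[where n="?n"] degree_add_le sum.distrib algebra_simps)
qed

lemma ip_polyop_smult:
  assumes "h \<in> V" "l \<in> V"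
  shows "ip (polyop (smult c p) h) l = c * ip (polyop p h) l"
  using assms by (simp add: ip_polyop[where n="degree p"] degree_smult_le sum_distrib_left algebra_simps)

lemma ip_polyop_pCons:
  assumes h: "h \<in> V" and l: "l \<in> V"
  shows "ip (polyop (pCons a p) h) l = a * ip h l + ip (polyop p h) (b l)"
proof -
  have "ip (polyop (pCons a p) h) l = (\<Sum>k\<le>Suc (degree p). coeff (pCons a p) k * ip ((b ^^ k) h) l)"
    using assms by (intro ip_polyop) (auto simp: degree_pCons_le)
  also have "\<dots> = a * ip h l + (\<Sum>k\<le>degree p. coeff p k * ip (b ((b ^^ k) h)) l)"
    by (simp add: sum.atMost_Suc_shift del: sum.atMost_Suc)
  also have "(\<Sum>k\<le>degree p. coeff p k * ip (b ((b ^^ k) h)) l) = ip (polyop p h) (b l)"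
    using assms by (simp add: b_sa funpow_mem ip_polyop[where n="degree p"] b_mem)
  finally show ?thesis .
qed

lemma ip_polyop_pCons':
  assumes h: "h \<in> V" and l: "l \<in> V"
  shows "ip (polyop (pCons a p) h) l = a * ip h l + ip (polyop p (b h)) l"
proof -
  have "ip (polyop (pCons a p) h) l = (\<Sum>k\<le>Suc (degree p). coeff (pCons a p) k * ip ((b ^^ k) h) l)"
    using assms by (intro ip_polyop) (auto simp: degree_pCons_le)
  also have "\<dots> = a * ip h l + (\<Sum>k\<le>degree p. coeff p k * ip ((b ^^ k) (b h)) l)"
    by (simp add: sum.atMost_Suc_shift funpow_swap1 del: sum.atMost_Suc)
  also have "(\<Sum>k\<le>degree p. coeff p k * ip ((b ^^ k) (b h)) l) = ip (polyop p (b h)) l"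
    using assms by (simp add: ip_polyop[where n="degree p"] b_mem)
  finally show ?thesis .
qed

lemma ip_polyop_mult:
  assumes h: "h \<in> V" and l: "l \<in> V"
  shows "ip (polyop (p * q) h) l = ip (polyop p (polyop q h)) l"
  using l
proof (induction p arbitrary: l)
  case 0
  then show ?case using h by (simp add: ip_polyop_0 polyop_mem)
next
  case (pCons a p)
  have "ip (polyop (pCons a p * q) h) l = a * ip (polyop q h) l + ip (polyop (p * q) h) (b l)"
    using h pCons.prems by (simp add: mult_pCons_left ip_polyop_add ip_polyop_smult ip_polyop_pCons)
  then show ?case
    using pCons h by (simp add: b_mem ip_polyop_pCons polyop_mem)
qed

lemma ip_polyop_adj:
  assumes h: "h \<in> V" and l: "l \<in> V"
  shows "ip (polyop p h) l = ip h (polyop (map_poly cnj p) l)"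
  using l
proof (induction p arbitrary: l)
  case 0
  then show ?case using h by (simp add: ip_polyop_0 polyop_mem ip_sym[of "polyop 0 _"])
next
  case (pCons a p)
  have "ip h (polyop (map_poly cnj (pCons a p)) l) = cnj (ip (polyop (map_poly cnj (pCons a p)) l) h)"
    using h pCons.prems by (simp add: ip_sym[of "polyop _ _" h] polyop_mem)
  also have "\<dots> = cnj (cnj a * ip l h + ip (polyop (map_poly cnj p) (b l)) h)"
    using h pCons.prems by (simp add: map_poly_pCons ip_polyop_pCons')
  also have "\<dots> = a * ip h l + ip h (polyop (map_poly cnj p) (b l))"
    using h pCons.prems by (simp add: ip_sym[of "polyop _ _" h] polyop_mem b_mem ip_sym[of l h])
  finally show ?case
    using pCons h by (simp add: b_mem ip_polyop_pCons)
qed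

lemma nrm_polyop_mult:
  "h \<in> V \<Longrightarrow> nrm (polyop (p * q) h) = nrm (polyop p (polyop q h))"
  by (intro nrm_cong) (auto simp: polyop_mem ip_polyop_mult)

lemma nrm_polyop_const: "h \<in> V \<Longrightarrow> nrm (polyop [:c:] h) = cmod c * nrm h"
  by (simp add: polyop_def nrm_scale)

lemma nrm_polyop_linear: "h \<in> V \<Longrightarrow> nrm (polyop [:-z, 1:] h) = nrm (\<lambda>x. b h x - z * h x)"
  by (simp add: polyop_def algebra_simps)

lemma nrm_funpow: "h \<in> V \<Longrightarrow> nrm ((b ^^ k) h) \<le> \<bar>B\<bar> ^ k * nrm h"
proof (induction k)
  case (Suc k)
  have "nrm (b ((b ^^ k) h)) \<le> B * nrm ((b ^^ k) h)" using Suc by (intro b_bdd funpow_mem)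
  also have "\<dots> \<le> \<bar>B\<bar> * (\<bar>B\<bar> ^ k * nrm h)"
    using Suc by (intro mult_mono) (auto simp: nrm_nonneg funpow_mem)
  finally show ?case by (simp add: mult.assoc)
qed simp

lemma nrm_sum_le: "finite I \<Longrightarrow> (\<And>i. i \<in> I \<Longrightarrow> f i \<in> V) \<Longrightarrow>
   nrm (\<lambda>x. \<Sum>i\<in>I. c i * f i x) \<le> (\<Sum>i\<in>I. cmod (c i) * nrm (f i))"
proof (induction I rule: finite_induct)
  case empty
  then show ?case using nrm_scale[OF zero_mem, of 0] by simp
next
  case (insert i I)
  have "nrm (\<lambda>x. c i * f i x + (\<Sum>i\<in>I. c i * f i x)) \<le> nrm (\<lambda>x. c i * f i x) + nrm (\<lambda>x. \<Sum>i\<in>I. c i * f i x)"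
    using insert by (intro nrm_triangle scale_mem sum_mem) auto
  then show ?case using insert by (simp add: nrm_scale)
qed

lemma polyop_bdd: "\<exists>C\<ge>0. \<forall>h\<in>V. nrm (polyop p h) \<le> C * nrm h"
proof (intro exI[of _ "\<Sum>k\<le>degree p. cmod (coeff p k) * \<bar>B\<bar> ^ k"] conjI ballI)
  fix h assume h: "h \<in> V"
  have "nrm (polyop p h) \<le> (\<Sum>k\<le>degree p. cmod (coeff p k) * nrm ((b ^^ k) h))"
    unfolding polyop_def by (intro nrm_sum_le) (auto simp: funpow_mem h)
  also have "\<dots> \<le> (\<Sum>k\<le>degree p. cmod (coeff p k) * (\<bar>B\<bar> ^ k * nrm h))"
    by (intro sum_mono mult_left_mono nrm_funpow h) auto
  finally show "nrm (polyop p h) \<le> (\<Sum>k\<le>degree p. cmod (coeff p k) * \<bar>B\<bar> ^ k) * nrm h"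
    by (simp add: sum_distrib_right mult.assoc)
qed (auto intro!: sum_nonneg)

text \<open>The real approximate point spectrum of \<open>b\<close>.\<close>

definition aspec :: "real set" where
  "aspec = {t. \<forall>e>0. \<exists>h\<in>V. nrm (\<lambda>x. b h x - of_real t * h x) < e * nrm h}"

lemma aspecI:
  "(\<And>e. e > 0 \<Longrightarrow> \<exists>h\<in>V. nrm (\<lambda>x. b h x - of_real t * h x) < e * nrm h) \<Longrightarrow> t \<in> aspec"
  by (simp add: aspec_def)

lemma Im_ip_b: "h \<in> V \<Longrightarrow> Im (ip (b h) h) = 0"
  using b_sa[of h h] arg_cong[OF ip_sym[of "b h" h], of Im] b_mem by simp

lemma linear_bounded_below:
  assumes "\<forall>t\<in>aspec. z \<noteq> of_real t"
  shows "\<exists>e>0. \<forall>h\<in>V. e * nrm h \<le> nrm (\<lambda>x. b h x - z * h x)"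
proof (cases "Im z = 0")
  case True
  then have z: "z = of_real (Re z)" by (simp add: complex_eq_iff)
  then have "Re z \<notin> aspec" using assms by metis
  then obtain e where "e > 0" "\<forall>h\<in>V. \<not> nrm (\<lambda>x. b h x - of_real (Re z) * h x) < e * nrm h"
    unfolding aspec_def by auto
  then show ?thesis using z by (metis linorder_not_less)
next
  case False
  have "\<bar>Im z\<bar> * nrm h \<le> nrm (\<lambda>x. b h x - z * h x)" if h: "h \<in> V" for h
  proof -
    have m: "(\<lambda>x. b h x - z * h x) \<in> V" using h by (intro diff_mem b_mem)
    have "Im (ip (\<lambda>x. b h x - z * h x) h) = - Im z * (nrm h)\<^sup>2"
      using h by (simp add: ip_diff b_mem ip_self Im_ip_b)
    then have "\<bar>Im z\<bar> * (nrm h)\<^sup>2 = \<bar>Im (ip (\<lambda>x. b h x - z * h x) h)\<bar>" by (simp add: abs_mult)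
    also have "\<dots> \<le> nrm (\<lambda>x. b h x - z * h x) * nrm h"
      using Cauchy_Schwarz[OF m h] abs_Im_le_cmod order_trans by blast
    finally have *: "\<bar>Im z\<bar> * nrm h * nrm h \<le> nrm (\<lambda>x. b h x - z * h x) * nrm h"
      by (simp add: power2_eq_square mult.assoc)
    show ?thesis
    proof (cases "nrm h = 0")
      case True
      then show ?thesis using nrm_nonneg[OF m] by simp
    next
      case False
      then show ?thesis using * nrm_nonneg[OF h] by (simp add: mult_le_cancel_right)
    qed
  qed
  then show ?thesis using False by (intro exI[of _ "\<bar>Im z\<bar>"]) auto
qed

text \<open>By induction on the degree: \<open>q\<close> has a linear factor, and both factors are bounded below.\<close>

lemma poly_bounded_below:
  assumes "q \<noteq> 0" "\<forall>t\<in>aspec. poly q (of_real t) \<noteq> 0"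
  shows "\<exists>e>0. \<forall>h\<in>V. e * nrm h \<le> nrm (polyop q h)"
  using assms
proof (induction "degree q" arbitrary: q)
  case 0
  then obtain c where q: "q = [:c:]" by (metis degree_eq_zeroE)
  then show ?case using 0 by (intro exI[of _ "cmod c"]) (auto simp: nrm_polyop_const)
next
  case (Suc n)
  have "\<not> constant (poly q)" using Suc.hyps(2) by (simp add: constant_degree)
  then obtain z where "poly q z = 0" using fundamental_theorem_of_algebra by blast
  then obtain q' where q: "q = [:-z, 1:] * q'" by (metis poly_eq_0_iff_dvd dvdE)
  have q0: "q' \<noteq> 0" using Suc.prems q by auto
  then have "degree q = Suc (degree q')" unfolding q by (subst degree_mult_eq) auto
  then have "n = degree q'" using Suc.hyps by simp
  moreover have "\<forall>t\<in>aspec. poly q' (of_real t) \<noteq> 0" using Suc.prems q by auto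
  ultimately obtain e1 where e1: "e1 > 0" "\<And>h. h \<in> V \<Longrightarrow> e1 * nrm h \<le> nrm (polyop q' h)"
    using Suc.hyps(1)[of q'] q0 by blast
  have "\<forall>t\<in>aspec. z \<noteq> of_real t" using Suc.prems q by auto
  then obtain e2 where e2: "e2 > 0" "\<And>h. h \<in> V \<Longrightarrow> e2 * nrm h \<le> nrm (\<lambda>x. b h x - z * h x)"
    using linear_bounded_below by blast
  have "e2 * e1 * nrm h \<le> nrm (polyop q h)" if h: "h \<in> V" for h
  proof -
    have "e2 * e1 * nrm h \<le> e2 * nrm (polyop q' h)"
      using e1(2)[OF h] e2(1) by (simp add: mult.assoc)
    also have "\<dots> \<le> nrm (\<lambda>x. b (polyop q' h) x - z * polyop q' h x)"
      using h by (intro e2 polyop_mem)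
    also have "\<dots> = nrm (polyop [:-z, 1:] (polyop q' h))"
      using h by (simp only: nrm_polyop_linear polyop_mem)
    also have "\<dots> = nrm (polyop q h)" unfolding q using h by (simp only: nrm_polyop_mult)
    finally show ?thesis .
  qed
  then show ?case using e1(1) e2(1) by (intro exI[of _ "e2 * e1"]) auto
qed

lemma polyop_root_aspec:
  assumes "q \<noteq> 0" "\<And>e. e > 0 \<Longrightarrow> \<exists>h\<in>V. nrm (polyop q h) < e * nrm h"
  shows "\<exists>t\<in>aspec. poly q (of_real t) = 0"
  using poly_bounded_below[OF assms(1)] assms(2) by (meson linorder_not_less)

text \<open>If \<open>N\<close> is the norm of \<open>T = p(b)\<close>, then \<open>T\<^sup>* T - N\<^sup>2\<close> is not bounded below, because
  \<open>\<parallel>(T\<^sup>* T - N\<^sup>2) h\<parallel>\<^sup>2 \<le> N\<^sup>2 (N\<^sup>2 \<parallel>h\<parallel>\<^sup>2 - \<parallel>T h\<parallel>\<^sup>2)\<close>.\<close>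

lemma polyop_norm_attained:
  assumes N: "0 < N" "\<And>h. h \<in> V \<Longrightarrow> nrm (polyop p h) \<le> N * nrm h"
    and opt: "\<And>c. 0 \<le> c \<Longrightarrow> c < N \<Longrightarrow> \<exists>h\<in>V. c * nrm h < nrm (polyop p h)"
    and e: "e > 0"
  shows "\<exists>h\<in>V. nrm (polyop (map_poly cnj p * p - [:of_real (N\<^sup>2):]) h) < e * nrm h"
proof -
  \<comment> \<open>the constant below \<open>N\<close> that makes \<open>N\<^sup>2 (N\<^sup>2 - c\<^sup>2)\<close> at most \<open>e\<^sup>2 / 2\<close>\<close>
  define c where "c = sqrt (max 0 (N\<^sup>2 - e\<^sup>2 / (2 * N\<^sup>2)))"
  have c0: "0 \<le> c" by (simp add: c_def)
  have c2: "c\<^sup>2 = max 0 (N\<^sup>2 - e\<^sup>2 / (2 * N\<^sup>2))" by (simp add: c_def)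
  have "c\<^sup>2 < N\<^sup>2" unfolding c2 using N(1) e by simp
  then have "c < N" using N(1) by (intro power2_less_imp_less[of c N]) auto
  then obtain h where h: "h \<in> V" and hc: "c * nrm h < nrm (polyop p h)" using opt c0 by blast
  define u where "u = polyop p h"
  define w where "w = polyop (map_poly cnj p) u"
  have u: "u \<in> V" and w: "w \<in> V" using h by (auto simp: u_def w_def polyop_mem)
  have cc: "map_poly cnj (map_poly cnj p) = p" by (simp add: poly_eq_iff coeff_map_poly)
  have nh: "0 < nrm h"
  proof (rule ccontr)
    assume "\<not> 0 < nrm h"
    then have "nrm h = 0" using nrm_nonneg[OF h] by simp
    then show False using hc N(2)[OF h] by simp
  qed
  have "of_real ((nrm w)\<^sup>2) = ip u (polyop p w)"
    using ip_self[OF w] ip_polyop_adj[OF u w, of "map_poly cnj p"] by (simp add: w_def cc)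
  then have "(nrm w)\<^sup>2 = cmod (ip u (polyop p w))" by (metis norm_of_real abs_power2)
  also have "\<dots> \<le> nrm u * (N * nrm w)"
    using Cauchy_Schwarz[OF u polyop_mem[OF w]] mult_left_mono[OF N(2)[OF w] nrm_nonneg[OF u]]
    by (rule order_trans)
  finally have "nrm w * nrm w \<le> N * nrm u * nrm w" by (simp add: power2_eq_square algebra_simps)
  then have wN: "nrm w \<le> N * nrm u"
    using nrm_nonneg[OF w] nrm_nonneg[OF u] N(1)
    by (cases "nrm w = 0") (auto simp: mult_le_cancel_right)
  have wh: "ip w h = of_real ((nrm u)\<^sup>2)"
    using ip_polyop_adj[OF u h, of "map_poly cnj p"] ip_self[OF u] by (simp add: w_def cc) (simp add: u_def)
  let ?q = "map_poly cnj p * p - [:of_real (N\<^sup>2):]"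
  have "nrm (polyop ?q h) = nrm (\<lambda>x. w x - of_real (N\<^sup>2) * h x)"
  proof (rule nrm_cong)
    fix l assume l: "l \<in> V"
    have "?q = map_poly cnj p * p + [:- of_real (N\<^sup>2):]" by simp
    then have "ip (polyop ?q h) l = ip (polyop (map_poly cnj p * p) h) l + ip (polyop [:- of_real (N\<^sup>2):] h) l"
      using h l by (simp only: ip_polyop_add)
    also have "ip (polyop (map_poly cnj p * p) h) l = ip w l" using h l by (simp add: ip_polyop_mult w_def u_def)
    also have "ip (polyop [:- of_real (N\<^sup>2):] h) l = - of_real (N\<^sup>2) * ip h l"
      using h l ip_scale[OF h l, of "- of_real (N\<^sup>2)"] by (simp add: polyop_def)
    finally show "ip (polyop ?q h) l = ip (\<lambda>x. w x - of_real (N\<^sup>2) * h x) l"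
      by (simp add: ip_diff[OF w h l])
  qed (auto intro: polyop_mem h diff_mem w)
  then have "(nrm (polyop ?q h))\<^sup>2 = (nrm w)\<^sup>2 - 2 * Re (cnj (of_real (N\<^sup>2)) * ip w h) + (N\<^sup>2)\<^sup>2 * (nrm h)\<^sup>2"
    using nrm_sq_diff[OF w h, of "of_real (N\<^sup>2)"] by (simp add: norm_power)
  also have "\<dots> = (nrm w)\<^sup>2 - 2 * N\<^sup>2 * (nrm u)\<^sup>2 + N\<^sup>2 * (N\<^sup>2 * (nrm h)\<^sup>2)"
    unfolding wh by (simp add: power2_eq_square flip: of_real_mult)
  also have "\<dots> \<le> (N * nrm u)\<^sup>2 - 2 * N\<^sup>2 * (nrm u)\<^sup>2 + N\<^sup>2 * (N\<^sup>2 * (nrm h)\<^sup>2)"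
    using wN nrm_nonneg[OF w] by (simp add: power_mono)
  also have "\<dots> = N\<^sup>2 * (N\<^sup>2 * (nrm h)\<^sup>2 - (nrm u)\<^sup>2)"
    by (simp add: power_mult_distrib algebra_simps)
  also have "\<dots> \<le> N\<^sup>2 * (N\<^sup>2 * (nrm h)\<^sup>2 - (c * nrm h)\<^sup>2)"
    using hc c0 nrm_nonneg[OF h] N(1) by (intro mult_left_mono diff_left_mono power_mono) (auto simp: u_def)
  also have "\<dots> = N\<^sup>2 * (N\<^sup>2 - c\<^sup>2) * (nrm h)\<^sup>2" by (simp add: power_mult_distrib algebra_simps)
  also have "\<dots> \<le> (e\<^sup>2 / 2) * (nrm h)\<^sup>2"
  proof (rule mult_right_mono)
    have "N\<^sup>2 - c\<^sup>2 \<le> e\<^sup>2 / (2 * N\<^sup>2)" unfolding c2 by simp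
    then have "N\<^sup>2 * (N\<^sup>2 - c\<^sup>2) \<le> N\<^sup>2 * (e\<^sup>2 / (2 * N\<^sup>2))" by (intro mult_left_mono) auto
    then show "N\<^sup>2 * (N\<^sup>2 - c\<^sup>2) \<le> e\<^sup>2 / 2" using N(1) by simp
  qed simp
  also have "\<dots> < (e * nrm h)\<^sup>2" using e nh by (simp add: power_mult_distrib)
  finally have "nrm (polyop ?q h) < e * nrm h"
    using e nh by (intro power2_less_imp_less[of _ "e * nrm h"]) auto
  then show ?thesis using h by blast
qed

lemma op_norm_obtain:
  obtains N where "0 \<le> N" "\<And>h. h \<in> V \<Longrightarrow> nrm (polyop p h) \<le> N * nrm h"
    "\<And>c. 0 \<le> c \<Longrightarrow> c < N \<Longrightarrow> \<exists>h\<in>V. c * nrm h < nrm (polyop p h)"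
proof -
  define X where "X = {c. 0 \<le> c \<and> (\<forall>h\<in>V. nrm (polyop p h) \<le> c * nrm h)}"
  have ne: "X \<noteq> {}" using polyop_bdd[of p] by (auto simp: X_def)
  have bb: "bdd_below X" by (rule bdd_belowI[of _ 0]) (auto simp: X_def)
  show thesis
  proof (rule that[of "Inf X"])
    show "0 \<le> Inf X" using ne by (intro cInf_greatest) (auto simp: X_def)
    show "nrm (polyop p h) \<le> Inf X * nrm h" if h: "h \<in> V" for h
    proof (cases "nrm h = 0")
      case True
      obtain c where "c \<in> X" using ne by blast
      then show ?thesis using h True by (auto simp: X_def)
    next
      case False
      then have p: "nrm h > 0" using nrm_nonneg[OF h] by simp
      have "nrm (polyop p h) / nrm h \<le> Inf X"
        using ne h p by (intro cInf_greatest) (auto simp: X_def divide_le_eq)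
      then show ?thesis using p by (simp add: divide_le_eq)
    qed
    show "\<exists>h\<in>V. c * nrm h < nrm (polyop p h)" if "0 \<le> c" "c < Inf X" for c
    proof (rule ccontr)
      assume "\<not> (\<exists>h\<in>V. c * nrm h < nrm (polyop p h))"
      then have "c \<in> X" using that by (auto simp: X_def not_less)
      then show False using cInf_lower[OF _ bb] that by fastforce
    qed
  qed
qed

lemma aspec_nonempty:
  assumes "h0 \<in> V" "0 < nrm h0"
  shows "aspec \<noteq> {}"
proof -
  let ?p = "[:0, 1:] :: complex poly"
  obtain N where N: "0 \<le> N" "\<And>h. h \<in> V \<Longrightarrow> nrm (polyop ?p h) \<le> N * nrm h"
    "\<And>c. 0 \<le> c \<Longrightarrow> c < N \<Longrightarrow> \<exists>h\<in>V. c * nrm h < nrm (polyop ?p h)"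
    using op_norm_obtain[of ?p] by blast
  show ?thesis
  proof (cases "N = 0")
    case True
    have "nrm (\<lambda>x. b h0 x - of_real 0 * h0 x) < e * nrm h0" if "e > 0" for e
      using N(2)[OF assms(1)] True that assms(2) nrm_polyop_linear[OF assms(1), of 0]
      by (simp add: order_le_less_trans)
    then have "0 \<in> aspec" using assms(1) unfolding aspec_def by blast
    then show ?thesis by blast
  next
    case False
    let ?q = "map_poly cnj ?p * ?p - [:of_real (N\<^sup>2):]"
    have "coeff ?q 2 = 1" by (simp add: map_poly_pCons numeral_2_eq_2)
    then have "?q \<noteq> 0" by (metis coeff_0 zero_neq_one)
    moreover have "\<exists>h\<in>V. nrm (polyop ?q h) < e * nrm h" if "e > 0" for e
      using N False that by (intro polyop_norm_attained) auto
    ultimately show ?thesis using polyop_root_aspec by blast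
  qed
qed

text \<open>The norm of \<open>p(b)\<close> is at most the supremum of \<open>\<bar>p\<bar>\<close> on the spectrum: if \<open>N\<close> is the norm, a root of
  \<open>\<bar>p\<bar>\<^sup>2 - N\<^sup>2\<close> lies in the spectrum.\<close>

theorem polyop_le_spectral:
  assumes C: "0 \<le> C" "\<And>t. t \<in> aspec \<Longrightarrow> cmod (poly p (of_real t)) \<le> C" and h: "h \<in> V"
  shows "nrm (polyop p h) \<le> C * nrm h"
proof -
  obtain N where N: "0 \<le> N" "\<And>h. h \<in> V \<Longrightarrow> nrm (polyop p h) \<le> N * nrm h"
    "\<And>c. 0 \<le> c \<Longrightarrow> c < N \<Longrightarrow> \<exists>h\<in>V. c * nrm h < nrm (polyop p h)"
    using op_norm_obtain[of p] by blast
  have "N \<le> C"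
  proof (rule ccontr)
    assume NC: "\<not> N \<le> C"
    then have N0: "0 < N" using C by simp
    let ?q = "map_poly cnj p * p - [:of_real (N\<^sup>2):]"
    have small: "\<exists>h\<in>V. nrm (polyop ?q h) < e * nrm h" if "e > 0" for e
      using N N0 that by (intro polyop_norm_attained) auto
    have "\<exists>t\<in>aspec. poly ?q (of_real t) = 0"
    proof (cases "?q = 0")
      case True
      obtain h0 where h0: "h0 \<in> V" "nrm (polyop ?q h0) < 1 * nrm h0" using small[of 1] by auto
      then have "0 < nrm h0" using nrm_nonneg[OF polyop_mem[OF h0(1)], of ?q] by simp
      then have "aspec \<noteq> {}" using aspec_nonempty h0 by blast
      then show ?thesis using True by auto
    qed (use small polyop_root_aspec in blast)
    then obtain t where t: "t \<in> aspec" "poly ?q (of_real t) = 0" by blast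
    have "poly (map_poly cnj p) (of_real t) = cnj (poly p (of_real t))"
      using poly_cnj[of p "of_real t"] by simp
    then have "of_real ((cmod (poly p (of_real t)))\<^sup>2) = (of_real (N\<^sup>2) :: complex)"
      using t(2) by (simp add: complex_norm_square mult.commute del: of_real_power)
    then have "(cmod (poly p (of_real t)))\<^sup>2 = N\<^sup>2" by (simp only: of_real_eq_iff)
    then have "cmod (poly p (of_real t)) = N" using N0 by (simp add: power2_eq_iff_nonneg)
    then show False using C(2)[OF t(1)] NC by simp
  qed
  then show ?thesis using N(2)[OF h] mult_right_mono[OF _ nrm_nonneg[OF h]] by (meson order_trans)
qed

lemma aspec_nonneg: assumes "t \<in> aspec" shows "0 \<le> t"
proof (rule ccontr)
  assume t: "\<not> 0 \<le> t"
  then obtain h where h: "h \<in> V" and hl: "nrm (\<lambda>x. b h x - of_real t * h x) < (- t) * nrm h"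
    using assms unfolding aspec_def by (auto dest!: spec[of _ "- t"])
  have m: "(\<lambda>x. b h x - of_real t * h x) \<in> V" using h by (intro diff_mem b_mem)
  have "nrm h \<noteq> 0" using hl nrm_nonneg[OF m] by auto
  then have nh: "0 < nrm h" using nrm_nonneg[OF h] by simp
  have "(- t) * (nrm h)\<^sup>2 \<le> Re (ip (\<lambda>x. b h x - of_real t * h x) h)"
    using h b_pos[OF h] by (simp add: ip_diff b_mem ip_self)
  also have "\<dots> \<le> nrm (\<lambda>x. b h x - of_real t * h x) * nrm h"
    using Cauchy_Schwarz[OF m h] complex_Re_le_cmod order_trans by blast
  also have "\<dots> < (- t) * nrm h * nrm h" using hl nh by (rule mult_strict_right_mono)
  finally show False by (simp add: power2_eq_square mult.assoc)
qed

lemma aspec_le: assumes "t \<in> aspec" shows "t \<le> B"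
proof (rule ccontr)
  assume t: "\<not> t \<le> B"
  then obtain h where h: "h \<in> V" and hl: "nrm (\<lambda>x. b h x - of_real t * h x) < (t - B) * nrm h"
    using assms unfolding aspec_def by (auto dest!: spec[of _ "t - B"])
  have th: "(\<lambda>x. of_real t * h x) \<in> V" using h by (rule scale_mem)
  have "t * nrm h - B * nrm h \<le> nrm (\<lambda>x. of_real t * h x) - nrm (b h)"
    using b_bdd[OF h] aspec_nonneg[OF assms] by (simp add: nrm_scale h)
  also have "\<dots> \<le> nrm (\<lambda>x. of_real t * h x - b h x)"
    by (rule nrm_triangle_lower[OF th b_mem[OF h]])
  also have "\<dots> = nrm (\<lambda>x. b h x - of_real t * h x)"
    using nrm_scale[OF diff_mem[OF b_mem[OF h] h, of "of_real t"], of "-1"] by (simp add: algebra_simps)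
  finally show False using hl by (simp add: algebra_simps)
qed

lemma Sup_aspec_mem:
  assumes ne: "aspec \<noteq> {}" shows "Sup aspec \<in> aspec"
proof (rule aspecI)
  fix e :: real assume e: "e > 0"
  let ?r = "Sup aspec"
  have bd: "bdd_above aspec" using aspec_le by (meson bdd_aboveI)
  obtain t where t: "t \<in> aspec" "?r - e / 2 < t" using less_cSup_iff[OF ne bd, of "?r - e/2"] e by auto
  have tr: "t \<le> ?r" using cSup_upper[OF t(1) bd] .
  obtain h where h: "h \<in> V" and hl: "nrm (\<lambda>x. b h x - of_real t * h x) < e / 2 * nrm h"
    using t(1) e unfolding aspec_def by (auto dest!: spec[of _ "e/2"])
  have "(\<lambda>x. b h x - of_real ?r * h x) = (\<lambda>x. (b h x - of_real t * h x) - of_real (?r - t) * h x)"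
    by (simp add: algebra_simps)
  then have "nrm (\<lambda>x. b h x - of_real ?r * h x) \<le> nrm (\<lambda>x. b h x - of_real t * h x) + cmod (of_real (?r - t)) * nrm h"
    using nrm_triangle_diff[OF diff_mem[OF b_mem[OF h] h] h] by simp
  also have "\<dots> < e / 2 * nrm h + cmod (of_real (?r - t)) * nrm h" using hl by simp
  also have "\<dots> \<le> e / 2 * nrm h + e / 2 * nrm h"
    using tr t(2) nrm_nonneg[OF h] by (intro add_left_mono mult_right_mono) (auto simp flip: of_real_diff)
  finally have "nrm (\<lambda>x. b h x - of_real ?r * h x) < e * nrm h" by simp
  then show "\<exists>h\<in>V. nrm (\<lambda>x. b h x - of_real ?r * h x) < e * nrm h"
    using h by blast
qed

text \<open>An approximate eigenvector of \<open>b\<close> is one of \<open>p(b)\<close>, since \<open>x - z\<close> divides \<open>p - p(z)\<close>.\<close>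

lemma polyop_near_eigenvector:
  "\<exists>C\<ge>0. \<forall>h\<in>V. nrm (\<lambda>x. polyop p h x - poly p z * h x) \<le> C * nrm (\<lambda>x. b h x - z * h x)"
proof -
  have "poly (p + [:- poly p z:]) z = 0" by simp
  then obtain g where "p + [:- poly p z:] = [:-z, 1:] * g" by (metis poly_eq_0_iff_dvd dvdE)
  then have g: "p + [:- poly p z:] = g * [:-z, 1:]" by (simp add: mult.commute)
  obtain C where C: "C \<ge> 0" "\<And>h. h \<in> V \<Longrightarrow> nrm (polyop g h) \<le> C * nrm h" using polyop_bdd[of g] by blast
  have "nrm (\<lambda>x. polyop p h x - poly p z * h x) \<le> C * nrm (\<lambda>x. b h x - z * h x)" if h: "h \<in> V" for h
  proof -
    have "nrm (\<lambda>x. polyop p h x - poly p z * h x) = nrm (polyop (p + [:- poly p z:]) h)"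
    proof (rule nrm_cong)
      fix l assume l: "l \<in> V"
      have "ip (polyop [:- poly p z:] h) l = - poly p z * ip h l"
        using ip_scale[OF h l, of "- poly p z"] by (simp add: polyop_def)
      then show "ip (\<lambda>x. polyop p h x - poly p z * h x) l = ip (polyop (p + [:- poly p z:]) h) l"
        using h l by (simp only: ip_polyop_add ip_diff polyop_mem) simp
    qed (intro diff_mem polyop_mem h)+
    also have "\<dots> = nrm (polyop g (polyop [:-z, 1:] h))" unfolding g by (rule nrm_polyop_mult[OF h])
    also have "\<dots> \<le> C * nrm (polyop [:-z, 1:] h)" by (intro C polyop_mem h)
    finally show ?thesis unfolding nrm_polyop_linear[OF h] .
  qed
  then show ?thesis using C(1) by blast
qed

lemma polyop_monom: "polyop (monom 1 k) h = (b ^^ k) h"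
  by (simp add: polyop_def degree_monom_eq fun_eq_iff if_distrib[of "\<lambda>x. x * _"] sum.delta cong: if_cong)

text \<open>A gap below a point \<open>r\<close> of the spectrum makes the powers of \<open>b / r\<close> converge geometrically.\<close>

lemma funpow_gap:
  assumes r: "0 < r" and q: "0 \<le> q" and gap: "\<And>t. t \<in> aspec \<Longrightarrow> t = r \<or> t \<le> q * r" and le: "\<And>t. t \<in> aspec \<Longrightarrow> t \<le> r"
    and h: "h \<in> V"
  shows "nrm (\<lambda>x. of_real ((1 / r) ^ Suc k) * (b ^^ Suc k) h x - of_real ((1 / r) ^ k) * (b ^^ k) h x) \<le> q ^ k * nrm h"
proof -
  let ?p = "smult (of_real ((1 / r) ^ Suc k)) (monom 1 (Suc k)) + smult (- of_real ((1 / r) ^ k)) (monom (1::complex) k)"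
  have eval: "cmod (poly ?p (of_real t)) \<le> q ^ k" if t: "t \<in> aspec" for t
  proof -
    have "poly ?p (of_real t) = of_real ((t / r) ^ k * (t / r - 1))"
      using r by (simp add: poly_monom field_simps)
    then have eq: "cmod (poly ?p (of_real t)) = \<bar>t / r\<bar> ^ k * \<bar>t / r - 1\<bar>"
      by (simp only: norm_of_real) (simp add: abs_mult power_abs)
    show ?thesis
    proof (cases "t = r")
      case True
      then show ?thesis unfolding eq using r q by simp
    next
      case False
      have t0: "0 \<le> t / r" "t / r \<le> 1" "t / r \<le> q"
        using gap[OF t] le[OF t] False aspec_nonneg[OF t] r by (auto simp: divide_le_eq)
      have "\<bar>t / r\<bar> ^ k * \<bar>t / r - 1\<bar> \<le> q ^ k * 1"
        using t0 by (intro mult_mono power_mono) auto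
      then show ?thesis unfolding eq by simp
    qed
  qed
  have m: "(b ^^ j) h \<in> V" for j using h by (rule funpow_mem)
  have "nrm (\<lambda>x. of_real ((1 / r) ^ Suc k) * (b ^^ Suc k) h x - of_real ((1 / r) ^ k) * (b ^^ k) h x) = nrm (polyop ?p h)"
  proof (rule nrm_cong)
    fix l assume l: "l \<in> V"
    show "ip (\<lambda>x. of_real ((1 / r) ^ Suc k) * (b ^^ Suc k) h x - of_real ((1 / r) ^ k) * (b ^^ k) h x) l = ip (polyop ?p h) l"
      unfolding ip_diff[OF scale_mem[OF m] m l] ip_scale[OF m l] ip_polyop_add[OF h l] ip_polyop_smult[OF h l] polyop_monom
      by simp
  qed (intro diff_mem scale_mem m polyop_mem h)+
  also have "\<dots> \<le> q ^ k * nrm h"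
    using q by (intro polyop_le_spectral eval h) auto
  finally show ?thesis .
qed

end

section \<open>Haar measure on a second countable group\<close>

lemma borel_measurable_group_uminus [measurable (raw)]:
  fixes g :: "'a \<Rightarrow> 'b::{second_countable_topology, topological_group_add}"
  assumes "g \<in> borel_measurable M"
  shows "(\<lambda>x. - g x) \<in> borel_measurable M"
  by (rule borel_measurable_continuous_on[OF _ assms]) (intro continuous_intros)

locale haar =
  fixes \<mu> :: "'g::{topological_group_add, t2_space, second_countable_topology} measure"
  assumes lc: "locally_compact_space (euclidean :: 'g topology)"
    and lh: "left_haar_measure \<mu>"
begin

lemma sets_haar [measurable_cong, simp]: "sets \<mu> = sets borel"
  by (rule lh[unfolded left_haar_measure_def, THEN conjunct1])

lemma space_haar [simp]: "space \<mu> = UNIV"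
  using sets_eq_imp_space_eq[OF sets_haar] by simp

lemma haar_nonzero: "emeasure \<mu> UNIV \<noteq> 0"
  by (rule lh[unfolded left_haar_measure_def, THEN conjunct2, THEN conjunct1])

lemma haar_compact: "compact K \<Longrightarrow> emeasure \<mu> K < \<infinity>"
  using lh[unfolded left_haar_measure_def, THEN conjunct2, THEN conjunct2, THEN conjunct1] by simp

lemma haar_translate: "A \<in> sets borel \<Longrightarrow> emeasure \<mu> ((+) a ` A) = emeasure \<mu> A"
  using lh[unfolded left_haar_measure_def, THEN conjunct2, THEN conjunct2, THEN conjunct2, THEN conjunct2, THEN conjunct2] by simp

lemma compact_neighbourhood:
  obtains U K where "open U" "compact K" "(x::'g) \<in> U" "U \<subseteq> K"
  using lc unfolding locally_compact_space_def by simp blast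

sublocale sigma_finite_measure \<mu>
proof
  define F where "F = {U :: 'g set. open U \<and> (\<exists>K. compact K \<and> U \<subseteq> K)}"
  have op: "\<And>S. S \<in> F \<Longrightarrow> open S" by (simp add: F_def)
 obtain F' where F': "F' \<subseteq> F" "countable F'" "\<Union>F' = \<Union>F" by (rule Lindelof[OF op])
  have "x \<in> \<Union>F" for x
  proof -
    obtain U K where "open U" "compact K" "x \<in> U" "U \<subseteq> K" by (rule compact_neighbourhood)
    then show ?thesis unfolding F_def by blast
  qed
  then have "\<Union>F = UNIV" by blast
  moreover have "emeasure \<mu> U \<noteq> \<infinity>" if "U \<in> F'" for U
  proof -
    have "U \<in> F" using that F' by blast
    then obtain K where K: "compact K" "U \<subseteq> K" by (auto simp: F_def)
    have "emeasure \<mu> U \<le> emeasure \<mu> K" using K by (intro emeasure_mono) (auto simp: borel_compact)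
    then show ?thesis using haar_compact[OF K(1)] by (auto simp: top_unique)
  qed
  ultimately show "\<exists>A. countable A \<and> A \<subseteq> sets \<mu> \<and> \<Union>A = space \<mu> \<and> (\<forall>a\<in>A. emeasure \<mu> a \<noteq> \<infinity>)"
    using F' by (intro exI[of _ F']) (auto simp: F_def)
qed

sublocale P: pair_sigma_finite \<mu> \<mu> ..

lemma distr_left: "distr \<mu> borel (\<lambda>x. a + x) = \<mu>"
proof (rule measure_eqI)
  fix A :: "'g set" assume A: "A \<in> sets (distr \<mu> borel (\<lambda>x. a + x))"
  have "(\<lambda>x. a + x) -` A = (+) (-a) ` A"
    by (force simp: image_iff add.assoc[symmetric])
  then show "emeasure (distr \<mu> borel (\<lambda>x. a + x)) A = emeasure \<mu> A"
    using A haar_translate[of A "-a"] by (simp add: emeasure_distr)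
qed simp

lemma nn_integral_left:
  assumes [measurable]: "f \<in> borel_measurable borel"
  shows "(\<integral>\<^sup>+x. f (a + x) \<partial>\<mu>) = (\<integral>\<^sup>+x. f x \<partial>\<mu>)"
  using nn_integral_distr[of "\<lambda>x. a + x" \<mu> borel f] by (simp add: distr_left)

lemma integral_left:
  fixes f :: "'g \<Rightarrow> 'b::{banach, second_countable_topology}"
  assumes [measurable]: "f \<in> borel_measurable borel"
  shows "(LINT x|\<mu>. f (a + x)) = (LINT x|\<mu>. f x)"
  using integral_distr[of "\<lambda>x. a + x" \<mu> borel f] by (simp add: distr_left)

lemma AE_compose:
  assumes [measurable]: "T \<in> measurable borel borel"
    and null: "\<And>N. N \<in> null_sets \<mu> \<Longrightarrow> T -` N \<in> null_sets \<mu>"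
    and P: "AE x in \<mu>. P x"
  shows "AE x in \<mu>. P (T x)"
proof -
  from P obtain N where N: "\<And>x. x \<in> space \<mu> - N \<Longrightarrow> P x" "N \<in> null_sets \<mu>"
    by (rule AE_E3) blast
  show ?thesis
    by (rule AE_I'[OF null[OF N(2)]]) (use N(1) in auto)
qed

lemma AE_left: "AE x in \<mu>. P x \<Longrightarrow> AE x in \<mu>. P (a + x)"
proof (rule AE_compose)
  fix N assume N: "N \<in> null_sets \<mu>"
  then have b: "N \<in> sets borel" by (simp add: null_sets_def)
  have m: "(\<lambda>x. a + x) -` N \<in> sets borel"
    using measurable_sets[of "\<lambda>x. a + x" borel borel N] b by simp
  have "emeasure (distr \<mu> borel (\<lambda>x. a + x)) N = emeasure \<mu> ((\<lambda>x. a + x) -` N)"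
    using b by (simp add: emeasure_distr)
  then show "(\<lambda>x. a + x) -` N \<in> null_sets \<mu>" using N m by (simp add: distr_left null_sets_def)
qed simp

text \<open>Inversion preserves null sets: integrate the indicator of \<open>{(x, y). - x + y \<in> N}\<close> in both orders.\<close>

lemma null_sets_uminus:
  assumes N: "N \<in> null_sets \<mu>"
  shows "uminus -` N \<in> null_sets \<mu>"
proof -
  have [measurable]: "N \<in> sets borel" and N0: "emeasure \<mu> N = 0" using N by (auto simp: null_sets_def)
  have m [measurable]: "uminus -` N \<in> sets borel"
    using measurable_sets[of "uminus" borel borel N] by simp
  have "(\<integral>\<^sup>+x. \<integral>\<^sup>+y. indicator N (- x + y) \<partial>\<mu> \<partial>\<mu>) = 0"
    using N0 by (simp add: nn_integral_left[of "indicator N"])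
  moreover have "(\<integral>\<^sup>+x. \<integral>\<^sup>+y. indicator N (- x + y) \<partial>\<mu> \<partial>\<mu>) = (\<integral>\<^sup>+y. \<integral>\<^sup>+x. indicator N (- x + y) \<partial>\<mu> \<partial>\<mu>)"
    by (rule P.Fubini'[symmetric]) simp
  moreover have "(\<integral>\<^sup>+x. indicator N (- x + y) \<partial>\<mu>) = emeasure \<mu> (uminus -` N)" for y
  proof -
    have "(\<integral>\<^sup>+x. indicator N (- x + y) \<partial>\<mu>) = (\<integral>\<^sup>+x. indicator N (- (y + x) + y) \<partial>\<mu>)"
      by (rule nn_integral_left[symmetric]) simp
    also have "\<dots> = (\<integral>\<^sup>+x. indicator (uminus -` N) x \<partial>\<mu>)"
      by (intro nn_integral_cong) (simp add: minus_add add.assoc indicator_def)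
    finally show ?thesis by simp
  qed
  ultimately have "emeasure \<mu> (uminus -` N) * emeasure \<mu> UNIV = 0" by simp
  then show ?thesis using haar_nonzero m by (auto simp: null_sets_def)
qed

lemma AE_uminus: "AE x in \<mu>. P x \<Longrightarrow> AE x in \<mu>. P (- x)"
  by (rule AE_compose) (simp_all add: null_sets_uminus)

lemma AE_right: "AE x in \<mu>. P x \<Longrightarrow> AE x in \<mu>. P (x + a)"
  using AE_uminus[OF AE_left[OF AE_uminus[of P], of "- a"]] by (simp add: minus_add)

text \<open>Countably many translates of a nonempty open set cover the group.\<close>

lemma open_pos:
  assumes U: "open U" "U \<noteq> ({} :: 'g set)"
  shows "emeasure \<mu> U \<noteq> 0"
proof
  assume U0: "emeasure \<mu> U = 0"
  obtain u where u: "u \<in> U" using U by blast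
  define F where "F = range (\<lambda>a. (\<lambda>x. a + x) -` U)"
  have op: "open S" if "S \<in> F" for S
    using that U(1) unfolding F_def by (auto intro!: open_vimage continuous_intros)
 obtain F' where F': "F' \<subseteq> F" "countable F'" "\<Union>F' = \<Union>F" by (rule Lindelof[OF op])
  have "x \<in> \<Union>F" for x
    unfolding F_def using u by (auto intro!: exI[of _ "u - x"])
  then have cov: "\<Union>F' = UNIV" using F' by auto
  have "S \<in> null_sets \<mu>" if S: "S \<in> F'" for S
  proof -
    obtain a where a: "S = (\<lambda>x. a + x) -` U" using S F' by (auto simp: F_def)
    have "emeasure \<mu> S = emeasure (distr \<mu> borel (\<lambda>x. a + x)) U"
      using U(1) by (simp add: a emeasure_distr)
    then show ?thesis using U0 op[of S] S F' by (auto simp: distr_left null_sets_def)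
  qed
  then have "(\<Union>S\<in>F'. S) \<in> null_sets \<mu>" using F'(2) by (intro null_sets_UN') auto
  then show False using cov haar_nonzero by (simp add: null_sets_def)
qed

text \<open>Let \<open>U\<close> be an open neighbourhood of \<open>0\<close> in a compact set \<open>C\<close>.  A maximal finite set \<open>F\<close> with disjoint translates
  \<open>g + U\<close> exists by finiteness of the measure, and the compact sets \<open>g + (C - C)\<close> with \<open>g\<close> in \<open>F\<close> cover the group.\<close>

lemma finite_imp_compact:
  assumes fin: "emeasure \<mu> UNIV \<noteq> \<infinity>"
  shows "compact (UNIV :: 'g set)"
proof -
  obtain U C where UC: "open U" "compact C" "(0::'g) \<in> U" "U \<subseteq> C" by (rule compact_neighbourhood)
  have [measurable]: "U \<in> sets borel" using UC by simp
  have pos: "0 < emeasure \<mu> U" using open_pos[of U] UC by (auto simp: zero_less_iff_neq_zero)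
  have tr: "(+) g ` U \<in> sets borel" for g
  proof -
    have "(+) g ` U = (\<lambda>x. - g + x) -` U" by (force simp: image_iff add.assoc[symmetric])
    then show ?thesis using measurable_sets[of "\<lambda>x. - g + x" borel borel U] by simp
  qed
  define \<F> where "\<F> = {F :: 'g set. finite F \<and> disjoint_family_on (\<lambda>g. (+) g ` U) F}"
  have bound: "of_nat (card F) * emeasure \<mu> U \<le> emeasure \<mu> UNIV" if F: "F \<in> \<F>" for F
  proof -
    have "of_nat (card F) * emeasure \<mu> U = (\<Sum>g\<in>F. emeasure \<mu> ((+) g ` U))"
      by (simp add: haar_translate)
    also have "\<dots> = emeasure \<mu> (\<Union>g\<in>F. (+) g ` U)"
      using F tr by (intro sum_emeasure) (auto simp: \<F>_def)
    also have "\<dots> \<le> emeasure \<mu> UNIV" by (intro emeasure_mono) auto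
    finally show ?thesis .
  qed
  have Ufin: "emeasure \<mu> U < \<infinity>"
    using emeasure_mono[of U UNIV \<mu>] fin by (auto simp: less_top top_unique)
  have real_bound: "real (card F) \<le> measure \<mu> UNIV / measure \<mu> U" if F: "F \<in> \<F>" for F
  proof -
    have m: "measure \<mu> U > 0" using pos Ufin by (simp add: measure_def enn2real_positive_iff)
    have "ennreal (real (card F) * measure \<mu> U) \<le> ennreal (measure \<mu> UNIV)"
      using bound[OF F] fin Ufin
      by (simp add: emeasure_eq_ennreal_measure ennreal_mult ennreal_of_nat_eq_real_of_nat top_unique)
    then have "real (card F) * measure \<mu> U \<le> measure \<mu> UNIV" by (simp add: ennreal_le_iff)
    then show ?thesis using m by (simp add: le_divide_eq)
  qed
  have "{} \<in> \<F>" by (simp add: \<F>_def disjoint_family_on_def)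
  moreover have "\<forall>F. F \<in> \<F> \<longrightarrow> card F < Suc (nat \<lfloor>measure \<mu> UNIV / measure \<mu> U\<rfloor>)"
    using real_bound by (auto intro!: le_nat_floor simp: less_Suc_eq_le)
  ultimately have "\<exists>F. F \<in> \<F> \<and> (\<forall>F'. F' \<in> \<F> \<longrightarrow> card F' \<le> card F)"
    by (rule Lattices_Big.ex_has_greatest_nat)
  then obtain F where F: "F \<in> \<F>" and Fmax: "\<And>F'. F' \<in> \<F> \<Longrightarrow> card F' \<le> card F" by auto
  have "x \<in> (\<Union>g\<in>F. (\<lambda>(u, v). g + (u - v)) ` (C \<times> C))" for x
  proof (cases "x \<in> F")
    case True
    then show ?thesis using UC by (auto intro!: bexI[of _ x] image_eqI[of _ _ "(0, 0)"])
  next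
    case False
    have "\<not> (\<forall>g\<in>F. (+) g ` U \<inter> (+) x ` U = {})"
    proof
      assume a: "\<forall>g\<in>F. (+) g ` U \<inter> (+) x ` U = {}"
      then have "insert x F \<in> \<F>" using F unfolding \<F>_def disjoint_family_on_def by blast
      then have "card (insert x F) \<le> card F" by (rule Fmax)
      then show False using False F by (simp add: \<F>_def)
    qed
    then obtain g u v where g: "g \<in> F" "u \<in> U" "v \<in> U" "g + u = x + v" by auto
    then have "x = g + (u - v)" by (metis add.assoc add_diff_cancel diff_conv_add_uminus)
    then show ?thesis using g UC by (auto intro!: bexI[of _ g] image_eqI[of _ _ "(u, v)"])
  qed
  then have cov: "(\<Union>g\<in>F. (\<lambda>(u, v). g + (u - v)) ` (C \<times> C)) = UNIV" by auto
  have "compact ((\<lambda>(u, v). g + (u - v)) ` (C \<times> C))" for g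
    unfolding split_def using UC(2)
    by (intro compact_continuous_image continuous_intros compact_Times)
  then have "compact (\<Union>g\<in>F. (\<lambda>(u, v). g + (u - v)) ` (C \<times> C))"
    using F by (intro compact_UN) (auto simp: \<F>_def)
  then show ?thesis unfolding cov .
qed

text \<open>A finite measure equivalent to \<open>\<mu>\<close> and invariant under inversion: symmetrise \<open>h d\<mu>\<close> with \<open>h > 0\<close> integrable, and
  take the density with respect to \<open>\<mu>\<close>.  This avoids the modular function.\<close>

lemma symmetric_density:
  obtains f :: "'g \<Rightarrow> real" where "f \<in> borel_measurable borel" "\<And>x. 0 \<le> f x" "AE x in \<mu>. 0 < f x"
    "integrable \<mu> f" "distr (density \<mu> f) borel uminus = density \<mu> f"
proof -
  obtain h where h [measurable]: "h \<in> borel_measurable \<mu>" and hfin: "(\<integral>\<^sup>+x. h x \<partial>\<mu>) \<noteq> \<infinity>"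
    and hpos: "\<And>x. 0 < h x \<and> h x < \<infinity>"
    using Ex_finite_integrable_function by auto
  define M0 where "M0 = density \<mu> h"
  define M1 where "M1 = distr M0 borel uminus"
  have s0 [simp, measurable_cong]: "sets M0 = sets borel" by (simp add: M0_def)
  have s1 [simp, measurable_cong]: "sets M1 = sets borel" by (simp add: M1_def)
  have M1: "emeasure M1 A = emeasure M0 (uminus -` A)" if "A \<in> sets borel" for A
    using that sets_eq_imp_space_eq[OF s0] by (simp add: M1_def emeasure_distr)
  have neg: "uminus -` A \<in> sets borel" if "A \<in> sets borel" for A :: "'g set"
    using measurable_sets[of "uminus" borel borel A] that by simp
  have "absolutely_continuous \<mu> M1"
    unfolding absolutely_continuous_def
  proof
    fix N assume N: "N \<in> null_sets \<mu>"
    then have N': "uminus -` N \<in> null_sets \<mu>" by (rule null_sets_uminus)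
    have "emeasure M0 (uminus -` N) = 0"
      unfolding M0_def using N' by (subst emeasure_density) (auto simp: null_sets_def intro!: nn_integral_null_set)
    then show "N \<in> null_sets M1" using N M1[of N] by (auto simp: null_sets_def)
  qed
  then obtain g where g [measurable]: "g \<in> borel_measurable \<mu>" and gM: "density \<mu> g = M1"
    using Radon_Nikodym[of M1] by auto
  have em: "emeasure (density \<mu> (\<lambda>x. h x + g x)) A = emeasure M0 A + emeasure M1 A" if A: "A \<in> sets borel" for A
    unfolding gM[symmetric] M0_def using A
    by (simp add: emeasure_density distrib_right nn_integral_add)
  define f where "f x = enn2real (h x + g x)" for x
  have fm [measurable]: "f \<in> borel_measurable borel" unfolding f_def
    using h g by (simp add: measurable_cong_sets[OF sets_haar refl])
  have tot: "(\<integral>\<^sup>+x. h x + g x \<partial>\<mu>) \<noteq> \<infinity>"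
  proof -
    have "(\<integral>\<^sup>+x. h x + g x \<partial>\<mu>) = emeasure (density \<mu> (\<lambda>x. h x + g x)) UNIV"
      by (simp add: emeasure_density)
    also have "\<dots> = emeasure M0 UNIV + emeasure M1 UNIV" by (rule em) simp
    also have "\<dots> = emeasure M0 UNIV + emeasure M0 UNIV" by (simp add: M1)
    also have "emeasure M0 UNIV = (\<integral>\<^sup>+x. h x \<partial>\<mu>)" by (simp add: M0_def emeasure_density)
    finally show ?thesis using hfin by simp
  qed
  then have fin: "AE x in \<mu>. h x + g x \<noteq> \<infinity>" by (intro nn_integral_PInf_AE) auto
  have eqf: "AE x in \<mu>. ennreal (f x) = h x + g x"
    using fin by eventually_elim (simp add: f_def less_top)
  have dens: "density \<mu> f = density \<mu> (\<lambda>x. h x + g x)"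
    using eqf by (intro density_cong) auto
  show thesis
  proof (rule that[of f])
    show "AE x in \<mu>. 0 < f x"
      using fin by eventually_elim (use hpos in \<open>auto simp: f_def enn2real_positive_iff less_top add_pos_nonneg intro: add_pos_nonneg\<close>)
    have "(\<integral>\<^sup>+x. ennreal (f x) \<partial>\<mu>) = (\<integral>\<^sup>+x. h x + g x \<partial>\<mu>)"
      using eqf by (rule nn_integral_cong_AE)
    then show "integrable \<mu> f"
      using tot by (intro integrableI_nonneg) (auto simp: f_def less_top)
    show "distr (density \<mu> f) borel uminus = density \<mu> f"
    proof (rule measure_eqI)
      fix A assume "A \<in> sets (distr (density \<mu> f) borel uminus)"
      then have A: "A \<in> sets borel" by simp
      have "emeasure (distr (density \<mu> f) borel uminus) A = emeasure (density \<mu> f) (uminus -` A)"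
        using A by (subst emeasure_distr) auto
      also have "\<dots> = emeasure M0 (uminus -` A) + emeasure M1 (uminus -` A)"
        unfolding dens by (rule em[OF neg[OF A]])
      also have "\<dots> = emeasure M1 A + emeasure M0 A"
        using A neg[OF A] by (simp add: M1 vimage_def)
      also have "\<dots> = emeasure (density \<mu> f) A" unfolding dens em[OF A] by (rule add.commute)
      finally show "emeasure (distr (density \<mu> f) borel uminus) A = emeasure (density \<mu> f) A" .
    qed simp
  qed (simp_all add: f_def fm[unfolded f_def])
qed

end

section \<open>Square integrable functions and convolution\<close>

lemma borel_measurable_cnj [measurable (raw)]:
  "f \<in> borel_measurable M \<Longrightarrow> (\<lambda>x. cnj (f x)) \<in> borel_measurable M"
  by (rule borel_measurable_continuous_on) (intro continuous_intros)

lemma L2_fun_iff: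
  "h \<in> L2_fun M \<longleftrightarrow> h \<in> borel_measurable M \<and> (\<integral>\<^sup>+x. (ennreal (cmod (h x)))\<^sup>2 \<partial>M) < \<infinity>"
  by (auto simp: L2_fun_def integrable_iff_bounded ennreal_power)

lemma L2_fun_bound:
  assumes "h \<in> L2_fun M" "k \<in> L2_fun M" "g \<in> borel_measurable M"
    and "\<And>x. (cmod (g x))\<^sup>2 \<le> c * ((cmod (h x))\<^sup>2 + (cmod (k x))\<^sup>2)"
  shows "g \<in> L2_fun M"
proof -
  have "integrable M (\<lambda>x. c * ((cmod (h x))\<^sup>2 + (cmod (k x))\<^sup>2))"
    using assms(1,2) by (auto simp: L2_fun_def)
  then have "integrable M (\<lambda>x. (cmod (g x))\<^sup>2)"
    by (rule Bochner_Integration.integrable_bound) (use assms(3,4) in \<open>auto intro: order_trans[OF _ abs_ge_self]\<close>)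
  then show ?thesis using assms(3) by (simp add: L2_fun_def)
qed

lemma L2_prod_integrable:
  assumes "h \<in> L2_fun M" "k \<in> L2_fun M"
  shows "integrable M (\<lambda>x. h x * cnj (k x))"
proof (rule Bochner_Integration.integrable_bound)
  show "integrable M (\<lambda>x. (cmod (h x))\<^sup>2 + (cmod (k x))\<^sup>2)"
    using assms by (auto simp: L2_fun_def)
  have [measurable]: "h \<in> borel_measurable M" "k \<in> borel_measurable M" using assms by (auto simp: L2_fun_def)
  show "(\<lambda>x. h x * cnj (k x)) \<in> borel_measurable M" by measurable
  have "cmod (h x) * cmod (k x) \<le> (cmod (h x))\<^sup>2 + (cmod (k x))\<^sup>2" for x
    using sum_squares_bound[of "cmod (h x)" "cmod (k x)"] mult_nonneg_nonneg[OF norm_ge_zero norm_ge_zero, of "h x" "k x"]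
    by linarith
  then show "AE x in M. norm (h x * cnj (k x)) \<le> norm ((cmod (h x))\<^sup>2 + (cmod (k x))\<^sup>2)"
    by (simp add: norm_mult)
qed

text \<open>The inner product of square integrable functions.\<close>

definition ip2 :: "'x measure \<Rightarrow> ('x \<Rightarrow> complex) \<Rightarrow> ('x \<Rightarrow> complex) \<Rightarrow> complex" where
  "ip2 M h k = (LINT x|M. h x * cnj (k x))"

lemma L2_add_mem:
  assumes "h \<in> L2_fun M" "k \<in> L2_fun M"
  shows "(\<lambda>x. h x + k x) \<in> L2_fun M"
proof (rule L2_fun_bound[OF assms, where c = 2])
  show "(\<lambda>x. h x + k x) \<in> borel_measurable M" using assms by (auto simp: L2_fun_def)
  show "(cmod (h x + k x))\<^sup>2 \<le> 2 * ((cmod (h x))\<^sup>2 + (cmod (k x))\<^sup>2)" for x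
  proof -
    have "(cmod (h x + k x))\<^sup>2 \<le> (cmod (h x) + cmod (k x))\<^sup>2"
      by (intro power_mono norm_triangle_ineq) auto
    then show ?thesis using sum_squares_bound[of "cmod (h x)" "cmod (k x)"] by (simp add: power2_sum)
  qed
qed

lemma L2_scale_mem: "h \<in> L2_fun M \<Longrightarrow> (\<lambda>x. c * h x) \<in> L2_fun M"
  by (rule L2_fun_bound[where c = "(cmod c)\<^sup>2" and h = h and k = h])
     (auto simp: L2_fun_def norm_mult power_mult_distrib mult_left_mono)

lemma L2_semi_inner: "semi_inner (L2_fun M) (ip2 M)"
proof
  show "(\<lambda>x. 0) \<in> L2_fun M" by (simp add: L2_fun_def)
  fix h k l :: "'a \<Rightarrow> complex" and c
  assume h: "h \<in> L2_fun M" and k: "k \<in> L2_fun M"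
  show "(\<lambda>x. h x + k x) \<in> L2_fun M" using h k by (rule L2_add_mem)
  show "(\<lambda>x. c * h x) \<in> L2_fun M" using h by (rule L2_scale_mem)
  show "0 \<le> Re (ip2 M h h)"
  proof -
    have "ip2 M h h = (LINT x|M. complex_of_real ((cmod (h x))\<^sup>2))"
      unfolding ip2_def by (simp only: complex_norm_square)
    also have "\<dots> = complex_of_real (LINT x|M. (cmod (h x))\<^sup>2)" by (rule integral_complex_of_real)
    finally show ?thesis by simp
  qed
  show "ip2 M k h = cnj (ip2 M h k)"
    using Bochner_Integration.integral_cnj[of M "\<lambda>x. h x * cnj (k x)"] unfolding ip2_def by (simp add: mult.commute)
  show "ip2 M (\<lambda>x. c * h x) k = c * ip2 M h k"
    by (simp add: ip2_def mult.assoc)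
  assume l: "l \<in> L2_fun M"
  show "ip2 M (\<lambda>x. h x + k x) l = ip2 M h l + ip2 M k l"
    unfolding ip2_def distrib_right
    by (intro Bochner_Integration.integral_add L2_prod_integrable h k l)
qed

context haar
begin

sublocale L2: semi_inner "L2_fun \<mu>" "ip2 \<mu>"
  by (rule L2_semi_inner)

lemma nrm_eq: "L2.nrm h = sqrt (LINT x|\<mu>. (cmod (h x))\<^sup>2)"
proof -
  have "ip2 \<mu> h h = (LINT x|\<mu>. complex_of_real ((cmod (h x))\<^sup>2))"
    unfolding ip2_def by (simp only: complex_norm_square)
  also have "\<dots> = complex_of_real (LINT x|\<mu>. (cmod (h x))\<^sup>2)" by (rule integral_complex_of_real)
  finally show ?thesis by (simp add: L2.nrm_def)
qed

lemma nn_integral_sq_eq: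
  assumes "h \<in> L2_fun \<mu>"
  shows "(\<integral>\<^sup>+x. (ennreal (cmod (h x)))\<^sup>2 \<partial>\<mu>) = ennreal ((L2.nrm h)\<^sup>2)"
proof -
  have "(\<integral>\<^sup>+x. ennreal ((cmod (h x))\<^sup>2) \<partial>\<mu>) = ennreal (LINT x|\<mu>. (cmod (h x))\<^sup>2)"
    using assms by (intro nn_integral_eq_integral) (auto simp: L2_fun_def)
  then show ?thesis by (simp add: nrm_eq ennreal_power)
qed

lemma L2_measurable: "h \<in> L2_fun \<mu> \<Longrightarrow> h \<in> borel_measurable borel"
  by (simp add: L2_fun_def measurable_cong_sets[OF sets_haar refl])

lemma nrm_0_iff:
  assumes h: "h \<in> L2_fun \<mu>"
  shows "L2.nrm h = 0 \<longleftrightarrow> (AE x in \<mu>. h x = 0)"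
proof -
  have [measurable]: "h \<in> borel_measurable borel" using h by (rule L2_measurable)
  have "L2.nrm h = 0 \<longleftrightarrow> ennreal ((L2.nrm h)\<^sup>2) = 0" by (simp add: ennreal_eq_0_iff)
  also have "\<dots> \<longleftrightarrow> (\<integral>\<^sup>+x. (ennreal (cmod (h x)))\<^sup>2 \<partial>\<mu>) = 0" by (simp only: nn_integral_sq_eq[OF h])
  also have "\<dots> \<longleftrightarrow> (AE x in \<mu>. (ennreal (cmod (h x)))\<^sup>2 = 0)" by (rule nn_integral_0_iff_AE) measurable
  finally show ?thesis by simp
qed

lemma AE_eq_iff_nrm:
  assumes "h \<in> L2_fun \<mu>" "k \<in> L2_fun \<mu>"
  shows "(AE x in \<mu>. h x = k x) \<longleftrightarrow> L2.nrm (\<lambda>x. h x - k x) = 0"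
  using nrm_0_iff[OF L2.sub_mem[OF assms]] by simp

lemma AE_eqI_ip:
  assumes "h \<in> L2_fun \<mu>" "k \<in> L2_fun \<mu>" "\<And>l. l \<in> L2_fun \<mu> \<Longrightarrow> ip2 \<mu> h l = ip2 \<mu> k l"
  shows "AE x in \<mu>. h x = k x"
  unfolding AE_eq_iff_nrm[OF assms(1,2)] by (rule L2.nrm_diff_eq_0[OF assms])

lemma ip2_cong_AE:
  assumes "h \<in> L2_fun \<mu>" "k \<in> L2_fun \<mu>" "AE x in \<mu>. h x = k x" "l \<in> L2_fun \<mu>"
  shows "ip2 \<mu> h l = ip2 \<mu> k l"
  unfolding ip2_def
  using assms(3) L2_measurable[OF assms(1)] L2_measurable[OF assms(2)] L2_measurable[OF assms(4)]
  by (intro integral_cong_AE) auto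

text \<open>Convolution of a nonnegative real function with one that has values in \<open>[0, \<infinity>]\<close>; it is defined everywhere.\<close>

definition nconv :: "('g \<Rightarrow> real) \<Rightarrow> ('g \<Rightarrow> ennreal) \<Rightarrow> 'g \<Rightarrow> ennreal" where
  "nconv f h x = (\<integral>\<^sup>+y. ennreal (f y) * h (- y + x) \<partial>\<mu>)"

lemma nconv_measurable [measurable]:
  assumes [measurable]: "f \<in> borel_measurable borel" "h \<in> borel_measurable borel"
  shows "nconv f h \<in> borel_measurable borel"
  unfolding nconv_def by measurable

text \<open>Young's inequality for \<open>L\<^sup>1\<close> and \<open>L\<^sup>2\<close>, by the Cauchy-Schwarz inequality with respect to the measure \<open>f d\<mu>\<close>.\<close>

lemma nconv_sq:
  assumes [measurable]: "f \<in> borel_measurable borel" "h \<in> borel_measurable borel" and f: "\<And>x. 0 \<le> f x"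
  shows "(\<integral>\<^sup>+x. (nconv f h x)\<^sup>2 \<partial>\<mu>) \<le> (\<integral>\<^sup>+x. f x \<partial>\<mu>)\<^sup>2 * (\<integral>\<^sup>+x. (h x)\<^sup>2 \<partial>\<mu>)"
proof -
  have sq: "(ennreal (sqrt (f y)))\<^sup>2 = ennreal (f y)" for y using f by (simp add: ennreal_power)
  have sq': "ennreal (sqrt (f y)) * ennreal (sqrt (f y)) = ennreal (f y)" for y
    using sq[of y] by (simp add: power2_eq_square)
  have "(nconv f h x)\<^sup>2 \<le> (\<integral>\<^sup>+y. f y \<partial>\<mu>) * (\<integral>\<^sup>+y. ennreal (f y) * (h (- y + x))\<^sup>2 \<partial>\<mu>)" for x
  proof -
    have "nconv f h x = (\<integral>\<^sup>+y. ennreal (sqrt (f y)) * (ennreal (sqrt (f y)) * h (- y + x)) \<partial>\<mu>)"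
      unfolding nconv_def mult.assoc[symmetric] sq' ..
    then have "(nconv f h x)\<^sup>2 \<le> (\<integral>\<^sup>+y. (ennreal (sqrt (f y)))\<^sup>2 \<partial>\<mu>) * (\<integral>\<^sup>+y. (ennreal (sqrt (f y)) * h (- y + x))\<^sup>2 \<partial>\<mu>)"
      by (simp only:) (rule Cauchy_Schwarz_nn_integral, measurable)
    then show ?thesis by (simp add: power_mult_distrib sq)
  qed
  then have "(\<integral>\<^sup>+x. (nconv f h x)\<^sup>2 \<partial>\<mu>) \<le> (\<integral>\<^sup>+x. (\<integral>\<^sup>+y. f y \<partial>\<mu>) * (\<integral>\<^sup>+y. ennreal (f y) * (h (- y + x))\<^sup>2 \<partial>\<mu>) \<partial>\<mu>)"
    by (intro nn_integral_mono)
  also have "\<dots> = (\<integral>\<^sup>+y. f y \<partial>\<mu>) * (\<integral>\<^sup>+x. \<integral>\<^sup>+y. ennreal (f y) * (h (- y + x))\<^sup>2 \<partial>\<mu> \<partial>\<mu>)"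
    by (rule nn_integral_cmult) measurable
  also have "(\<integral>\<^sup>+x. \<integral>\<^sup>+y. ennreal (f y) * (h (- y + x))\<^sup>2 \<partial>\<mu> \<partial>\<mu>) = (\<integral>\<^sup>+y. \<integral>\<^sup>+x. ennreal (f y) * (h (- y + x))\<^sup>2 \<partial>\<mu> \<partial>\<mu>)"
    by (rule P.Fubini') simp
  also have "\<dots> = (\<integral>\<^sup>+y. ennreal (f y) * (\<integral>\<^sup>+x. (h x)\<^sup>2 \<partial>\<mu>) \<partial>\<mu>)"
    by (simp add: nn_integral_cmult nn_integral_left[of "\<lambda>x. (h x)\<^sup>2"])
  also have "\<dots> = (\<integral>\<^sup>+y. f y \<partial>\<mu>) * (\<integral>\<^sup>+x. (h x)\<^sup>2 \<partial>\<mu>)"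
    by (rule nn_integral_multc) measurable
  finally show ?thesis by (simp add: power2_eq_square mult.assoc)
qed

lemma L1_measurable: "f \<in> L1_fun \<mu> \<Longrightarrow> f \<in> borel_measurable borel"
  using borel_measurable_integrable[of \<mu> f] by (simp add: L1_fun_def measurable_cong_sets[OF sets_haar refl])

lemma convolution_measurable [measurable]:
  assumes [measurable]: "f \<in> borel_measurable borel" "h \<in> borel_measurable borel"
  shows "convolution \<mu> f h \<in> borel_measurable borel"
  unfolding convolution_def by measurable

lemma convolution_le_nconv:
  "ennreal (cmod (convolution \<mu> f h x)) \<le> nconv (\<lambda>y. cmod (f y)) (\<lambda>y. ennreal (cmod (h y))) x"
proof (cases "integrable \<mu> (\<lambda>y. f y * h (- y + x))")
  case True
  then show ?thesis unfolding convolution_def nconv_def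
    using integral_norm_bound_ennreal[OF True] by (simp add: norm_mult ennreal_mult)
qed (simp add: convolution_def not_integrable_integral_eq)

lemma L1_nn_integral: "f \<in> L1_fun \<mu> \<Longrightarrow> (\<integral>\<^sup>+x. ennreal (cmod (f x)) \<partial>\<mu>) = ennreal (LINT x|\<mu>. cmod (f x))"
  by (intro nn_integral_eq_integral) (auto simp: L1_fun_def)

lemma
  assumes f: "f \<in> L1_fun \<mu>" and h: "h \<in> L2_fun \<mu>"
  shows convolution_L2: "convolution \<mu> f h \<in> L2_fun \<mu>"
    and nrm_convolution: "L2.nrm (convolution \<mu> f h) \<le> (LINT x|\<mu>. cmod (f x)) * L2.nrm h"
proof -
  have [measurable]: "f \<in> borel_measurable borel" "h \<in> borel_measurable borel"
    using f h L1_measurable L2_measurable by auto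
  let ?I = "LINT x|\<mu>. cmod (f x)"
  have I: "0 \<le> ?I" by simp
  have n: "0 \<le> L2.nrm h" using h by (rule L2.nrm_nonneg)
  have "(\<integral>\<^sup>+x. (ennreal (cmod (convolution \<mu> f h x)))\<^sup>2 \<partial>\<mu>) \<le>
      (\<integral>\<^sup>+x. (nconv (\<lambda>y. cmod (f y)) (\<lambda>y. ennreal (cmod (h y))) x)\<^sup>2 \<partial>\<mu>)"
    by (intro nn_integral_mono power_mono convolution_le_nconv) auto
  also have "\<dots> \<le> (\<integral>\<^sup>+x. ennreal (cmod (f x)) \<partial>\<mu>)\<^sup>2 * (\<integral>\<^sup>+x. (ennreal (cmod (h x)))\<^sup>2 \<partial>\<mu>)"
    by (rule nconv_sq) auto
  also have "\<dots> = ennreal ((?I * L2.nrm h)\<^sup>2)"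
    unfolding L1_nn_integral[OF f] nn_integral_sq_eq[OF h]
    using I n by (simp add: ennreal_power ennreal_mult[symmetric] power_mult_distrib)
  finally have le: "(\<integral>\<^sup>+x. (ennreal (cmod (convolution \<mu> f h x)))\<^sup>2 \<partial>\<mu>) \<le> ennreal ((?I * L2.nrm h)\<^sup>2)" .
  then show m: "convolution \<mu> f h \<in> L2_fun \<mu>"
    unfolding L2_fun_iff by (auto simp: measurable_cong_sets[OF sets_haar refl] order_le_less_trans)
  have "(L2.nrm (convolution \<mu> f h))\<^sup>2 \<le> (?I * L2.nrm h)\<^sup>2"
    using le unfolding nn_integral_sq_eq[OF m] by (simp add: ennreal_le_iff)
  then show "L2.nrm (convolution \<mu> f h) \<le> ?I * L2.nrm h"
    by (rule power2_le_imp_le) (use I n in auto)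
qed

lemma convolution_AE_integrable:
  assumes f: "f \<in> L1_fun \<mu>" and h: "h \<in> L2_fun \<mu>"
  shows "AE x in \<mu>. nconv (\<lambda>y. cmod (f y)) (\<lambda>y. ennreal (cmod (h y))) x < \<infinity>"
proof -
  have [measurable]: "f \<in> borel_measurable borel" "h \<in> borel_measurable borel"
    using f h L1_measurable L2_measurable by auto
  have "(\<integral>\<^sup>+x. (nconv (\<lambda>y. cmod (f y)) (\<lambda>y. ennreal (cmod (h y))) x)\<^sup>2 \<partial>\<mu>) \<le>
      (\<integral>\<^sup>+x. ennreal (cmod (f x)) \<partial>\<mu>)\<^sup>2 * (\<integral>\<^sup>+x. (ennreal (cmod (h x)))\<^sup>2 \<partial>\<mu>)"
    by (rule nconv_sq) auto
  also have "\<dots> < \<infinity>"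
    unfolding L1_nn_integral[OF f] nn_integral_sq_eq[OF h] by (simp add: ennreal_power ennreal_mult_less_top)
  finally have "AE x in \<mu>. (nconv (\<lambda>y. cmod (f y)) (\<lambda>y. ennreal (cmod (h y))) x)\<^sup>2 \<noteq> \<infinity>"
    by (intro nn_integral_PInf_AE) auto
  then show ?thesis by eventually_elim (auto simp: less_top power2_eq_square ennreal_mult_eq_top_iff)
qed

text \<open>Left translation.\<close>

definition Lt :: "'g \<Rightarrow> ('g \<Rightarrow> complex) \<Rightarrow> ('g \<Rightarrow> complex)" where
  "Lt a h = (\<lambda>x. h (- a + x))"

lemma Lt_mem: assumes h: "h \<in> L2_fun \<mu>" shows "Lt a h \<in> L2_fun \<mu>"
proof -
  have [measurable]: "h \<in> borel_measurable borel" using h by (rule L2_measurable)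
  have "(\<integral>\<^sup>+x. (ennreal (cmod (h (- a + x))))\<^sup>2 \<partial>\<mu>) = (\<integral>\<^sup>+x. (ennreal (cmod (h x)))\<^sup>2 \<partial>\<mu>)"
    by (rule nn_integral_left) measurable
  then show ?thesis using h unfolding L2_fun_iff Lt_def by simp
qed

lemma ip2_Lt:
  assumes h: "h \<in> L2_fun \<mu>" and k: "k \<in> L2_fun \<mu>"
  shows "ip2 \<mu> (Lt a h) k = ip2 \<mu> h (Lt (- a) k)"
proof -
  have [measurable]: "h \<in> borel_measurable borel" "k \<in> borel_measurable borel" using h k L2_measurable by auto
  have "ip2 \<mu> (Lt a h) k = (LINT x|\<mu>. h (- a + (a + x)) * cnj (k (a + x)))"
    unfolding ip2_def Lt_def by (rule integral_left[symmetric]) measurable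
  then show ?thesis by (simp add: ip2_def Lt_def add.assoc[symmetric])
qed

lemma Lt_add: "Lt (a + b) h = Lt a (Lt b h)"
  by (simp add: Lt_def minus_add add.assoc del: add_uminus_conv_diff)

lemma nrm_Lt: assumes h: "h \<in> L2_fun \<mu>" shows "L2.nrm (Lt a h) = L2.nrm h"
  using ip2_Lt[OF h Lt_mem[OF h], of a a] Lt_add[of "-a" a h] by (simp add: L2.nrm_def) (simp add: Lt_def)

lemma ip2_Lt_bound:
  assumes h: "h \<in> L2_fun \<mu>" and k: "k \<in> L2_fun \<mu>"
  shows "cmod (ip2 \<mu> (Lt a h) k) \<le> L2.nrm h * L2.nrm k"
  using L2.Cauchy_Schwarz[OF Lt_mem[OF h] k, of a] nrm_Lt[OF h] by simp

lemma ip2_Lt_measurable [measurable]: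
  assumes h: "h \<in> L2_fun \<mu>" and k: "k \<in> L2_fun \<mu>"
  shows "(\<lambda>a. ip2 \<mu> (Lt a h) k) \<in> borel_measurable borel"
proof -
  have [measurable]: "h \<in> borel_measurable borel" "k \<in> borel_measurable borel" using h k L2_measurable by auto
  show ?thesis unfolding ip2_def Lt_def by measurable
qed

lemma L1_bounded_integrable:
  fixes u :: "'g \<Rightarrow> complex"
  assumes "f \<in> L1_fun \<mu>" and [measurable]: "u \<in> borel_measurable borel" and "\<And>x. cmod (u x) \<le> C"
  shows "integrable \<mu> (\<lambda>x. f x * u x)"
proof (rule Bochner_Integration.integrable_bound)
  have [measurable]: "f \<in> borel_measurable borel" using assms(1) by (rule L1_measurable)
  show "integrable \<mu> (\<lambda>x. C * cmod (f x))" using assms(1) by (auto simp: L1_fun_def)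
  show "(\<lambda>x. f x * u x) \<in> borel_measurable \<mu>" by measurable
  have "cmod (f x) * cmod (u x) \<le> \<bar>C * cmod (f x)\<bar>" for x
    using mult_left_mono[OF assms(3)[of x], of "cmod (f x)"] by (simp add: mult.commute)
  then show "AE x in \<mu>. norm (f x * u x) \<le> norm (C * cmod (f x))" by (simp add: norm_mult)
qed

text \<open>Convolution by \<open>f\<close> as a weak integral of left translations.  Identities between convolution operators are
  derived from this formula, which holds without exceptional null sets.\<close>

lemma ip2_convolution:
  assumes f: "f \<in> L1_fun \<mu>" and h: "h \<in> L2_fun \<mu>" and k: "k \<in> L2_fun \<mu>"
  shows "ip2 \<mu> (convolution \<mu> f h) k = (LINT y|\<mu>. f y * ip2 \<mu> (Lt y h) k)"
proof -
  have [measurable]: "f \<in> borel_measurable borel" "h \<in> borel_measurable borel" "k \<in> borel_measurable borel"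
    using f h k L1_measurable L2_measurable by auto
  let ?g = "\<lambda>(y, x). f y * h (- y + x) * cnj (k x)"
  have int: "integrable (\<mu> \<Otimes>\<^sub>M \<mu>) ?g"
  proof (rule integrableI_bounded)
    show "?g \<in> borel_measurable (\<mu> \<Otimes>\<^sub>M \<mu>)" by measurable
    have "(\<integral>\<^sup>+p. ennreal (norm (?g p)) \<partial>(\<mu> \<Otimes>\<^sub>M \<mu>)) = (\<integral>\<^sup>+y. \<integral>\<^sup>+x. ennreal (norm (?g (y, x))) \<partial>\<mu> \<partial>\<mu>)"
      by (rule nn_integral_fst[symmetric]) measurable
    also have "\<dots> \<le> (\<integral>\<^sup>+y. \<integral>\<^sup>+x. ennreal (cmod (f y)) * ((ennreal (cmod (h (- y + x))))\<^sup>2 + (ennreal (cmod (k x)))\<^sup>2) \<partial>\<mu> \<partial>\<mu>)"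
    proof (intro nn_integral_mono)
      fix x y
      have "cmod (h (- y + x)) * cmod (k x) \<le> (cmod (h (- y + x)))\<^sup>2 + (cmod (k x))\<^sup>2"
        using sum_squares_bound[of "cmod (h (- y + x))" "cmod (k x)"]
          mult_nonneg_nonneg[OF norm_ge_zero norm_ge_zero, of "h (- y + x)" "k x"] by linarith
      then have "cmod (f y) * (cmod (h (- y + x)) * cmod (k x)) \<le> cmod (f y) * ((cmod (h (- y + x)))\<^sup>2 + (cmod (k x))\<^sup>2)"
        by (rule mult_left_mono) simp
      then have "ennreal (cmod (f y) * (cmod (h (- y + x)) * cmod (k x))) \<le> ennreal (cmod (f y) * ((cmod (h (- y + x)))\<^sup>2 + (cmod (k x))\<^sup>2))"
        by (rule ennreal_leI)
      then show "ennreal (norm (?g (y, x))) \<le> ennreal (cmod (f y)) * ((ennreal (cmod (h (- y + x))))\<^sup>2 + (ennreal (cmod (k x)))\<^sup>2)"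
        by (simp add: norm_mult ennreal_mult ennreal_power mult.assoc)
    qed
    also have "\<dots> = (\<integral>\<^sup>+y. ennreal (cmod (f y)) * ((\<integral>\<^sup>+x. (ennreal (cmod (h x)))\<^sup>2 \<partial>\<mu>) + (\<integral>\<^sup>+x. (ennreal (cmod (k x)))\<^sup>2 \<partial>\<mu>)) \<partial>\<mu>)"
      by (simp add: nn_integral_cmult nn_integral_add nn_integral_left[of "\<lambda>x. (ennreal (cmod (h x)))\<^sup>2"])
    also have "\<dots> = (\<integral>\<^sup>+y. ennreal (cmod (f y)) \<partial>\<mu>) * ((\<integral>\<^sup>+x. (ennreal (cmod (h x)))\<^sup>2 \<partial>\<mu>) + (\<integral>\<^sup>+x. (ennreal (cmod (k x)))\<^sup>2 \<partial>\<mu>))"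
      by (rule nn_integral_multc) measurable
    also have "\<dots> < \<infinity>"
      unfolding L1_nn_integral[OF f] nn_integral_sq_eq[OF h] nn_integral_sq_eq[OF k]
      by (simp add: ennreal_mult_less_top)
    finally show "(\<integral>\<^sup>+p. ennreal (norm (?g p)) \<partial>(\<mu> \<Otimes>\<^sub>M \<mu>)) < \<infinity>" .
  qed
  have "ip2 \<mu> (convolution \<mu> f h) k = (LINT x|\<mu>. LINT y|\<mu>. f y * h (- y + x) * cnj (k x))"
    unfolding ip2_def convolution_def by simp
  also have "\<dots> = (LINT y|\<mu>. LINT x|\<mu>. f y * h (- y + x) * cnj (k x))"
    using P.Fubini_integral[of "\<lambda>y x. f y * h (- y + x) * cnj (k x)"] int by simp
  also have "\<dots> = (LINT y|\<mu>. f y * ip2 \<mu> (Lt y h) k)"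
    by (simp add: ip2_def Lt_def mult.assoc)
  finally show ?thesis .
qed

lemma
  assumes f: "f \<in> L1_fun \<mu>" and g: "g \<in> L1_fun \<mu>"
  shows convolution_L1: "convolution \<mu> f g \<in> L1_fun \<mu>"
    and convolution_L1_weak: "\<And>w C. w \<in> borel_measurable borel \<Longrightarrow> (\<And>x. cmod (w x) \<le> C) \<Longrightarrow>
      (LINT z|\<mu>. convolution \<mu> f g z * w z) = (LINT y|\<mu>. f y * (LINT z|\<mu>. g z * w (y + z)))"
proof -
  have [measurable]: "f \<in> borel_measurable borel" "g \<in> borel_measurable borel"
    using f g L1_measurable by auto
  have nn: "(\<integral>\<^sup>+y. \<integral>\<^sup>+z. ennreal (cmod (f y)) * ennreal (cmod (g (- y + z))) \<partial>\<mu> \<partial>\<mu>) < \<infinity>"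
  proof -
    have "(\<integral>\<^sup>+y. \<integral>\<^sup>+z. ennreal (cmod (f y)) * ennreal (cmod (g (- y + z))) \<partial>\<mu> \<partial>\<mu>)
       = (\<integral>\<^sup>+y. ennreal (cmod (f y)) * (\<integral>\<^sup>+z. ennreal (cmod (g z)) \<partial>\<mu>) \<partial>\<mu>)"
      by (simp add: nn_integral_cmult nn_integral_left[of "\<lambda>x. ennreal (cmod (g x))"])
    also have "\<dots> = (\<integral>\<^sup>+y. ennreal (cmod (f y)) \<partial>\<mu>) * (\<integral>\<^sup>+z. ennreal (cmod (g z)) \<partial>\<mu>)"
      by (rule nn_integral_multc) measurable
    finally show ?thesis unfolding L1_nn_integral[OF f] L1_nn_integral[OF g]
      by (simp add: ennreal_mult_less_top)
  qed
  have "(\<integral>\<^sup>+z. ennreal (norm (convolution \<mu> f g z)) \<partial>\<mu>) \<le> (\<integral>\<^sup>+z. \<integral>\<^sup>+y. ennreal (cmod (f y)) * ennreal (cmod (g (- y + z))) \<partial>\<mu> \<partial>\<mu>)"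
    using convolution_le_nconv[of f g] by (intro nn_integral_mono) (simp add: nconv_def)
  also have "\<dots> = (\<integral>\<^sup>+y. \<integral>\<^sup>+z. ennreal (cmod (f y)) * ennreal (cmod (g (- y + z))) \<partial>\<mu> \<partial>\<mu>)"
    by (rule P.Fubini') simp
  also note nn
  finally show "convolution \<mu> f g \<in> L1_fun \<mu>"
    unfolding L1_fun_def by (auto intro!: integrableI_bounded simp: measurable_cong_sets[OF sets_haar refl])
  fix w :: "'g \<Rightarrow> complex" and C
  assume w [measurable]: "w \<in> borel_measurable borel" and C: "\<And>x. cmod (w x) \<le> C"
  let ?g = "\<lambda>(y, z). f y * g (- y + z) * w z"
  have C0: "0 \<le> C" using C[of 0] norm_ge_zero order_trans by blast
  have int: "integrable (\<mu> \<Otimes>\<^sub>M \<mu>) ?g"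
  proof (rule integrableI_bounded)
    show "?g \<in> borel_measurable (\<mu> \<Otimes>\<^sub>M \<mu>)" by measurable
    have "(\<integral>\<^sup>+p. ennreal (norm (?g p)) \<partial>(\<mu> \<Otimes>\<^sub>M \<mu>)) = (\<integral>\<^sup>+y. \<integral>\<^sup>+z. ennreal (norm (?g (y, z))) \<partial>\<mu> \<partial>\<mu>)"
      by (rule nn_integral_fst[symmetric]) measurable
    also have "\<dots> \<le> (\<integral>\<^sup>+y. \<integral>\<^sup>+z. ennreal C * (ennreal (cmod (f y)) * ennreal (cmod (g (- y + z)))) \<partial>\<mu> \<partial>\<mu>)"
    proof (intro nn_integral_mono)
      fix y z
      have "cmod (f y) * cmod (g (- y + z)) * cmod (w z) \<le> C * (cmod (f y) * cmod (g (- y + z)))"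
        using mult_left_mono[OF C[of z], of "cmod (f y) * cmod (g (- y + z))"] by (simp add: mult.commute)
      then have "ennreal (cmod (f y) * cmod (g (- y + z)) * cmod (w z)) \<le> ennreal (C * (cmod (f y) * cmod (g (- y + z))))"
        by (rule ennreal_leI)
      then show "ennreal (norm (?g (y, z))) \<le> ennreal C * (ennreal (cmod (f y)) * ennreal (cmod (g (- y + z))))"
        using C0 by (simp add: norm_mult ennreal_mult)
    qed
    also have "\<dots> = ennreal C * (\<integral>\<^sup>+y. \<integral>\<^sup>+z. ennreal (cmod (f y)) * ennreal (cmod (g (- y + z))) \<partial>\<mu> \<partial>\<mu>)"
      by (simp add: nn_integral_cmult)
    also have "\<dots> < \<infinity>" using nn by (simp add: ennreal_mult_less_top)
    finally show "(\<integral>\<^sup>+p. ennreal (norm (?g p)) \<partial>(\<mu> \<Otimes>\<^sub>M \<mu>)) < \<infinity>" .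
  qed
  have "(LINT z|\<mu>. convolution \<mu> f g z * w z) = (LINT z|\<mu>. LINT y|\<mu>. f y * g (- y + z) * w z)"
    unfolding convolution_def by simp
  also have "\<dots> = (LINT y|\<mu>. LINT z|\<mu>. f y * g (- y + z) * w z)"
    using P.Fubini_integral[of "\<lambda>y z. f y * g (- y + z) * w z"] int by simp
  also have "\<dots> = (LINT y|\<mu>. LINT z|\<mu>. f y * g (- y + (y + z)) * w (y + z))"
    by (intro Bochner_Integration.integral_cong refl integral_left[symmetric]) measurable
  also have "\<dots> = (LINT y|\<mu>. f y * (LINT z|\<mu>. g z * w (y + z)))"
    by (simp add: mult.assoc add.assoc[symmetric])
  finally show "(LINT z|\<mu>. convolution \<mu> f g z * w z) = (LINT y|\<mu>. f y * (LINT z|\<mu>. g z * w (y + z)))" .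
qed

lemma ip2_convolution_assoc:
  assumes f: "f \<in> L1_fun \<mu>" and g: "g \<in> L1_fun \<mu>" and h: "h \<in> L2_fun \<mu>" and k: "k \<in> L2_fun \<mu>"
  shows "ip2 \<mu> (convolution \<mu> (convolution \<mu> f g) h) k = ip2 \<mu> (convolution \<mu> f (convolution \<mu> g h)) k"
proof -
  have "ip2 \<mu> (convolution \<mu> (convolution \<mu> f g) h) k = (LINT z|\<mu>. convolution \<mu> f g z * ip2 \<mu> (Lt z h) k)"
    by (rule ip2_convolution[OF convolution_L1[OF f g] h k])
  also have "\<dots> = (LINT y|\<mu>. f y * (LINT z|\<mu>. g z * ip2 \<mu> (Lt (y + z) h) k))"
    by (rule convolution_L1_weak[OF f g ip2_Lt_measurable[OF h k] ip2_Lt_bound[OF h k]])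
  also have "\<dots> = (LINT y|\<mu>. f y * ip2 \<mu> (Lt y (convolution \<mu> g h)) k)"
  proof -
    have "(LINT z|\<mu>. g z * ip2 \<mu> (Lt (y + z) h) k) = ip2 \<mu> (Lt y (convolution \<mu> g h)) k" for y
      unfolding Lt_add ip2_Lt[OF Lt_mem[OF h] k] ip2_Lt[OF convolution_L2[OF g h] k]
      by (rule ip2_convolution[OF g h Lt_mem[OF k], symmetric])
    then show ?thesis by simp
  qed
  also have "\<dots> = ip2 \<mu> (convolution \<mu> f (convolution \<mu> g h)) k"
    by (rule ip2_convolution[OF f convolution_L2[OF g h] k, symmetric])
  finally show ?thesis .
qed

end

section \<open>Positive eigenfunctions\<close>

lemma ennreal_mult_right_cancel:
  fixes a b c :: ennreal
  assumes "a * c = b * c" "c \<noteq> 0" "c \<noteq> top"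
  shows "a = b"
proof -
  have "c * a = c * b" using assms(1) by (simp add: mult.commute)
  then show ?thesis using assms(2,3) by (auto simp: ennreal_mult_cancel_left)
qed

lemma nn_integral_eq_imp_AE_eq:
  assumes [measurable]: "u \<in> borel_measurable M" "v \<in> borel_measurable M"
    and le: "AE x in M. u x \<le> v x" and eq: "(\<integral>\<^sup>+x. u x \<partial>M) = (\<integral>\<^sup>+x. v x \<partial>M)"
    and fin: "(\<integral>\<^sup>+x. v x \<partial>M) < \<infinity>"
  shows "AE x in M. u x = v x"
proof -
  have "(\<integral>\<^sup>+x. v x - u x \<partial>M) = (\<integral>\<^sup>+x. v x \<partial>M) - (\<integral>\<^sup>+x. u x \<partial>M)"
    using le eq fin by (intro nn_integral_diff) auto
  then have "(\<integral>\<^sup>+x. v x - u x \<partial>M) = 0" using eq fin by (simp add: ennreal_minus_eq_0)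
  then have "AE x in M. v x - u x = 0" by (subst (asm) nn_integral_0_iff_AE) auto
  then show ?thesis using le by eventually_elim (auto simp: ennreal_minus_eq_0 intro: antisym)
qed

text \<open>A convolution kernel \<open>F\<close> that is positive almost everywhere and symmetric, in the sense that the measure \<open>F d\<mu>\<close> is
  invariant under inversion.\<close>

locale perron = haar +
  fixes F :: "'a \<Rightarrow> real"
  assumes F_meas [measurable]: "F \<in> borel_measurable borel"
    and F_nonneg: "\<And>x. 0 \<le> F x"
    and F_pos: "AE x in \<mu>. 0 < F x"
    and F_sym: "distr (density \<mu> F) borel uminus = density \<mu> F"
begin

lemma nn_integral_F_uminus:
  assumes [measurable]: "w \<in> borel_measurable borel"
  shows "(\<integral>\<^sup>+y. ennreal (F y) * w (- y) \<partial>\<mu>) = (\<integral>\<^sup>+y. ennreal (F y) * w y \<partial>\<mu>)"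
proof -
  have "(\<integral>\<^sup>+y. ennreal (F y) * w y \<partial>\<mu>) = (\<integral>\<^sup>+y. w y \<partial>density \<mu> F)"
    by (rule nn_integral_density[symmetric]) measurable
  also have "\<dots> = (\<integral>\<^sup>+y. w y \<partial>distr (density \<mu> F) borel uminus)" by (simp only: F_sym)
  also have "\<dots> = (\<integral>\<^sup>+y. w (- y) \<partial>density \<mu> F)" by (rule nn_integral_distr) measurable
  also have "\<dots> = (\<integral>\<^sup>+y. ennreal (F y) * w (- y) \<partial>\<mu>)" by (rule nn_integral_density) measurable
  finally show ?thesis ..
qed

lemma nconv_sym:
  assumes [measurable]: "h \<in> borel_measurable borel" "k \<in> borel_measurable borel"
  shows "(\<integral>\<^sup>+x. nconv F h x * k x \<partial>\<mu>) = (\<integral>\<^sup>+x. h x * nconv F k x \<partial>\<mu>)"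
proof -
  have "(\<integral>\<^sup>+x. nconv F h x * k x \<partial>\<mu>) = (\<integral>\<^sup>+x. \<integral>\<^sup>+y. ennreal (F y) * h (- y + x) * k x \<partial>\<mu> \<partial>\<mu>)"
    unfolding nconv_def by (simp add: nn_integral_multc)
  also have "\<dots> = (\<integral>\<^sup>+y. \<integral>\<^sup>+x. ennreal (F y) * h (- y + x) * k x \<partial>\<mu> \<partial>\<mu>)"
    by (rule P.Fubini') simp
  also have "\<dots> = (\<integral>\<^sup>+y. ennreal (F y) * (\<integral>\<^sup>+x. h (- y + x) * k x \<partial>\<mu>) \<partial>\<mu>)"
    by (simp add: mult.assoc nn_integral_cmult)
  also have "\<dots> = (\<integral>\<^sup>+y. ennreal (F y) * (\<integral>\<^sup>+x. h (- (- y) + x) * k x \<partial>\<mu>) \<partial>\<mu>)"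
    by (rule nn_integral_F_uminus[symmetric, where w = "\<lambda>y. \<integral>\<^sup>+x. h (- y + x) * k x \<partial>\<mu>"]) measurable
  also have "\<dots> = (\<integral>\<^sup>+y. ennreal (F y) * (\<integral>\<^sup>+x. h x * k (- y + x) \<partial>\<mu>) \<partial>\<mu>)"
  proof -
    have "(\<integral>\<^sup>+x. h (- (- y) + x) * k x \<partial>\<mu>) = (\<integral>\<^sup>+x. h (- (- y) + (- y + x)) * k (- y + x) \<partial>\<mu>)" for y
      by (rule nn_integral_left[symmetric]) measurable
    then show ?thesis by (simp add: add.assoc[symmetric])
  qed
  also have "\<dots> = (\<integral>\<^sup>+y. \<integral>\<^sup>+x. ennreal (F y) * (h x * k (- y + x)) \<partial>\<mu> \<partial>\<mu>)"
    by (simp add: nn_integral_cmult)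
  also have "\<dots> = (\<integral>\<^sup>+x. \<integral>\<^sup>+y. ennreal (F y) * (h x * k (- y + x)) \<partial>\<mu> \<partial>\<mu>)"
    by (rule P.Fubini'[symmetric]) simp
  also have "\<dots> = (\<integral>\<^sup>+x. h x * nconv F k x \<partial>\<mu>)"
    unfolding nconv_def by (simp add: nn_integral_cmult[symmetric] mult.left_commute)
  finally show ?thesis .
qed

lemma nconv_pos:
  assumes [measurable]: "k \<in> borel_measurable borel" and k: "\<not> (AE x in \<mu>. k x = 0)"
  shows "nconv F k x \<noteq> 0"
proof
  assume "nconv F k x = 0"
  then have "AE y in \<mu>. ennreal (F y) * k (- y + x) = 0"
    unfolding nconv_def by (subst (asm) nn_integral_0_iff_AE) auto
  then have "AE y in \<mu>. k (- y + x) = 0"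
    using F_pos by eventually_elim (simp add: ennreal_eq_0_iff)
  from AE_right[OF AE_uminus[OF this], of "- x"] have "AE y in \<mu>. k y = 0"
    by (simp add: add.assoc)
  then show False using k by blast
qed

lemma nconv_mono: "(\<And>x. h x \<le> k x) \<Longrightarrow> nconv F h x \<le> nconv F k x"
  unfolding nconv_def by (intro nn_integral_mono mult_left_mono) auto

lemma nconv_right: "nconv F (\<lambda>x. k (x + z)) x = nconv F k (x + z)"
  unfolding nconv_def by (simp add: add.assoc)

text \<open>Eigenfunctions of the convolution by \<open>F\<close>, with values in \<open>[0, \<infinity>]\<close> and without integrability condition.\<close>

definition eigen :: "real \<Rightarrow> ('a \<Rightarrow> ennreal) \<Rightarrow> bool" where
  "eigen r k \<longleftrightarrow> (AE x in \<mu>. nconv F k x = ennreal r * k x)"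

lemma eigen_zero_or_pos:
  assumes [measurable]: "k \<in> borel_measurable borel" and e: "eigen r k"
  shows "(AE x in \<mu>. k x = 0) \<or> (AE x in \<mu>. 0 < k x)"
proof (cases "AE x in \<mu>. k x = 0")
  case False
  have "AE x in \<mu>. 0 < k x"
    using e unfolding eigen_def
    by eventually_elim (use nconv_pos[OF assms(1) False] in \<open>auto simp: zero_less_iff_neq_zero\<close>)
  then show ?thesis by blast
qed simp

text \<open>A nonnegative eigenfunction \<open>\<psi>\<close> is comparable with a positive square integrable one \<open>\<xi>\<close> for the same eigenvalue.  Their
  minimum \<open>\<zeta>\<close> satisfies \<open>F * \<zeta> \<le> r \<zeta>\<close>; pairing with \<open>\<xi>\<close> shows that it is an eigenfunction.  So is
  \<open>\<xi> - \<zeta>\<close>, which therefore vanishes almost everywhere or is positive almost everywhere.\<close>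

lemma eigen_compare:
  fixes \<xi> \<psi> :: "'a \<Rightarrow> real"
  assumes [measurable]: "\<xi> \<in> borel_measurable borel" "\<psi> \<in> borel_measurable borel"
    and nn: "\<And>x. 0 \<le> \<xi> x" "\<And>x. 0 \<le> \<psi> x" and r: "0 \<le> r"
    and sq: "(\<integral>\<^sup>+x. (ennreal (\<xi> x))\<^sup>2 \<partial>\<mu>) < \<infinity>"
    and pos: "AE x in \<mu>. 0 < \<xi> x"
    and e1: "eigen r (\<lambda>x. ennreal (\<xi> x))" and e2: "eigen r (\<lambda>x. ennreal (\<psi> x))"
  shows "(AE x in \<mu>. \<xi> x \<le> \<psi> x) \<or> (AE x in \<mu>. \<psi> x \<le> \<xi> x)"
proof -
  define \<zeta> where "\<zeta> x = min (\<xi> x) (\<psi> x)" for x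
  define \<kappa> where "\<kappa> x = \<xi> x - \<zeta> x" for x
  have [measurable]: "\<zeta> \<in> borel_measurable borel" "\<kappa> \<in> borel_measurable borel"
    unfolding \<kappa>_def \<zeta>_def by measurable
  have z0: "0 \<le> \<zeta> x" "\<zeta> x \<le> \<xi> x" "\<zeta> x \<le> \<psi> x" "0 \<le> \<kappa> x" for x using nn by (auto simp: \<zeta>_def \<kappa>_def)
  have le: "AE x in \<mu>. nconv F (\<lambda>x. ennreal (\<zeta> x)) x \<le> ennreal r * ennreal (\<zeta> x)"
    using e1 e2 unfolding eigen_def
  proof eventually_elim
    fix x assume a: "nconv F (\<lambda>x. ennreal (\<xi> x)) x = ennreal r * ennreal (\<xi> x)"
      "nconv F (\<lambda>x. ennreal (\<psi> x)) x = ennreal r * ennreal (\<psi> x)"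
    have "nconv F (\<lambda>x. ennreal (\<zeta> x)) x \<le> nconv F (\<lambda>x. ennreal (\<xi> x)) x"
      "nconv F (\<lambda>x. ennreal (\<zeta> x)) x \<le> nconv F (\<lambda>x. ennreal (\<psi> x)) x"
      by (auto intro!: nconv_mono ennreal_leI z0)
    then show "nconv F (\<lambda>x. ennreal (\<zeta> x)) x \<le> ennreal r * ennreal (\<zeta> x)"
      unfolding a by (auto simp: \<zeta>_def min_def)
  qed
  have "(\<integral>\<^sup>+x. nconv F (\<lambda>x. ennreal (\<zeta> x)) x * ennreal (\<xi> x) \<partial>\<mu>) = (\<integral>\<^sup>+x. ennreal (\<zeta> x) * nconv F (\<lambda>x. ennreal (\<xi> x)) x \<partial>\<mu>)"
    by (rule nconv_sym) measurable
  also have "\<dots> = (\<integral>\<^sup>+x. ennreal r * ennreal (\<zeta> x) * ennreal (\<xi> x) \<partial>\<mu>)"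
  proof (rule nn_integral_cong_AE)
    show "AE x in \<mu>. ennreal (\<zeta> x) * nconv F (\<lambda>x. ennreal (\<xi> x)) x = ennreal r * ennreal (\<zeta> x) * ennreal (\<xi> x)"
      using e1 unfolding eigen_def by eventually_elim (simp add: ac_simps)
  qed
  finally have eq: "(\<integral>\<^sup>+x. nconv F (\<lambda>x. ennreal (\<zeta> x)) x * ennreal (\<xi> x) \<partial>\<mu>) = (\<integral>\<^sup>+x. ennreal r * ennreal (\<zeta> x) * ennreal (\<xi> x) \<partial>\<mu>)" .
  have "(\<integral>\<^sup>+x. ennreal r * ennreal (\<zeta> x) * ennreal (\<xi> x) \<partial>\<mu>) \<le> (\<integral>\<^sup>+x. ennreal r * (ennreal (\<xi> x))\<^sup>2 \<partial>\<mu>)"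
    by (intro nn_integral_mono) (auto simp: power2_eq_square mult.assoc intro!: mult_left_mono mult_right_mono ennreal_leI z0)
  also have "\<dots> = ennreal r * (\<integral>\<^sup>+x. (ennreal (\<xi> x))\<^sup>2 \<partial>\<mu>)" by (rule nn_integral_cmult) measurable
  also have "\<dots> < \<infinity>" using sq by (simp add: ennreal_mult_less_top)
  finally have fin: "(\<integral>\<^sup>+x. ennreal r * ennreal (\<zeta> x) * ennreal (\<xi> x) \<partial>\<mu>) < \<infinity>" .
  have "AE x in \<mu>. nconv F (\<lambda>x. ennreal (\<zeta> x)) x * ennreal (\<xi> x) = ennreal r * ennreal (\<zeta> x) * ennreal (\<xi> x)"
    using le by (intro nn_integral_eq_imp_AE_eq[OF _ _ _ eq fin]) (auto elim!: eventually_mono intro: mult_right_mono)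
  then have ez: "AE x in \<mu>. nconv F (\<lambda>x. ennreal (\<zeta> x)) x = ennreal r * ennreal (\<zeta> x)"
    using pos by eventually_elim (erule ennreal_mult_right_cancel, auto simp: ennreal_eq_0_iff)
  have split: "nconv F (\<lambda>x. ennreal (\<xi> x)) x = nconv F (\<lambda>x. ennreal (\<zeta> x)) x + nconv F (\<lambda>x. ennreal (\<kappa> x)) x" for x
  proof -
    have s: "ennreal (\<xi> y) = ennreal (\<zeta> y) + ennreal (\<kappa> y)" for y
      using z0[of y] by (subst ennreal_plus[symmetric]) (auto simp: \<kappa>_def)
    show ?thesis unfolding nconv_def s distrib_left by (rule nn_integral_add) measurable
  qed
  have "eigen r (\<lambda>x. ennreal (\<kappa> x))"
    unfolding eigen_def using ez e1[unfolded eigen_def]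
  proof eventually_elim
    fix x assume a: "nconv F (\<lambda>x. ennreal (\<zeta> x)) x = ennreal r * ennreal (\<zeta> x)"
      "nconv F (\<lambda>x. ennreal (\<xi> x)) x = ennreal r * ennreal (\<xi> x)"
    have "ennreal r * ennreal (\<xi> x) = ennreal r * ennreal (\<zeta> x) + ennreal r * ennreal (\<kappa> x)"
      using z0[of x] unfolding distrib_left[symmetric] by (subst ennreal_plus[symmetric]) (auto simp: \<kappa>_def)
    then have "ennreal r * ennreal (\<zeta> x) + nconv F (\<lambda>x. ennreal (\<kappa> x)) x = ennreal r * ennreal (\<zeta> x) + ennreal r * ennreal (\<kappa> x)"
      using a split[of x] by simp
    moreover have "ennreal r * ennreal (\<zeta> x) \<noteq> \<infinity>" by (simp add: ennreal_mult_eq_top_iff)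
    ultimately show "nconv F (\<lambda>x. ennreal (\<kappa> x)) x = ennreal r * ennreal (\<kappa> x)"
      by (simp add: ennreal_add_left_cancel)
  qed
  then have "(AE x in \<mu>. ennreal (\<kappa> x) = 0) \<or> (AE x in \<mu>. 0 < ennreal (\<kappa> x))"
    by (intro eigen_zero_or_pos) auto
  then show ?thesis
  proof
    assume "AE x in \<mu>. ennreal (\<kappa> x) = 0"
    then have "AE x in \<mu>. \<xi> x \<le> \<psi> x"
      by eventually_elim (auto simp: \<kappa>_def \<zeta>_def ennreal_eq_0_iff)
    then show ?thesis ..
  next
    assume "AE x in \<mu>. 0 < ennreal (\<kappa> x)"
    then have "AE x in \<mu>. \<psi> x \<le> \<xi> x"
      by eventually_elim (auto simp: \<kappa>_def \<zeta>_def)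
    then show ?thesis ..
  qed
qed

text \<open>Right translates of \<open>\<xi>\<close> are eigenfunctions; their square integrability, which involves the modular function, is not
  needed.  The factor \<open>t\<close> is chosen so that \<open>\<xi>\<close> and \<open>t \<xi>(\<cdot> + z)\<close> have the same integral against a positive
  weight; being comparable, they agree.\<close>

lemma eigen_right_translate:
  fixes \<xi> :: "'a \<Rightarrow> real"
  assumes [measurable]: "\<xi> \<in> borel_measurable borel"
    and nn: "\<And>x. 0 \<le> \<xi> x" and r: "0 \<le> r"
    and sq: "(\<integral>\<^sup>+x. (ennreal (\<xi> x))\<^sup>2 \<partial>\<mu>) < \<infinity>"
    and pos: "AE x in \<mu>. 0 < \<xi> x"
    and e: "eigen r (\<lambda>x. ennreal (\<xi> x))"
  shows "\<exists>t. AE x in \<mu>. \<xi> x = t * \<xi> (x + z)"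
proof -
  have posz: "AE x in \<mu>. 0 < \<xi> (x + z)" by (rule AE_right[OF pos])
  obtain w0 where w0 [measurable]: "w0 \<in> borel_measurable \<mu>" and w0fin: "(\<integral>\<^sup>+x. w0 x \<partial>\<mu>) \<noteq> \<infinity>"
    and w0pos: "\<And>x. 0 < w0 x \<and> w0 x < \<infinity>"
    using Ex_finite_integrable_function by auto
  \<comment> \<open>a positive weight against which \<open>\<xi>\<close> and its translate are both integrable\<close>
  define w where "w x = enn2real (w0 x) / (1 + \<xi> x + \<xi> (x + z))" for x
  have w0m [measurable]: "w0 \<in> borel_measurable borel" using w0 by (simp add: measurable_cong_sets[OF sets_haar refl])
  have wm [measurable]: "w \<in> borel_measurable borel" unfolding w_def by measurable
  have w0r: "0 < enn2real (w0 x)" for x using w0pos[of x] by (simp add: enn2real_positive_iff)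
  have den: "0 < 1 + \<xi> x + \<xi> (x + z)" for x using nn[of x] nn[of "x + z"] by linarith
  have wpos: "0 < w x" for x using w0r[of x] den[of x] by (simp add: w_def)
  have i0: "integrable \<mu> (\<lambda>x. enn2real (w0 x))"
    using w0fin w0pos by (intro integrableI_nonneg) (auto simp: less_top)
  have int1: "integrable \<mu> (\<lambda>x. w x * \<xi> x)"
  proof (rule Bochner_Integration.integrable_bound[OF i0])
    have "w x * \<xi> x \<le> enn2real (w0 x)" for x
      using den[of x] nn[of x] nn[of "x + z"] w0r[of x] by (auto simp: w_def divide_le_eq intro!: mult_left_mono)
    then show "AE x in \<mu>. norm (w x * \<xi> x) \<le> norm (enn2real (w0 x))"
      using nn wpos by (auto simp: less_imp_le abs_mult intro: order_trans[OF _ abs_ge_self])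
  qed measurable
  have int2: "integrable \<mu> (\<lambda>x. w x * \<xi> (x + z))"
  proof (rule Bochner_Integration.integrable_bound[OF i0])
    have "w x * \<xi> (x + z) \<le> enn2real (w0 x)" for x
      using den[of x] nn[of x] nn[of "x + z"] w0r[of x] by (auto simp: w_def divide_le_eq intro!: mult_left_mono)
    then show "AE x in \<mu>. norm (w x * \<xi> (x + z)) \<le> norm (enn2real (w0 x))"
      using nn wpos by (auto simp: less_imp_le abs_mult intro: order_trans[OF _ abs_ge_self])
  qed measurable
  have I2: "0 < (LINT x|\<mu>. w x * \<xi> (x + z))"
  proof -
    have "0 \<le> (LINT x|\<mu>. w x * \<xi> (x + z))" using nn wpos by (intro Bochner_Integration.integral_nonneg) (simp add: less_imp_le)
    moreover have "(LINT x|\<mu>. w x * \<xi> (x + z)) \<noteq> 0"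
    proof
      assume "(LINT x|\<mu>. w x * \<xi> (x + z)) = 0"
      then have "AE x in \<mu>. w x * \<xi> (x + z) = 0"
        using nn wpos by (subst (asm) integral_nonneg_eq_0_iff_AE[OF int2]) (auto simp: less_imp_le)
      then have "AE x in \<mu>. False" using posz by eventually_elim (use wpos in \<open>auto simp: less_le\<close>)
      then show False using haar_nonzero by (simp add: AE_iff_null null_sets_def)
    qed
    ultimately show ?thesis by simp
  qed
  define t where "t = (LINT x|\<mu>. w x * \<xi> x) / (LINT x|\<mu>. w x * \<xi> (x + z))"
  have t0: "0 \<le> t" unfolding t_def using I2 nn wpos by (intro divide_nonneg_pos Bochner_Integration.integral_nonneg) (simp_all add: less_imp_le)
  define \<psi> where "\<psi> x = t * \<xi> (x + z)" for x
  have [measurable]: "\<psi> \<in> borel_measurable borel" unfolding \<psi>_def by measurable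
  have int3: "integrable \<mu> (\<lambda>x. w x * \<psi> x)"
    using integrable_mult_right[of t, OF int2] by (simp add: \<psi>_def mult.left_commute)
  have eq: "(LINT x|\<mu>. w x * \<psi> x) = (LINT x|\<mu>. w x * \<xi> x)"
  proof -
    have "(LINT x|\<mu>. w x * \<psi> x) = (LINT x|\<mu>. t * (w x * \<xi> (x + z)))"
      by (simp only: \<psi>_def mult.left_commute)
    also have "\<dots> = t * (LINT x|\<mu>. w x * \<xi> (x + z))" by (rule integral_mult_right_zero)
    finally show ?thesis using I2 by (simp add: t_def)
  qed
  have "eigen r (\<lambda>x. ennreal (\<psi> x))"
  proof -
    have "nconv F (\<lambda>x. ennreal (\<psi> x)) x = ennreal t * nconv F (\<lambda>x. ennreal (\<xi> x)) (x + z)" for x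
    proof -
      have "nconv F (\<lambda>x. ennreal (\<psi> x)) x = (\<integral>\<^sup>+y. ennreal t * (ennreal (F y) * ennreal (\<xi> (- y + x + z))) \<partial>\<mu>)"
        unfolding nconv_def \<psi>_def using nn t0 by (simp add: ennreal_mult mult.left_commute)
      also have "\<dots> = ennreal t * nconv F (\<lambda>x. ennreal (\<xi> (x + z))) x"
        unfolding nconv_def by (rule nn_integral_cmult) measurable
      finally show ?thesis using nconv_right[of "\<lambda>x. ennreal (\<xi> x)" z x] by simp
    qed
    then show ?thesis using AE_right[OF e[unfolded eigen_def], of z] unfolding eigen_def
      by (auto elim!: eventually_mono simp: \<psi>_def ennreal_mult[OF t0 nn] mult.left_commute)
  qed
  then have "(AE x in \<mu>. \<xi> x \<le> \<psi> x) \<or> (AE x in \<mu>. \<psi> x \<le> \<xi> x)"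
    using nn t0 by (intro eigen_compare[OF _ _ _ _ r sq pos e]) (auto simp: \<psi>_def)
  then have "AE x in \<mu>. w x * \<psi> x = w x * \<xi> x"
  proof
    assume "AE x in \<mu>. \<xi> x \<le> \<psi> x"
    then have nn': "AE x in \<mu>. 0 \<le> w x * \<psi> x - w x * \<xi> x"
      by eventually_elim (use wpos in \<open>simp add: less_imp_le mult_left_mono\<close>)
    have "(LINT x|\<mu>. w x * \<psi> x - w x * \<xi> x) = 0" using int1 int3 eq by simp
    then have "AE x in \<mu>. w x * \<psi> x - w x * \<xi> x = 0"
      using integral_nonneg_eq_0_iff_AE[OF Bochner_Integration.integrable_diff[OF int3 int1] nn'] by simp
    then show ?thesis by simp
  next
    assume "AE x in \<mu>. \<psi> x \<le> \<xi> x"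
    then have nn': "AE x in \<mu>. 0 \<le> w x * \<xi> x - w x * \<psi> x"
      by eventually_elim (use wpos in \<open>simp add: less_imp_le mult_left_mono\<close>)
    have "(LINT x|\<mu>. w x * \<xi> x - w x * \<psi> x) = 0" using int1 int3 eq by simp
    then have "AE x in \<mu>. w x * \<xi> x - w x * \<psi> x = 0"
      using integral_nonneg_eq_0_iff_AE[OF Bochner_Integration.integrable_diff[OF int1 int3] nn'] by simp
    then show ?thesis by eventually_elim linarith
  qed
  then have "AE x in \<mu>. \<xi> x = t * \<xi> (x + z)"
    by eventually_elim (use wpos in \<open>auto simp: \<psi>_def less_le\<close>)
  then show ?thesis ..
qed

text \<open>By Fubini, \<open>\<xi> x \<xi> (x' + z) = \<xi> x' \<xi> (x + z)\<close> for almost all \<open>x\<close>, \<open>x'\<close> and \<open>z\<close>.  Squaring and integrating over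
  \<open>z\<close> gives \<open>\<xi> x = \<xi> x'\<close> by left invariance, so \<open>\<xi>\<close> is constant almost everywhere.\<close>

theorem eigenfunction_imp_finite:
  fixes \<xi> :: "'a \<Rightarrow> real"
  assumes \<xi>m [measurable]: "\<xi> \<in> borel_measurable borel"
    and nn: "\<And>x. 0 \<le> \<xi> x" and r: "0 \<le> r"
    and sq: "(\<integral>\<^sup>+x. (ennreal (\<xi> x))\<^sup>2 \<partial>\<mu>) < \<infinity>"
    and nz: "\<not> (AE x in \<mu>. \<xi> x = 0)"
    and e: "eigen r (\<lambda>x. ennreal (\<xi> x))"
  shows "emeasure \<mu> UNIV < \<infinity>"
proof -
  have "(AE x in \<mu>. ennreal (\<xi> x) = 0) \<or> (AE x in \<mu>. 0 < ennreal (\<xi> x))"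
    by (rule eigen_zero_or_pos[OF _ e]) measurable
  moreover have "\<not> (AE x in \<mu>. ennreal (\<xi> x) = 0)"
  proof
    assume "AE x in \<mu>. ennreal (\<xi> x) = 0"
    then have "AE x in \<mu>. \<xi> x = 0" by eventually_elim (use nn in \<open>auto simp: ennreal_eq_0_iff intro: antisym\<close>)
    then show False using nz by blast
  qed
  ultimately have pos: "AE x in \<mu>. 0 < \<xi> x" by simp
  interpret PP: pair_sigma_finite \<mu> "\<mu> \<Otimes>\<^sub>M \<mu>"
    by (intro pair_sigma_finite.intro sigma_finite_measure_axioms sigma_finite_pair_measure)
  let ?P = "\<lambda>z p. \<xi> (fst p) * \<xi> (snd p + z) = \<xi> (snd p) * \<xi> (fst p + z)"
  have "AE p in \<mu> \<Otimes>\<^sub>M \<mu>. ?P z p" for z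
  proof -
    obtain t where t: "AE x in \<mu>. \<xi> x = t * \<xi> (x + z)"
      using eigen_right_translate[OF \<xi>m nn r sq pos e] by blast
    have "AE x in \<mu>. AE x' in \<mu>. ?P z (x, x')"
      using t
    proof eventually_elim
      fix x assume x: "\<xi> x = t * \<xi> (x + z)"
      show "AE x' in \<mu>. ?P z (x, x')"
        using t by eventually_elim (simp add: x)
    qed
    moreover have "{p \<in> space (\<mu> \<Otimes>\<^sub>M \<mu>). ?P z p} \<in> sets (\<mu> \<Otimes>\<^sub>M \<mu>)"
      by (rule borel_measurable_eq) measurable
    ultimately show ?thesis by (intro P.AE_pair_measure) auto
  qed
  then have "AE z in \<mu>. AE p in \<mu> \<Otimes>\<^sub>M \<mu>. ?P z p" by simp
  moreover have "{x \<in> space (\<mu> \<Otimes>\<^sub>M (\<mu> \<Otimes>\<^sub>M \<mu>)). ?P (fst x) (snd x)} \<in> sets (\<mu> \<Otimes>\<^sub>M (\<mu> \<Otimes>\<^sub>M \<mu>))"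
    by (rule borel_measurable_eq) measurable
  ultimately have "AE p in \<mu> \<Otimes>\<^sub>M \<mu>. AE z in \<mu>. ?P z p"
    by (simp only: PP.AE_commute)
  then have "AE x in \<mu>. AE x' in \<mu>. AE z in \<mu>. ?P z (x, x')"
    by (rule P.AE_pair)
  then have "AE x in \<mu>. 0 < \<xi> x \<and> (AE x' in \<mu>. AE z in \<mu>. ?P z (x, x'))" using pos by eventually_elim simp
  moreover have "ae_filter \<mu> \<noteq> bot" using haar_nonzero by (simp add: ae_filter_eq_bot_iff)
  ultimately obtain x0 where x0: "0 < \<xi> x0" "AE x' in \<mu>. AE z in \<mu>. ?P z (x0, x')"
    using eventually_happens by blast
  define S where "S = (\<integral>\<^sup>+x. (ennreal (\<xi> x))\<^sup>2 \<partial>\<mu>)"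
  have S0: "S \<noteq> 0"
  proof
    assume "S = 0"
    then have "AE x in \<mu>. (ennreal (\<xi> x))\<^sup>2 = 0" unfolding S_def by (subst (asm) nn_integral_0_iff_AE) auto
    then have "AE x in \<mu>. \<xi> x = 0" by eventually_elim (use nn in \<open>auto simp: ennreal_eq_0_iff intro: antisym\<close>)
    then show False using nz by blast
  qed
  have tr: "(\<integral>\<^sup>+z. (ennreal (\<xi> x) * ennreal (\<xi> (y + z)))\<^sup>2 \<partial>\<mu>) = (ennreal (\<xi> x))\<^sup>2 * S" for x y
  proof -
    have "(\<integral>\<^sup>+z. (ennreal (\<xi> x) * ennreal (\<xi> (y + z)))\<^sup>2 \<partial>\<mu>) = (ennreal (\<xi> x))\<^sup>2 * (\<integral>\<^sup>+z. (ennreal (\<xi> (y + z)))\<^sup>2 \<partial>\<mu>)"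
      unfolding power_mult_distrib by (rule nn_integral_cmult) measurable
    also have "(\<integral>\<^sup>+z. (ennreal (\<xi> (y + z)))\<^sup>2 \<partial>\<mu>) = S"
      unfolding S_def by (rule nn_integral_left) measurable
    finally show ?thesis .
  qed
  have "AE x in \<mu>. \<xi> x = \<xi> x0"
    using x0(2)
  proof eventually_elim
    fix x assume a: "AE z in \<mu>. ?P z (x0, x)"
    have "(\<integral>\<^sup>+z. (ennreal (\<xi> x0) * ennreal (\<xi> (x + z)))\<^sup>2 \<partial>\<mu>) = (\<integral>\<^sup>+z. (ennreal (\<xi> x) * ennreal (\<xi> (x0 + z)))\<^sup>2 \<partial>\<mu>)"
      using a by (intro nn_integral_cong_AE) (auto elim!: eventually_mono simp: ennreal_mult[symmetric] nn)
    then have "(ennreal (\<xi> x0))\<^sup>2 * S = (ennreal (\<xi> x))\<^sup>2 * S" unfolding tr .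
    then have "(ennreal (\<xi> x0))\<^sup>2 = (ennreal (\<xi> x))\<^sup>2"
      using S0 sq by (elim ennreal_mult_right_cancel) (auto simp: S_def)
    then have "(\<xi> x0)\<^sup>2 = (\<xi> x)\<^sup>2" using nn by (simp add: ennreal_power)
    then show "\<xi> x = \<xi> x0" using nn by (simp add: power2_eq_iff_nonneg)
  qed
  then have "S = (\<integral>\<^sup>+x. (ennreal (\<xi> x0))\<^sup>2 \<partial>\<mu>)"
    unfolding S_def by (intro nn_integral_cong_AE) (auto elim: eventually_mono)
  then have "(ennreal (\<xi> x0))\<^sup>2 * emeasure \<mu> UNIV < \<infinity>" using sq by (simp add: S_def)
  then show ?thesis using x0(1) by (auto simp: ennreal_mult_less_top ennreal_power)
qed

end

section \<open>The averaging operator and its spectral gap\<close>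

context haar
begin

lemma nn_integral_sq_diff:
  assumes "h \<in> L2_fun \<mu>" "k \<in> L2_fun \<mu>"
  shows "(\<integral>\<^sup>+x. (ennreal (cmod (h x - k x)))\<^sup>2 \<partial>\<mu>) = ennreal ((L2.nrm (\<lambda>x. h x - k x))\<^sup>2)"
  by (rule nn_integral_sq_eq[OF L2.sub_mem[OF assms]])

lemma geometric_tail:
  assumes v: "\<And>k. v k \<in> L2_fun \<mu>" and q: "0 \<le> q" "q < 1" and C: "0 \<le> C"
    and step: "\<And>k. L2.nrm (\<lambda>x. v (Suc k) x - v k x) \<le> q ^ k * C"
  shows "L2.nrm (\<lambda>x. v (k + m) x - v k x) \<le> C * q ^ k / (1 - q)"
proof -
  have "L2.nrm (\<lambda>x. v (k + m) x - v k x) \<le> C * q ^ k * (1 - q ^ m) / (1 - q)"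
  proof (induction m)
    case 0
    then show ?case using L2.nrm_scale[OF L2.zero_mem, of 0] by simp
  next
    case (Suc m)
    have "L2.nrm (\<lambda>x. (v (Suc (k + m)) x - v (k + m) x) + (v (k + m) x - v k x))
       \<le> L2.nrm (\<lambda>x. v (Suc (k + m)) x - v (k + m) x) + L2.nrm (\<lambda>x. v (k + m) x - v k x)"
      by (intro L2.nrm_triangle L2.sub_mem v)
    also have "\<dots> \<le> q ^ (k + m) * C + C * q ^ k * (1 - q ^ m) / (1 - q)"
      using step[of "k + m"] Suc.IH by (rule add_mono)
    also have "\<dots> = C * q ^ k * (1 - q ^ Suc m) / (1 - q)"
      using q by (simp add: field_simps power_add)
    finally show ?case by simp
  qed
  also have "\<dots> \<le> C * q ^ k / (1 - q)"
    using q C by (intro divide_right_mono) (auto simp: mult_left_le)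
  finally show ?thesis .
qed

text \<open>Completeness of \<open>L\<^sup>2\<close> for geometrically convergent sequences, with convergence almost everywhere.\<close>

lemma L2_geometric_limit:
  assumes v: "\<And>k. v k \<in> L2_fun \<mu>" and q: "0 < q" "q < 1" and C: "0 \<le> C"
    and step: "\<And>k. L2.nrm (\<lambda>x. v (Suc k) x - v k x) \<le> q ^ k * C"
  obtains l where "l \<in> L2_fun \<mu>" "AE x in \<mu>. (\<lambda>k. v k x) \<longlonglongrightarrow> l x"
    "\<And>k. L2.nrm (\<lambda>x. v k x - l x) \<le> C * q ^ k / (1 - q)"
proof -
  have [measurable]: "v k \<in> borel_measurable borel" for k using v by (rule L2_measurable)
  \<comment> \<open>an increment \<open>D\<close> satisfies \<open>D \<le> s\<^sup>k + D\<^sup>2 / s\<^sup>k\<close>, and the integrals of the last terms are summable over \<open>k\<close>\<close>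
  define s where "s = sqrt q"
  have s: "0 < s" "s < 1" "s\<^sup>2 = q" using q by (auto simp: s_def)
  define d where "d k x = (cmod (v (Suc k) x - v k x))\<^sup>2 / s ^ k" for k x
  have [measurable]: "d k \<in> borel_measurable borel" for k unfolding d_def by measurable
  have d0: "0 \<le> d k x" for k x using s by (simp add: d_def)
  have di: "(\<integral>\<^sup>+x. ennreal (d k x) \<partial>\<mu>) \<le> ennreal (C\<^sup>2 * (s ^ 3) ^ k)" for k
  proof -
    have "(\<integral>\<^sup>+x. ennreal (d k x) \<partial>\<mu>) = (\<integral>\<^sup>+x. ennreal (1 / s ^ k) * (ennreal (cmod (v (Suc k) x - v k x)))\<^sup>2 \<partial>\<mu>)"
      using s by (intro nn_integral_cong) (simp add: d_def ennreal_power ennreal_mult[symmetric])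
    also have "\<dots> = ennreal (1 / s ^ k) * ennreal ((L2.nrm (\<lambda>x. v (Suc k) x - v k x))\<^sup>2)"
      unfolding nn_integral_sq_diff[OF v v, symmetric] by (rule nn_integral_cmult) measurable
    also have "\<dots> \<le> ennreal (1 / s ^ k) * ennreal ((q ^ k * C)\<^sup>2)"
      using step[of k] L2.nrm_nonneg[OF L2.sub_mem[OF v v]] by (intro mult_left_mono ennreal_leI power_mono) auto
    also have "\<dots> = ennreal (1 / s ^ k * (q ^ k * C)\<^sup>2)" using s by (simp only: ennreal_mult[symmetric] zero_le_power2 divide_nonneg_pos zero_le_one zero_less_power)
    also have "1 / s ^ k * (q ^ k * C)\<^sup>2 = C\<^sup>2 * (s ^ 3) ^ k"
      using s(1) unfolding s(3)[symmetric] by (simp add: field_simps power_mult[symmetric] flip: power_add)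
    finally show ?thesis .
  qed
  have s3: "s ^ 3 < 1" using s by (simp add: power_less_one_iff)
  have "(\<integral>\<^sup>+x. (\<Sum>k. ennreal (d k x)) \<partial>\<mu>) = (\<Sum>k. \<integral>\<^sup>+x. ennreal (d k x) \<partial>\<mu>)"
    by (rule nn_integral_suminf) measurable
  also have "\<dots> \<le> (\<Sum>k. ennreal (C\<^sup>2 * (s ^ 3) ^ k))" by (intro suminf_le di) auto
  also have "\<dots> < top"
    using s s3 by (subst suminf_ennreal2) (auto intro!: summable_mult summable_geometric)
  finally have "AE x in \<mu>. (\<Sum>k. ennreal (d k x)) \<noteq> \<infinity>"
    by (intro nn_integral_PInf_AE) (auto simp: less_top)
  then have conv: "AE x in \<mu>. convergent (\<lambda>k. v k x)"
  proof eventually_elim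
    fix x assume "(\<Sum>k. ennreal (d k x)) \<noteq> \<infinity>"
    then have sd: "summable (\<lambda>k. d k x)" by (intro summable_suminf_not_top d0) simp
    have "summable (\<lambda>k. v (Suc k) x - v k x)"
    proof (rule summable_comparison_test)
      show "summable (\<lambda>k. s ^ k + d k x)" using s by (intro summable_add sd summable_geometric) auto
      have "cmod (v (Suc k) x - v k x) \<le> s ^ k + d k x" for k
      proof (cases "cmod (v (Suc k) x - v k x) \<le> s ^ k")
        case True
        then show ?thesis using d0[of k x] by simp
      next
        case False
        then have "cmod (v (Suc k) x - v k x) * s ^ k \<le> (cmod (v (Suc k) x - v k x))\<^sup>2"
          by (simp add: power2_eq_square mult_left_mono)
        then have "cmod (v (Suc k) x - v k x) \<le> d k x" using s(1) by (simp add: d_def le_divide_eq)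
        then show ?thesis using s(1) by (simp add: add_increasing)
      qed
      then show "\<exists>N. \<forall>k\<ge>N. norm (v (Suc k) x - v k x) \<le> s ^ k + d k x" by blast
    qed
    then have "convergent (\<lambda>n. \<Sum>k<n. v (Suc k) x - v k x)" by (simp add: summable_iff_convergent)
    then have "convergent (\<lambda>n. v n x - v 0 x)" by (simp only: sum_lessThan_telescope[of "\<lambda>k. v k x"])
    then show "convergent (\<lambda>k. v k x)" by (simp add: convergent_diff_const_right_iff)
  qed
  define l where "l x = lim (\<lambda>k. v k x)" for x
  have lm [measurable]: "l \<in> borel_measurable borel" unfolding l_def by (rule borel_measurable_lim_metric) measurable
  have lim: "AE x in \<mu>. (\<lambda>k. v k x) \<longlonglongrightarrow> l x"
    using conv by eventually_elim (simp add: l_def convergent_LIMSEQ_iff)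
  let ?B = "\<lambda>k. C * q ^ k / (1 - q)"
  have B0: "0 \<le> ?B k" for k using q C by simp
  have fatou: "(\<integral>\<^sup>+x. (ennreal (cmod (v k x - l x)))\<^sup>2 \<partial>\<mu>) \<le> ennreal ((?B k)\<^sup>2)" for k
  proof -
    have "(\<integral>\<^sup>+x. (ennreal (cmod (v k x - l x)))\<^sup>2 \<partial>\<mu>) = (\<integral>\<^sup>+x. liminf (\<lambda>m. (ennreal (cmod (v (k + m) x - v k x)))\<^sup>2) \<partial>\<mu>)"
    proof (rule nn_integral_cong_AE)
      show "AE x in \<mu>. (ennreal (cmod (v k x - l x)))\<^sup>2 = liminf (\<lambda>m. (ennreal (cmod (v (k + m) x - v k x)))\<^sup>2)"
        using lim
      proof eventually_elim
        fix x assume "(\<lambda>k. v k x) \<longlonglongrightarrow> l x"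
        then have "(\<lambda>m. v (k + m) x) \<longlonglongrightarrow> l x" by (subst add.commute) (rule LIMSEQ_ignore_initial_segment)
        then have "(\<lambda>m. ennreal ((cmod (v (k + m) x - v k x))\<^sup>2)) \<longlonglongrightarrow> ennreal ((cmod (l x - v k x))\<^sup>2)"
          by (intro tendsto_intros)
        then have "(\<lambda>m. (ennreal (cmod (v (k + m) x - v k x)))\<^sup>2) \<longlonglongrightarrow> (ennreal (cmod (v k x - l x)))\<^sup>2"
          by (simp add: ennreal_power norm_minus_commute)
        then show "(ennreal (cmod (v k x - l x)))\<^sup>2 = liminf (\<lambda>m. (ennreal (cmod (v (k + m) x - v k x)))\<^sup>2)"
          by (intro lim_imp_Liminf[symmetric]) auto
      qed
    qed
    also have "\<dots> \<le> liminf (\<lambda>m. \<integral>\<^sup>+x. (ennreal (cmod (v (k + m) x - v k x)))\<^sup>2 \<partial>\<mu>)"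
      by (rule nn_integral_liminf) measurable
    also have "\<dots> \<le> liminf (\<lambda>m::nat. ennreal ((?B k)\<^sup>2))"
    proof (intro Liminf_mono always_eventually allI)
      fix m
      show "(\<integral>\<^sup>+x. (ennreal (cmod (v (k + m) x - v k x)))\<^sup>2 \<partial>\<mu>) \<le> ennreal ((?B k)\<^sup>2)"
        unfolding nn_integral_sq_diff[OF v v]
        using geometric_tail[of v q C k m, OF v _ q(2) C step] q L2.nrm_nonneg[OF L2.sub_mem[OF v v]]
        by (intro ennreal_leI power_mono) auto
    qed
    also have "\<dots> = ennreal ((?B k)\<^sup>2)" by (simp add: Liminf_const)
    finally show ?thesis .
  qed
  have mem: "(\<lambda>x. v k x - l x) \<in> L2_fun \<mu>" for k
    unfolding L2_fun_iff using fatou[of k] by (auto simp: measurable_cong_sets[OF sets_haar refl] order_le_less_trans)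
  have l: "l \<in> L2_fun \<mu>" using L2.sub_mem[OF v[of 0] mem[of 0]] by simp
  have "L2.nrm (\<lambda>x. v k x - l x) \<le> ?B k" for k
  proof (rule power2_le_imp_le[OF _ B0])
    show "(L2.nrm (\<lambda>x. v k x - l x))\<^sup>2 \<le> (?B k)\<^sup>2"
      using fatou[of k] unfolding nn_integral_sq_eq[OF mem] by (simp add: ennreal_le_iff)
  qed
  then show thesis using that[OF l lim] by blast
qed

end

text \<open>The kernel \<open>F\<close> is now assumed integrable, so that convolution by it is a bounded operator.\<close>

locale averaging = perron +
  assumes F_int: "integrable \<mu> F"
begin

text \<open>The kernel \<open>F\<close> as a complex function.\<close>

definition phi :: "'a \<Rightarrow> complex" where "phi x = of_real (F x)"

lemma phi_L1: "phi \<in> L1_fun \<mu>"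
  using F_int unfolding L1_fun_def phi_def[abs_def] by simp

text \<open>The kernel \<open>F * F\<close>.  Convolution by it is the square of a self-adjoint operator, hence positive.\<close>

definition \<Phi> :: "'a \<Rightarrow> real" where "\<Phi> x = (LINT y|\<mu>. F y * F (- y + x))"

lemma \<Phi>_meas [measurable]: "\<Phi> \<in> borel_measurable borel"
  unfolding \<Phi>_def by measurable

lemma \<Phi>_nonneg: "0 \<le> \<Phi> x"
  unfolding \<Phi>_def by (intro Bochner_Integration.integral_nonneg) (simp add: F_nonneg)

lemma conv_phi: "convolution \<mu> phi phi = (\<lambda>x. of_real (\<Phi> x))"
  unfolding convolution_def phi_def \<Phi>_def
  by (simp flip: of_real_mult)

lemma \<Phi>_L1: "(\<lambda>x. complex_of_real (\<Phi> x)) \<in> L1_fun \<mu>"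
  using convolution_L1[OF phi_L1 phi_L1] by (simp add: conv_phi)

lemma nn_integral_F: "(\<integral>\<^sup>+x. ennreal (F x) \<partial>\<mu>) < \<infinity>"
  using F_int F_nonneg by (simp add: integrable_iff_bounded)

lemma nconv_F_weak:
  assumes [measurable]: "w \<in> borel_measurable borel"
  shows "(\<integral>\<^sup>+z. nconv F (\<lambda>x. ennreal (F x)) z * w z \<partial>\<mu>) =
    (\<integral>\<^sup>+y. ennreal (F y) * (\<integral>\<^sup>+z. ennreal (F z) * w (y + z) \<partial>\<mu>) \<partial>\<mu>)"
proof -
  have "(\<integral>\<^sup>+z. nconv F (\<lambda>x. ennreal (F x)) z * w z \<partial>\<mu>) = (\<integral>\<^sup>+z. \<integral>\<^sup>+y. ennreal (F y) * ennreal (F (- y + z)) * w z \<partial>\<mu> \<partial>\<mu>)"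
    unfolding nconv_def by (simp add: nn_integral_multc)
  also have "\<dots> = (\<integral>\<^sup>+y. \<integral>\<^sup>+z. ennreal (F y) * ennreal (F (- y + z)) * w z \<partial>\<mu> \<partial>\<mu>)"
    by (rule P.Fubini') simp
  also have "\<dots> = (\<integral>\<^sup>+y. \<integral>\<^sup>+z. ennreal (F y) * ennreal (F (- y + (y + z))) * w (y + z) \<partial>\<mu> \<partial>\<mu>)"
    by (intro nn_integral_cong nn_integral_left[symmetric]) measurable
  also have "\<dots> = (\<integral>\<^sup>+y. ennreal (F y) * (\<integral>\<^sup>+z. ennreal (F z) * w (y + z) \<partial>\<mu>) \<partial>\<mu>)"
    by (simp add: add.assoc[symmetric] nn_integral_cmult mult.assoc)
  finally show ?thesis .
qed

lemma \<Phi>_eq_nconv: "AE x in \<mu>. ennreal (\<Phi> x) = nconv F (\<lambda>x. ennreal (F x)) x"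
proof -
  have "(\<integral>\<^sup>+x. nconv F (\<lambda>x. ennreal (F x)) x \<partial>\<mu>) = (\<integral>\<^sup>+y. ennreal (F y) * (\<integral>\<^sup>+z. ennreal (F z) \<partial>\<mu>) \<partial>\<mu>)"
    using nconv_F_weak[of "\<lambda>_. 1"] by simp
  also have "\<dots> = (\<integral>\<^sup>+y. ennreal (F y) \<partial>\<mu>) * (\<integral>\<^sup>+z. ennreal (F z) \<partial>\<mu>)"
    by (rule nn_integral_multc) measurable
  also have "\<dots> < \<infinity>" using nn_integral_F by (simp add: ennreal_mult_less_top)
  finally have "AE x in \<mu>. nconv F (\<lambda>x. ennreal (F x)) x \<noteq> \<infinity>"
    by (intro nn_integral_PInf_AE) auto
  then show ?thesis
  proof eventually_elim
    fix x assume fin: "nconv F (\<lambda>x. ennreal (F x)) x \<noteq> \<infinity>"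
    have eq: "nconv F (\<lambda>x. ennreal (F x)) x = (\<integral>\<^sup>+y. ennreal (F y * F (- y + x)) \<partial>\<mu>)"
      unfolding nconv_def by (simp add: ennreal_mult F_nonneg)
    have "integrable \<mu> (\<lambda>y. F y * F (- y + x))"
      using fin unfolding eq by (intro integrableI_nonneg) (auto simp: F_nonneg less_top)
    then show "ennreal (\<Phi> x) = nconv F (\<lambda>x. ennreal (F x)) x"
      unfolding eq \<Phi>_def by (intro nn_integral_eq_integral[symmetric]) (auto simp: F_nonneg)
  qed
qed

lemma \<Phi>_weak:
  assumes [measurable]: "w \<in> borel_measurable borel"
  shows "(\<integral>\<^sup>+z. ennreal (\<Phi> z) * w z \<partial>\<mu>) =
    (\<integral>\<^sup>+y. ennreal (F y) * (\<integral>\<^sup>+z. ennreal (F z) * w (y + z) \<partial>\<mu>) \<partial>\<mu>)"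
  unfolding nconv_F_weak[OF assms, symmetric]
  by (rule nn_integral_cong_AE) (use \<Phi>_eq_nconv in \<open>auto elim: eventually_mono\<close>)

lemma \<Phi>_sym: "distr (density \<mu> \<Phi>) borel uminus = density \<mu> \<Phi>"
proof (rule measure_eqI)
  fix A assume "A \<in> sets (distr (density \<mu> \<Phi>) borel uminus)"
  then have A [measurable]: "A \<in> sets borel" by simp
  have [measurable]: "uminus -` A \<in> sets borel" using measurable_sets[of "uminus" borel borel A] by simp
  have "emeasure (distr (density \<mu> \<Phi>) borel uminus) A = emeasure (density \<mu> \<Phi>) (uminus -` A)"
    by (subst emeasure_distr) auto
  also have "\<dots> = (\<integral>\<^sup>+z. ennreal (\<Phi> z) * indicator A (- z) \<partial>\<mu>)"
    by (subst emeasure_density) (auto simp: indicator_def)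
  also have "\<dots> = (\<integral>\<^sup>+y. ennreal (F y) * (\<integral>\<^sup>+z. ennreal (F z) * indicator A (- z + - y) \<partial>\<mu>) \<partial>\<mu>)"
    by (subst \<Phi>_weak) (simp_all only: minus_add, measurable)
  also have "\<dots> = (\<integral>\<^sup>+y. ennreal (F y) * (\<integral>\<^sup>+z. ennreal (F z) * indicator A (z + - y) \<partial>\<mu>) \<partial>\<mu>)"
  proof -
    have "(\<integral>\<^sup>+z. ennreal (F z) * indicator A (- z + - y) \<partial>\<mu>) = (\<integral>\<^sup>+z. ennreal (F z) * indicator A (z + - y) \<partial>\<mu>)" for y
      by (rule nn_integral_F_uminus[where w = "\<lambda>z. indicator A (z + - y)"]) measurable
    then show ?thesis by (simp only:)
  qed
  also have "\<dots> = (\<integral>\<^sup>+y. ennreal (F y) * (\<integral>\<^sup>+z. ennreal (F z) * indicator A (z + y) \<partial>\<mu>) \<partial>\<mu>)"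
    by (rule nn_integral_F_uminus[of "\<lambda>y. \<integral>\<^sup>+z. ennreal (F z) * indicator A (z + y) \<partial>\<mu>"]) measurable
  also have "\<dots> = (\<integral>\<^sup>+y. \<integral>\<^sup>+z. ennreal (F y) * (ennreal (F z) * indicator A (z + y)) \<partial>\<mu> \<partial>\<mu>)"
    by (simp add: nn_integral_cmult)
  also have "\<dots> = (\<integral>\<^sup>+z. \<integral>\<^sup>+y. ennreal (F y) * (ennreal (F z) * indicator A (z + y)) \<partial>\<mu> \<partial>\<mu>)"
    by (rule P.Fubini'[symmetric]) simp
  also have "\<dots> = (\<integral>\<^sup>+z. ennreal (F z) * (\<integral>\<^sup>+y. ennreal (F y) * indicator A (z + y) \<partial>\<mu>) \<partial>\<mu>)"
    by (simp add: nn_integral_cmult[symmetric] mult.left_commute)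
  also have "\<dots> = (\<integral>\<^sup>+z. ennreal (\<Phi> z) * indicator A z \<partial>\<mu>)" by (rule \<Phi>_weak[symmetric]) measurable
  also have "\<dots> = emeasure (density \<mu> \<Phi>) A" by (rule emeasure_density[symmetric]) auto
  finally show "emeasure (distr (density \<mu> \<Phi>) borel uminus) A = emeasure (density \<mu> \<Phi>) A" .
qed simp

lemma AE_not_False: "\<not> (AE x in \<mu>. False)"
  using haar_nonzero by (simp add: AE_iff_null null_sets_def)

lemma \<Phi>_pos: "AE x in \<mu>. 0 < \<Phi> x"
proof -
  have "\<not> (AE x in \<mu>. ennreal (F x) = 0)"
  proof
    assume "AE x in \<mu>. ennreal (F x) = 0"
    then have "AE x in \<mu>. False" using F_pos by eventually_elim (simp add: ennreal_eq_0_iff)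
    then show False using AE_not_False by simp
  qed
  then have "nconv F (\<lambda>x. ennreal (F x)) x \<noteq> 0" for x by (intro nconv_pos) auto
  then show ?thesis
    using \<Phi>_eq_nconv by (auto elim!: eventually_mono simp: less_le \<Phi>_nonneg)
qed

sublocale E: perron \<mu> \<Phi>
  by unfold_locales (rule \<Phi>_meas \<Phi>_nonneg \<Phi>_pos \<Phi>_sym)+

lemma integral_F_uminus:
  fixes w :: "'a \<Rightarrow> complex"
  assumes [measurable]: "w \<in> borel_measurable borel"
  shows "(LINT y|\<mu>. phi y * w (- y)) = (LINT y|\<mu>. phi y * w y)"
proof -
  have "(LINT y|\<mu>. phi y * w y) = (LINT y|density \<mu> F. w y)"
    by (subst integral_density) (auto simp: F_nonneg phi_def scaleR_conv_of_real)
  also have "\<dots> = (LINT y|distr (density \<mu> F) borel uminus. w y)" by (simp only: F_sym)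
  also have "\<dots> = (LINT y|density \<mu> F. w (- y))" by (rule integral_distr) auto
  also have "\<dots> = (LINT y|\<mu>. phi y * w (- y))"
    by (subst integral_density) (auto simp: F_nonneg phi_def scaleR_conv_of_real)
  finally show ?thesis ..
qed

lemma conv_phi_sa:
  assumes h: "h \<in> L2_fun \<mu>" and k: "k \<in> L2_fun \<mu>"
  shows "ip2 \<mu> (convolution \<mu> phi h) k = ip2 \<mu> h (convolution \<mu> phi k)"
proof -
  have "ip2 \<mu> h (convolution \<mu> phi k) = cnj (ip2 \<mu> (convolution \<mu> phi k) h)"
    by (rule L2.ip_sym) (intro convolution_L2 phi_L1 k h)+
  also have "\<dots> = cnj (LINT y|\<mu>. phi y * ip2 \<mu> (Lt y k) h)" by (simp only: ip2_convolution[OF phi_L1 k h])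
  also have "\<dots> = (LINT y|\<mu>. cnj (phi y * ip2 \<mu> (Lt y k) h))"
    by (rule Bochner_Integration.integral_cnj[symmetric])
  also have "\<dots> = (LINT y|\<mu>. phi y * ip2 \<mu> (Lt (- y) h) k)"
  proof (rule Bochner_Integration.integral_cong[OF refl])
    fix y
    have "cnj (ip2 \<mu> (Lt y k) h) = ip2 \<mu> h (Lt y k)"
      by (rule L2.ip_sym[symmetric]) (intro Lt_mem k h)+
    then show "cnj (phi y * ip2 \<mu> (Lt y k) h) = phi y * ip2 \<mu> (Lt (- y) h) k"
      using ip2_Lt[OF h k, of "- y"] by (simp add: phi_def)
  qed
  also have "\<dots> = (LINT y|\<mu>. phi y * ip2 \<mu> (Lt y h) k)"
    by (rule integral_F_uminus[OF ip2_Lt_measurable[OF h k]])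
  also have "\<dots> = ip2 \<mu> (convolution \<mu> phi h) k" by (rule ip2_convolution[OF phi_L1 h k, symmetric])
  finally show ?thesis ..
qed

text \<open>Left convolution by \<open>\<Phi>\<close>.\<close>

definition b :: "('a \<Rightarrow> complex) \<Rightarrow> ('a \<Rightarrow> complex)" where
  "b h = convolution \<mu> (\<lambda>x. of_real (\<Phi> x)) h"

lemma b_ip:
  assumes h: "h \<in> L2_fun \<mu>" and k: "k \<in> L2_fun \<mu>"
  shows "ip2 \<mu> (b h) k = ip2 \<mu> (convolution \<mu> phi h) (convolution \<mu> phi k)"
  using ip2_convolution_assoc[OF phi_L1 phi_L1 h k] conv_phi_sa[OF convolution_L2[OF phi_L1 h] k]
  by (simp add: b_def conv_phi)

sublocale O: pos_operator "L2_fun \<mu>" "ip2 \<mu>" b "LINT x|\<mu>. cmod (of_real (\<Phi> x))"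
proof
  fix h k assume h: "h \<in> L2_fun \<mu>"
  note c = convolution_L2[OF phi_L1]
  show m: "b h \<in> L2_fun \<mu>" unfolding b_def by (rule convolution_L2[OF \<Phi>_L1 h])
  show "0 \<le> Re (ip2 \<mu> (b h) h)" unfolding b_ip[OF h h] by (rule L2.ip_pos[OF c[OF h]])
  show "L2.nrm (b h) \<le> (LINT x|\<mu>. cmod (of_real (\<Phi> x))) * L2.nrm h"
    unfolding b_def by (rule nrm_convolution[OF \<Phi>_L1 h])
  assume k: "k \<in> L2_fun \<mu>"
  have "ip2 \<mu> h (b k) = cnj (ip2 \<mu> (b k) h)"
    unfolding b_def by (rule L2.ip_sym[OF convolution_L2[OF \<Phi>_L1 k] h])
  also have "\<dots> = ip2 \<mu> (convolution \<mu> phi h) (convolution \<mu> phi k)"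
    unfolding b_ip[OF k h] by (rule L2.ip_sym[OF c[OF k] c[OF h], symmetric])
  finally show "ip2 \<mu> (b h) k = ip2 \<mu> h (b k)" by (simp only: b_ip[OF h k])
qed

text \<open>The operator \<open>b\<close> on real functions.\<close>

definition cavg :: "('a \<Rightarrow> real) \<Rightarrow> ('a \<Rightarrow> real)" where
  "cavg h x = (LINT y|\<mu>. \<Phi> y * h (- y + x))"

lemma b_of_real: "b (\<lambda>x. of_real (h x)) = (\<lambda>x. of_real (cavg h x))"
  unfolding b_def convolution_def cavg_def by (simp flip: of_real_mult)

lemma funpow_b_of_real: "(b ^^ k) (\<lambda>x. of_real (h x)) = (\<lambda>x. of_real ((cavg ^^ k) h x))"
  by (induction k) (simp_all add: b_of_real)

lemma cavg_nonneg: "(\<And>x. 0 \<le> h x) \<Longrightarrow> 0 \<le> cavg h x"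
  unfolding cavg_def by (intro Bochner_Integration.integral_nonneg) (simp add: \<Phi>_nonneg)

lemma funpow_cavg_nonneg: "(\<And>x. 0 \<le> h x) \<Longrightarrow> 0 \<le> (cavg ^^ k) h x"
  by (induction k arbitrary: x) (auto intro: cavg_nonneg)

lemma cavg_integrable:
  assumes G: "(\<lambda>x. complex_of_real (G x)) \<in> L2_fun \<mu>" and nn: "\<And>x. 0 \<le> G x"
  shows "AE x in \<mu>. integrable \<mu> (\<lambda>y. \<Phi> y * G (- y + x)) \<and>
    nconv \<Phi> (\<lambda>x. ennreal (G x)) x = ennreal (cavg G x)"
proof -
  have "(\<lambda>x. Re (complex_of_real (G x))) \<in> borel_measurable borel"
    using L2_measurable[OF G] by measurable
  then have [measurable]: "G \<in> borel_measurable borel" by simp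
  show ?thesis
    using convolution_AE_integrable[OF \<Phi>_L1 G]
  proof eventually_elim
    fix x assume "nconv (\<lambda>y. cmod (complex_of_real (\<Phi> y))) (\<lambda>y. ennreal (cmod (complex_of_real (G y)))) x < \<infinity>"
    then have fin: "nconv \<Phi> (\<lambda>x. ennreal (G x)) x < \<infinity>" by (simp add: \<Phi>_nonneg nn)
    have eq: "nconv \<Phi> (\<lambda>x. ennreal (G x)) x = (\<integral>\<^sup>+y. ennreal (\<Phi> y * G (- y + x)) \<partial>\<mu>)"
      unfolding nconv_def by (simp add: ennreal_mult \<Phi>_nonneg nn)
    have int: "integrable \<mu> (\<lambda>y. \<Phi> y * G (- y + x))"
      using fin unfolding eq by (intro integrableI_nonneg) (auto simp: \<Phi>_nonneg nn)
    moreover have "nconv \<Phi> (\<lambda>x. ennreal (G x)) x = ennreal (cavg G x)"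
      unfolding eq cavg_def using int by (intro nn_integral_eq_integral) (auto simp: \<Phi>_nonneg nn)
    ultimately show "integrable \<mu> (\<lambda>y. \<Phi> y * G (- y + x)) \<and>
        nconv \<Phi> (\<lambda>x. ennreal (G x)) x = ennreal (cavg G x)" by blast
  qed
qed

text \<open>The operator \<open>b\<close> preserves domination of the modulus.\<close>

lemma b_dominated:
  assumes g: "g \<in> L2_fun \<mu>" and G: "(\<lambda>x. complex_of_real (G x)) \<in> L2_fun \<mu>" and nn: "\<And>x. 0 \<le> G x"
    and le: "AE x in \<mu>. cmod (g x) \<le> G x"
  shows "AE x in \<mu>. cmod (b g x) \<le> cavg G x"
  using cavg_integrable[OF G nn]
proof eventually_elim
  fix x assume "integrable \<mu> (\<lambda>y. \<Phi> y * G (- y + x)) \<and> nconv \<Phi> (\<lambda>x. ennreal (G x)) x = ennreal (cavg G x)"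
  then have int: "integrable \<mu> (\<lambda>y. \<Phi> y * G (- y + x))" by blast
  have [measurable]: "g \<in> borel_measurable borel" using g by (rule L2_measurable)
  have "AE y in \<mu>. cmod (g (- y + x)) \<le> G (- y + x)" by (rule AE_uminus[OF AE_right[OF le]])
  then have dom: "AE y in \<mu>. norm (complex_of_real (\<Phi> y) * g (- y + x)) \<le> \<Phi> y * G (- y + x)"
    by eventually_elim (simp add: norm_mult \<Phi>_nonneg mult_left_mono)
  have "integrable \<mu> (\<lambda>y. complex_of_real (\<Phi> y) * g (- y + x))"
    by (rule Bochner_Integration.integrable_bound[OF int])
       (measurable, use dom in \<open>auto elim!: eventually_mono intro: order_trans[OF _ abs_ge_self]\<close>)
  then have "(LINT y|\<mu>. norm (complex_of_real (\<Phi> y) * g (- y + x))) \<le> cavg G x"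
    unfolding cavg_def using int dom by (intro integral_mono_AE) auto
  then show "cmod (b g x) \<le> cavg G x"
    unfolding b_def convolution_def
    using integral_norm_bound[of \<mu> "\<lambda>y. complex_of_real (\<Phi> y) * g (- y + x)"] by linarith
qed

lemma funpow_b_dominated:
  assumes g: "g \<in> L2_fun \<mu>" and G: "(\<lambda>x. complex_of_real (G x)) \<in> L2_fun \<mu>" and nn: "\<And>x. 0 \<le> G x"
    and le: "AE x in \<mu>. cmod (g x) \<le> G x"
  shows "AE x in \<mu>. cmod ((b ^^ k) g x) \<le> (cavg ^^ k) G x"
proof (induction k)
  case (Suc k)
  have "(\<lambda>x. complex_of_real ((cavg ^^ k) G x)) \<in> L2_fun \<mu>"
    using O.funpow_mem[OF G, of k] by (simp add: funpow_b_of_real)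
  then have "AE x in \<mu>. cmod (b ((b ^^ k) g) x) \<le> cavg ((cavg ^^ k) G) x"
    by (intro b_dominated O.funpow_mem g funpow_cavg_nonneg nn Suc)
  then show ?case by simp
qed (simp add: le)

lemma nrm_mono:
  assumes g: "g \<in> L2_fun \<mu>" and h: "h \<in> L2_fun \<mu>" and le: "AE x in \<mu>. cmod (g x) \<le> cmod (h x)"
  shows "L2.nrm g \<le> L2.nrm h"
proof (rule power2_le_imp_le[OF _ L2.nrm_nonneg[OF h]])
  have "(\<integral>\<^sup>+x. (ennreal (cmod (g x)))\<^sup>2 \<partial>\<mu>) \<le> (\<integral>\<^sup>+x. (ennreal (cmod (h x)))\<^sup>2 \<partial>\<mu>)"
    by (rule nn_integral_mono_AE) (use le in \<open>auto elim!: eventually_mono intro!: power_mono ennreal_leI\<close>)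
  then show "(L2.nrm g)\<^sup>2 \<le> (L2.nrm h)\<^sup>2"
    unfolding nn_integral_sq_eq[OF g] nn_integral_sq_eq[OF h] by (simp add: ennreal_le_iff)
qed

lemma nrm_pos_exists: "\<exists>h\<in>L2_fun \<mu>. 0 < L2.nrm h"
proof -
  let ?h = "\<lambda>x. complex_of_real (sqrt (F x))"
  have "(\<integral>\<^sup>+x. (ennreal (cmod (?h x)))\<^sup>2 \<partial>\<mu>) = (\<integral>\<^sup>+x. ennreal (F x) \<partial>\<mu>)"
    by (intro nn_integral_cong) (simp add: F_nonneg ennreal_power)
  then have h: "?h \<in> L2_fun \<mu>" unfolding L2_fun_iff using nn_integral_F by simp
  moreover have "L2.nrm ?h \<noteq> 0"
  proof
    assume "L2.nrm ?h = 0"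
    then have "AE x in \<mu>. ?h x = 0" by (simp only: nrm_0_iff[OF h])
    then have "AE x in \<mu>. False" using F_pos by eventually_elim simp
    then show False using AE_not_False by simp
  qed
  ultimately show ?thesis using L2.nrm_nonneg[OF h] by (intro bexI[of _ ?h]) auto
qed

lemma aspec_ne: "O.aspec \<noteq> {}"
  using nrm_pos_exists O.aspec_nonempty by blast

lemma aspec_le_Sup: "t \<in> O.aspec \<Longrightarrow> t \<le> Sup O.aspec"
  by (erule cSup_upper) (rule bdd_aboveI, rule O.aspec_le)

lemma Sup_aspec_pos: "0 < Sup O.aspec"
proof (rule ccontr)
  assume "\<not> 0 < Sup O.aspec"
  then have z: "t = 0" if "t \<in> O.aspec" for t using aspec_le_Sup[OF that] O.aspec_nonneg[OF that] by simp
  obtain g where g: "g \<in> L2_fun \<mu>" "0 < L2.nrm g" using nrm_pos_exists by blast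
  let ?G = "\<lambda>x. complex_of_real (cmod (g x))"
  have [measurable]: "g \<in> borel_measurable borel" using g(1) by (rule L2_measurable)
  have G: "?G \<in> L2_fun \<mu>" using g(1) unfolding L2_fun_iff by simp
  have "L2.nrm (O.polyop [:0, 1:] ?G) \<le> 0 * L2.nrm ?G"
    using z by (intro O.polyop_le_spectral G) auto
  then have "L2.nrm (b ?G) = 0"
    using O.nrm_polyop_linear[OF G, of 0] L2.nrm_nonneg[OF O.b_mem[OF G]] by simp
  then have "AE x in \<mu>. b ?G x = 0" by (simp only: nrm_0_iff[OF O.b_mem[OF G]])
  then have "AE x in \<mu>. nconv \<Phi> (\<lambda>x. ennreal (cmod (g x))) x = 0"
    using cavg_integrable[OF G norm_ge_zero] by eventually_elim (simp add: b_of_real)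
  moreover have "\<not> (AE x in \<mu>. ennreal (cmod (g x)) = 0)"
  proof
    assume "AE x in \<mu>. ennreal (cmod (g x)) = 0"
    then have "AE x in \<mu>. g x = 0" by eventually_elim (simp add: ennreal_eq_0_iff)
    then show False using g nrm_0_iff[OF g(1)] by simp
  qed
  ultimately have "AE x in \<mu>. False"
    using E.nconv_pos[of "\<lambda>x. ennreal (cmod (g x))"] by simp
  then show False using AE_not_False by simp
qed

text \<open>Passage from an eigenvector of \<open>b\<close> in \<open>L\<^sup>2\<close> to the pointwise setting of eigenfunctions with values in \<open>[0, \<infinity>]\<close>.\<close>

lemma positive_eigenfunction:
  assumes v: "v \<in> L2_fun \<mu>" "0 < L2.nrm v" and nn: "AE x in \<mu>. v x = of_real (cmod (v x))"
    and r: "0 < r" and eig: "AE x in \<mu>. b v x = of_real r * v x"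
  shows "emeasure \<mu> UNIV < \<infinity>"
proof -
  define \<xi> where "\<xi> x = cmod (v x)" for x
  have vm [measurable]: "v \<in> borel_measurable borel" using v(1) by (rule L2_measurable)
  have [measurable]: "\<xi> \<in> borel_measurable borel" unfolding \<xi>_def by measurable
  have X: "(\<lambda>x. complex_of_real (\<xi> x)) \<in> L2_fun \<mu>" using v(1) unfolding L2_fun_iff \<xi>_def by simp
  have bv: "b v x = of_real (cavg \<xi> x)" for x
  proof -
    have "AE y in \<mu>. v (- y + x) = of_real (\<xi> (- y + x))"
      using AE_uminus[OF AE_right[OF nn]] by (simp add: \<xi>_def)
    then have "b v x = b (\<lambda>x. of_real (\<xi> x)) x"
      unfolding b_def convolution_def by (intro integral_cong_AE) (auto elim: eventually_mono)
    then show ?thesis by (simp add: b_of_real)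
  qed
  have "AE x in \<mu>. complex_of_real (cavg \<xi> x) = of_real (r * \<xi> x)"
    using eig nn by eventually_elim (simp add: bv \<xi>_def)
  then have "AE x in \<mu>. cavg \<xi> x = r * \<xi> x" by eventually_elim (simp only: of_real_eq_iff)
  moreover have "AE x in \<mu>. integrable \<mu> (\<lambda>y. \<Phi> y * \<xi> (- y + x)) \<and> nconv \<Phi> (\<lambda>x. ennreal (\<xi> x)) x = ennreal (cavg \<xi> x)"
    by (rule cavg_integrable[OF X]) (simp add: \<xi>_def)
  ultimately have "E.eigen r (\<lambda>x. ennreal (\<xi> x))"
    unfolding E.eigen_def by eventually_elim (use r in \<open>simp add: ennreal_mult \<xi>_def[of _]\<close>)
  moreover have "(\<integral>\<^sup>+x. (ennreal (\<xi> x))\<^sup>2 \<partial>\<mu>) < \<infinity>" using v(1) unfolding L2_fun_iff \<xi>_def by simp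
  moreover have "\<not> (AE x in \<mu>. \<xi> x = 0)" using v nrm_0_iff[OF v(1)] by (simp add: \<xi>_def)
  ultimately show ?thesis
    using r by (intro E.eigenfunction_imp_finite[of \<xi> r]) (auto simp: \<xi>_def)
qed

text \<open>The powers of \<open>b / r\<close> applied to \<open>\<bar>h\<bar>\<close> converge to a nonnegative eigenvector.  To see that it is nonzero, \<open>h\<close> is taken so
  close to an eigenvector for \<open>r\<close> that \<open>(b / r)\<^sup>K h\<close> has norm at least \<open>\<parallel>h\<parallel> / 2\<close>, where \<open>K\<close> is such that the remaining steps
  change the vector by at most \<open>\<parallel>h\<parallel> / 4\<close>; the modulus of \<open>(b / r)\<^sup>K h\<close> is dominated by \<open>(b / r)\<^sup>K \<bar>h\<bar>\<close>.\<close>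

theorem gap_imp_finite:
  assumes d: "0 < d" and gap: "\<And>t. t \<in> O.aspec \<Longrightarrow> Sup O.aspec - d < t \<Longrightarrow> \<not> t < Sup O.aspec"
  shows "emeasure \<mu> UNIV < \<infinity>"
proof -
  define r where "r = Sup O.aspec"
  have r: "0 < r" and rA: "r \<in> O.aspec" unfolding r_def using Sup_aspec_pos O.Sup_aspec_mem[OF aspec_ne] by auto
  define q where "q = max (1 / 2) (1 - d / r)"
  have q: "0 < q" "q < 1" using d r by (auto simp: q_def)
  have gap': "t = r \<or> t \<le> q * r" if t: "t \<in> O.aspec" for t
  proof (cases "t = r")
    case False
    then have "t < Sup O.aspec" using aspec_le_Sup[OF t] by (simp add: r_def)
    then have "t \<le> r - d" using gap[OF t] by (fastforce simp: r_def not_less[symmetric])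
    also have "\<dots> = (1 - d / r) * r" using r by (simp add: field_simps)
    also have "\<dots> \<le> q * r" using r by (intro mult_right_mono) (auto simp: q_def)
    finally show ?thesis ..
  qed simp
  have "(\<lambda>k. q ^ k / (1 - q)) \<longlonglongrightarrow> 0 / (1 - q)" using q by (intro tendsto_intros LIMSEQ_realpow_zero) auto
  then have "\<forall>\<^sub>F k in sequentially. q ^ k / (1 - q) < 1 / 4" by (intro order_tendstoD) auto
  then obtain K where K: "q ^ K / (1 - q) < 1 / 4" by (auto simp: eventually_sequentially)
  obtain C where C: "C \<ge> 0" "\<And>h. h \<in> L2_fun \<mu> \<Longrightarrow>
      L2.nrm (\<lambda>x. O.polyop (monom 1 K) h x - poly (monom 1 K) (of_real r) * h x) \<le> C * L2.nrm (\<lambda>x. b h x - of_real r * h x)"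
    using O.polyop_near_eigenvector[of "monom 1 K" "of_real r"] by blast
  define e where "e = r ^ K / (2 * (C + 1))"
  have e: "e > 0" using r C by (simp add: e_def)
  obtain h where h: "h \<in> L2_fun \<mu>" and hl: "L2.nrm (\<lambda>x. b h x - of_real r * h x) < e * L2.nrm h"
    using rA e unfolding O.aspec_def by blast
  have hp: "0 < L2.nrm h"
  proof -
    have "0 < e * L2.nrm h"
      using hl L2.nrm_nonneg[OF L2.diff_mem[OF O.b_mem[OF h] h, of "of_real r"]] by linarith
    then show ?thesis using e by (simp add: zero_less_mult_iff)
  qed
  have bK: "(1 / 2) * r ^ K * L2.nrm h \<le> L2.nrm ((b ^^ K) h)"
  proof -
    have "L2.nrm (\<lambda>x. (b ^^ K) h x - of_real r ^ K * h x) \<le> C * L2.nrm (\<lambda>x. b h x - of_real r * h x)"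
      using C(2)[OF h] by (simp add: O.polyop_monom poly_monom)
    also have "\<dots> \<le> (C + 1) * (e * L2.nrm h)"
      using hl C(1) L2.nrm_nonneg[OF L2.diff_mem[OF O.b_mem[OF h] h, of "of_real r"]] by (intro mult_mono) auto
    also have "\<dots> = (1 / 2) * r ^ K * L2.nrm h" using C(1) by (simp add: e_def field_simps)
    finally have *: "L2.nrm (\<lambda>x. (b ^^ K) h x - of_real r ^ K * h x) \<le> (1 / 2) * r ^ K * L2.nrm h" .
    have "L2.nrm (\<lambda>x. of_real r ^ K * h x) - L2.nrm ((b ^^ K) h) \<le> L2.nrm (\<lambda>x. of_real r ^ K * h x - (b ^^ K) h x)"
      by (intro L2.nrm_triangle_lower L2.scale_mem h O.funpow_mem)
    also have "\<dots> = L2.nrm (\<lambda>x. (b ^^ K) h x - of_real r ^ K * h x)"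
      using L2.nrm_scale[OF L2.diff_mem[OF O.funpow_mem[OF h] h, of K "of_real r ^ K"], of "-1"] by simp
    also note *
    finally show ?thesis using r by (simp add: L2.nrm_scale[OF h] norm_power)
  qed
  let ?G = "\<lambda>x. complex_of_real (cmod (h x))"
  have [measurable]: "h \<in> borel_measurable borel" using h by (rule L2_measurable)
  have G: "?G \<in> L2_fun \<mu>" using h unfolding L2_fun_iff by simp
  have nG: "L2.nrm ?G = L2.nrm h" by (simp add: nrm_eq)
  define v where "v k x = of_real ((1 / r) ^ k) * (b ^^ k) ?G x" for k x
  have vm: "v k \<in> L2_fun \<mu>" for k
    unfolding v_def[abs_def] by (intro L2.scale_mem O.funpow_mem G)
  have step: "L2.nrm (\<lambda>x. v (Suc k) x - v k x) \<le> q ^ k * L2.nrm h" for k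
    unfolding v_def nG[symmetric]
    by (rule O.funpow_gap[OF r less_imp_le[OF q(1)] gap' _ G]) (auto simp: r_def intro: aspec_le_Sup)
  obtain l where l: "l \<in> L2_fun \<mu>" and lim: "AE x in \<mu>. (\<lambda>k. v k x) \<longlonglongrightarrow> l x"
    and dist: "\<And>k. L2.nrm (\<lambda>x. v k x - l x) \<le> L2.nrm h * q ^ k / (1 - q)"
    using L2_geometric_limit[OF vm q less_imp_le[OF hp] step] by blast
  show ?thesis
  proof (rule positive_eigenfunction[OF l _ _ r])
    have "(1 / 2) * L2.nrm h \<le> L2.nrm (v K)"
    proof -
      have "L2.nrm ((b ^^ K) h) \<le> L2.nrm ((b ^^ K) ?G)"
      proof (rule nrm_mono)
        show "AE x in \<mu>. cmod ((b ^^ K) h x) \<le> cmod ((b ^^ K) ?G x)"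
          using funpow_b_dominated[OF h G, of K]
          by (simp add: funpow_b_of_real) (auto elim!: eventually_mono intro: order_trans[OF _ abs_ge_self])
      qed (intro O.funpow_mem h G)+
      then have "(1 / 2) * r ^ K * L2.nrm h \<le> L2.nrm ((b ^^ K) ?G)" using bK by linarith
      then have "(1 / r) ^ K * ((1 / 2) * r ^ K * L2.nrm h) \<le> (1 / r) ^ K * L2.nrm ((b ^^ K) ?G)"
        using r by (intro mult_left_mono) auto
      moreover have "(1 / r) ^ K * ((1 / 2) * r ^ K * L2.nrm h) = (1 / 2) * L2.nrm h"
        using r by (simp add: power_one_over)
      moreover have "L2.nrm (v K) = (1 / r) ^ K * L2.nrm ((b ^^ K) ?G)"
        unfolding v_def[abs_def] L2.nrm_scale[OF O.funpow_mem[OF G]] norm_of_real using r by simp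
      ultimately show ?thesis by linarith
    qed
    also have "L2.nrm (v K) \<le> L2.nrm l + L2.nrm (\<lambda>x. v K x - l x)"
      using L2.nrm_triangle_lower[OF vm[of K] l] by linarith
    also have "L2.nrm (\<lambda>x. v K x - l x) \<le> L2.nrm h * (1 / 4)"
    proof -
      have "L2.nrm h * q ^ K / (1 - q) \<le> L2.nrm h * (1 / 4)"
        using mult_left_mono[OF less_imp_le[OF K] less_imp_le[OF hp]] by simp
      then show ?thesis using dist[of K] by linarith
    qed
    finally show "0 < L2.nrm l" using hp by linarith
    show "AE x in \<mu>. l x = of_real (cmod (l x))"
      using lim
    proof eventually_elim
      fix x assume x: "(\<lambda>k. v k x) \<longlonglongrightarrow> l x"
      have "v k x = of_real (cmod (v k x))" for k
        using funpow_cavg_nonneg[of "\<lambda>x. cmod (h x)" k x] r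
        by (simp add: v_def funpow_b_of_real norm_mult flip: of_real_power)
      then have "(\<lambda>k. v k x) \<longlonglongrightarrow> of_real (cmod (l x))"
        using tendsto_of_real[OF tendsto_norm[OF x], where 'a = complex] by simp
      then show "l x = of_real (cmod (l x))" using LIMSEQ_unique[OF x] by blast
    qed
    have ip_lim: "(\<lambda>k. ip2 \<mu> (v k) m) \<longlonglongrightarrow> ip2 \<mu> l m" if m: "m \<in> L2_fun \<mu>" for m
    proof -
      have le: "cmod (ip2 \<mu> (v k) m - ip2 \<mu> l m) \<le> L2.nrm h * q ^ k / (1 - q) * L2.nrm m" for k
      proof -
        have "ip2 \<mu> (v k) m - ip2 \<mu> l m = ip2 \<mu> (\<lambda>x. v k x - l x) m"
          using L2.ip_diff[OF vm l m, of k 1] by simp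
        then have "cmod (ip2 \<mu> (v k) m - ip2 \<mu> l m) \<le> L2.nrm (\<lambda>x. v k x - l x) * L2.nrm m"
          using L2.Cauchy_Schwarz[OF L2.sub_mem[OF vm l] m] by simp
        also have "\<dots> \<le> L2.nrm h * q ^ k / (1 - q) * L2.nrm m"
          by (intro mult_right_mono dist L2.nrm_nonneg m)
        finally show ?thesis .
      qed
      have "(\<lambda>k. L2.nrm h * q ^ k / (1 - q) * L2.nrm m) \<longlonglongrightarrow> L2.nrm h * 0 / (1 - q) * L2.nrm m"
        using q by (intro tendsto_intros LIMSEQ_realpow_zero) auto
      then have "(\<lambda>k. L2.nrm h * q ^ k / (1 - q) * L2.nrm m) \<longlonglongrightarrow> 0" by simp
      then have "(\<lambda>k. ip2 \<mu> (v k) m - ip2 \<mu> l m) \<longlonglongrightarrow> 0"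
        by (rule Lim_null_comparison[OF always_eventually[OF allI[OF le]]])
      then show ?thesis by (simp add: LIM_zero_iff)
    qed
    show "AE x in \<mu>. b l x = of_real r * l x"
    proof (rule AE_eqI_ip)
      fix m assume m: "m \<in> L2_fun \<mu>"
      have bm: "b m \<in> L2_fun \<mu>" using m by (rule O.b_mem)
      have s: "ip2 \<mu> (v k) (b m) = of_real r * ip2 \<mu> (v (Suc k)) m" for k
      proof -
        have "ip2 \<mu> (v k) (b m) = of_real ((1 / r) ^ k) * ip2 \<mu> ((b ^^ Suc k) ?G) m"
          unfolding v_def[abs_def] L2.ip_scale[OF O.funpow_mem[OF G] bm]
          using O.b_sa[OF O.funpow_mem[OF G] m] by simp
        moreover have "ip2 \<mu> (v (Suc k)) m = of_real ((1 / r) ^ Suc k) * ip2 \<mu> ((b ^^ Suc k) ?G) m"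
          unfolding v_def[abs_def] by (rule L2.ip_scale[OF O.funpow_mem[OF G] m])
        ultimately show ?thesis using r by simp
      qed
      have "(\<lambda>k. ip2 \<mu> (v k) (b m)) \<longlonglongrightarrow> of_real r * ip2 \<mu> l m"
        unfolding s by (intro tendsto_intros LIMSEQ_Suc ip_lim m)
      then have "ip2 \<mu> l (b m) = of_real r * ip2 \<mu> l m" using LIMSEQ_unique ip_lim[OF bm] by blast
      then show "ip2 \<mu> (b l) m = ip2 \<mu> (\<lambda>x. of_real r * l x) m"
        by (simp add: O.b_sa[OF l m] L2.ip_scale[OF l m])
    qed (intro O.b_mem L2.scale_mem l)+
  qed
qed

end

section \<open>The reduced group C*-algebra\<close>

context haar
begin

text \<open>The element of the space \<open>L\<^sup>2\<close> given by a function.\<close>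

definition cls :: "('g \<Rightarrow> complex) \<Rightarrow> ('g \<Rightarrow> complex) set" where
  "cls h = L2_rel \<mu> `` {h}"

lemma mem_cls: "h \<in> L2_fun \<mu> \<Longrightarrow> k \<in> cls h \<longleftrightarrow> k \<in> L2_fun \<mu> \<and> (AE x in \<mu>. h x = k x)"
  by (auto simp: cls_def L2_rel_def)

lemma cls_self: "h \<in> L2_fun \<mu> \<Longrightarrow> h \<in> cls h"
  by (simp add: mem_cls)

lemma cls_eqI:
  assumes h: "h \<in> L2_fun \<mu>" and k: "k \<in> L2_fun \<mu>" and ae: "AE x in \<mu>. h x = k x"
  shows "cls h = cls k"
proof (rule set_eqI)
  fix l
  have "AE x in \<mu>. (h x = l x) = (k x = l x)" using ae by eventually_elim simp
  then have "(AE x in \<mu>. h x = l x) \<longleftrightarrow> (AE x in \<mu>. k x = l x)" by (rule eventually_subst)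
  then show "l \<in> cls h \<longleftrightarrow> l \<in> cls k" by (simp add: mem_cls h k)
qed

lemma cls_eqI_ip:
  assumes "h \<in> L2_fun \<mu>" "k \<in> L2_fun \<mu>" "\<And>l. l \<in> L2_fun \<mu> \<Longrightarrow> ip2 \<mu> h l = ip2 \<mu> k l"
  shows "cls h = cls k"
  by (rule cls_eqI[OF assms(1,2) AE_eqI_ip[OF assms]])

lemma cls_ne: "h \<in> L2_fun \<mu> \<Longrightarrow> cls h \<noteq> {}"
  using cls_self by blast

lemma L2_points: "points (L2_space \<mu>) = cls ` L2_fun \<mu>"
  by (auto simp: L2_space_def quotient_def cls_def)

lemma cls_mem: "h \<in> L2_fun \<mu> \<Longrightarrow> cls h \<in> points (L2_space \<mu>)"
  by (simp add: L2_points)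

lemma UN_const: "A \<noteq> {} \<Longrightarrow> (\<And>x. x \<in> A \<Longrightarrow> f x = B) \<Longrightarrow> (\<Union>x\<in>A. f x) = B"
  by auto

lemma L2_plus:
  assumes h: "h \<in> L2_fun \<mu>" and k: "k \<in> L2_fun \<mu>"
  shows "plus_of (L2_space \<mu>) (cls h) (cls k) = cls (\<lambda>x. h x + k x)"
proof -
  have eq: "cls (\<lambda>x. h' x + k' x) = cls (\<lambda>x. h x + k x)" if h': "h' \<in> cls h" and k': "k' \<in> cls k" for h' k'
  proof (rule cls_eqI)
    have "AE x in \<mu>. h x = h' x" "AE x in \<mu>. k x = k' x" using h' k' by (auto simp: mem_cls h k)
    then show "AE x in \<mu>. h' x + k' x = h x + k x" by eventually_elim simp
  qed (use h' k' h k in \<open>auto simp: mem_cls intro: L2.add_mem\<close>)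
  have "(\<Union>h'\<in>cls h. \<Union>k'\<in>cls k. cls (\<lambda>x. h' x + k' x)) = cls (\<lambda>x. h x + k x)"
    by (intro UN_const cls_ne h k eq)
  then show ?thesis by (simp add: L2_space_def cls_def)
qed

lemma L2_scale:
  assumes h: "h \<in> L2_fun \<mu>"
  shows "scale_of (L2_space \<mu>) c (cls h) = cls (\<lambda>x. c * h x)"
proof -
  have eq: "cls (\<lambda>x. c * h' x) = cls (\<lambda>x. c * h x)" if h': "h' \<in> cls h" for h'
  proof (rule cls_eqI)
    have "AE x in \<mu>. h x = h' x" using h' by (auto simp: mem_cls h)
    then show "AE x in \<mu>. c * h' x = c * h x" by eventually_elim simp
  qed (use h' h in \<open>auto simp: mem_cls intro: L2.scale_mem\<close>)
  have "(\<Union>h'\<in>cls h. cls (\<lambda>x. c * h' x)) = cls (\<lambda>x. c * h x)"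
    by (intro UN_const cls_ne h eq)
  then show ?thesis by (simp add: L2_space_def cls_def)
qed

lemma L2_norm:
  assumes h: "h \<in> L2_fun \<mu>"
  shows "norm_of (L2_space \<mu>) (cls h) = L2.nrm h"
proof -
  have "sqrt (LINT x|\<mu>. (cmod (h' x))\<^sup>2) = L2.nrm h" if h': "h' \<in> cls h" for h'
  proof -
    have h'm: "h' \<in> L2_fun \<mu>" and ae: "AE x in \<mu>. h x = h' x" using h' by (auto simp: mem_cls h)
    have "L2.nrm h = L2.nrm h'"
      by (rule L2.nrm_cong[OF h h'm ip2_cong_AE[OF h h'm ae]])
    then show ?thesis by (simp add: nrm_eq)
  qed
  then have "(\<lambda>h. sqrt (LINT x|\<mu>. (cmod (h x))\<^sup>2)) ` cls h = {L2.nrm h}"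
    using cls_self[OF h] by force
  then show ?thesis by (simp add: L2_space_def)
qed

lemma left_regular_cls:
  assumes f: "f \<in> L1_fun \<mu>" and h: "h \<in> L2_fun \<mu>"
  shows "left_regular \<mu> f (cls h) = cls (convolution \<mu> f h)"
proof -
  have eq: "cls (convolution \<mu> f h') = cls (convolution \<mu> f h)" if h': "h' \<in> cls h" for h'
  proof -
    have h'm: "h' \<in> L2_fun \<mu>" and ae: "AE x in \<mu>. h x = h' x" using h' by (auto simp: mem_cls h)
    have [measurable]: "f \<in> borel_measurable borel" "h \<in> borel_measurable borel" "h' \<in> borel_measurable borel"
      using f h h'm L1_measurable L2_measurable by auto
    have "convolution \<mu> f h' = convolution \<mu> f h"
    proof
      fix x
      have "AE y in \<mu>. h (- y + x) = h' (- y + x)" by (rule AE_uminus[OF AE_right[OF ae]])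
      then show "convolution \<mu> f h' x = convolution \<mu> f h x"
        unfolding convolution_def by (intro integral_cong_AE) auto
    qed
    then show ?thesis by simp
  qed
  have "(\<Union>h'\<in>cls h. cls (convolution \<mu> f h')) = cls (convolution \<mu> f h)"
    by (intro UN_const cls_ne h eq)
  then show ?thesis using cls_mem[OF h] by (simp add: left_regular_def cls_def)
qed

lemma bounded_opsI:
  assumes "T \<in> extensional (points (L2_space \<mu>))" "\<And>h. h \<in> L2_fun \<mu> \<Longrightarrow> T (cls h) = cls (S h)"
    and S: "\<And>h. h \<in> L2_fun \<mu> \<Longrightarrow> S h \<in> L2_fun \<mu>"
    and add: "\<And>h k l. h \<in> L2_fun \<mu> \<Longrightarrow> k \<in> L2_fun \<mu> \<Longrightarrow> l \<in> L2_fun \<mu> \<Longrightarrow>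
        ip2 \<mu> (S (\<lambda>x. h x + k x)) l = ip2 \<mu> (S h) l + ip2 \<mu> (S k) l"
    and scale: "\<And>h c l. h \<in> L2_fun \<mu> \<Longrightarrow> l \<in> L2_fun \<mu> \<Longrightarrow> ip2 \<mu> (S (\<lambda>x. c * h x)) l = c * ip2 \<mu> (S h) l"
    and bd: "\<And>h. h \<in> L2_fun \<mu> \<Longrightarrow> L2.nrm (S h) \<le> B * L2.nrm h"
  shows "T \<in> bounded_ops (L2_space \<mu>) (L2_space \<mu>)"
  unfolding bounded_ops_def
proof (intro CollectI conjI ballI allI)
  show "T \<in> points (L2_space \<mu>) \<rightarrow>\<^sub>E points (L2_space \<mu>)"
    using assms(1,2) S by (auto simp: PiE_def L2_points)
  show "\<exists>K. \<forall>x\<in>points (L2_space \<mu>). norm_of (L2_space \<mu>) (T x) \<le> K * norm_of (L2_space \<mu>) x"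
    using bd assms(2) S by (intro exI[of _ B]) (auto simp: L2_points L2_norm)
next
  fix H K assume "H \<in> points (L2_space \<mu>)" "K \<in> points (L2_space \<mu>)"
  then obtain h k where h: "h \<in> L2_fun \<mu>" "H = cls h" and k: "k \<in> L2_fun \<mu>" "K = cls k"
    by (auto simp: L2_points)
  have "cls (S (\<lambda>x. h x + k x)) = cls (\<lambda>x. S h x + S k x)"
    by (rule cls_eqI_ip) (auto simp: add h k S L2.add_mem L2.ip_add)
  then show "T (plus_of (L2_space \<mu>) H K) = plus_of (L2_space \<mu>) (T H) (T K)"
    using h k assms(2) S by (simp add: L2_plus L2.add_mem)
next
  fix c H assume "H \<in> points (L2_space \<mu>)"
  then obtain h where h: "h \<in> L2_fun \<mu>" "H = cls h" by (auto simp: L2_points)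
  have "cls (S (\<lambda>x. c * h x)) = cls (\<lambda>x. c * S h x)"
    by (rule cls_eqI_ip) (auto simp: scale h S L2.scale_mem L2.ip_scale)
  then show "T (scale_of (L2_space \<mu>) c H) = scale_of (L2_space \<mu>) c (T H)"
    using h assms(2) S by (simp add: L2_scale L2.scale_mem)
qed

lemma ip2_convolution_add:
  assumes f: "f \<in> L1_fun \<mu>" and h: "h \<in> L2_fun \<mu>" and k: "k \<in> L2_fun \<mu>" and l: "l \<in> L2_fun \<mu>"
  shows "ip2 \<mu> (convolution \<mu> f (\<lambda>x. h x + k x)) l = ip2 \<mu> (convolution \<mu> f h) l + ip2 \<mu> (convolution \<mu> f k) l"
proof -
  have i: "integrable \<mu> (\<lambda>y. f y * ip2 \<mu> (Lt y g) l)" if g: "g \<in> L2_fun \<mu>" for g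
    by (rule L1_bounded_integrable[OF f ip2_Lt_measurable[OF g l] ip2_Lt_bound[OF g l]])
  have "ip2 \<mu> (Lt y (\<lambda>x. h x + k x)) l = ip2 \<mu> (Lt y h) l + ip2 \<mu> (Lt y k) l" for y
    using L2.ip_add[OF Lt_mem[OF h] Lt_mem[OF k] l, of y y] by (simp add: Lt_def)
  then show ?thesis
    unfolding ip2_convolution[OF f L2.add_mem[OF h k] l] ip2_convolution[OF f h l] ip2_convolution[OF f k l]
    by (simp only: distrib_left Bochner_Integration.integral_add[OF i[OF h] i[OF k]])
qed

lemma ip2_convolution_scale:
  assumes f: "f \<in> L1_fun \<mu>" and h: "h \<in> L2_fun \<mu>" and l: "l \<in> L2_fun \<mu>"
  shows "ip2 \<mu> (convolution \<mu> f (\<lambda>x. c * h x)) l = c * ip2 \<mu> (convolution \<mu> f h) l"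
proof -
  have "ip2 \<mu> (Lt y (\<lambda>x. c * h x)) l = c * ip2 \<mu> (Lt y h) l" for y
    using L2.ip_scale[OF Lt_mem[OF h] l, of c y] by (simp add: Lt_def)
  then show ?thesis
    unfolding ip2_convolution[OF f L2.scale_mem[OF h] l] ip2_convolution[OF f h l]
    by (simp add: mult.left_commute)
qed

lemma left_regular_bounded:
  assumes f: "f \<in> L1_fun \<mu>"
  shows "left_regular \<mu> f \<in> bounded_ops (L2_space \<mu>) (L2_space \<mu>)"
proof (rule bounded_opsI[where S = "convolution \<mu> f" and B = "LINT x|\<mu>. cmod (f x)"])
  show "left_regular \<mu> f \<in> extensional (points (L2_space \<mu>))" by (simp add: left_regular_def)
qed (intro left_regular_cls convolution_L2 ip2_convolution_add ip2_convolution_scale nrm_convolution f; assumption)+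

text \<open>A representative of an element of \<open>L\<^sup>2\<close>.\<close>

definition rep :: "('g \<Rightarrow> complex) set \<Rightarrow> ('g \<Rightarrow> complex)" where
  "rep H = (SOME h. h \<in> H)"

lemma rep_cls:
  assumes h: "h \<in> L2_fun \<mu>"
  shows "rep (cls h) \<in> L2_fun \<mu>" "AE x in \<mu>. h x = rep (cls h) x"
proof -
  have "rep (cls h) \<in> cls h" unfolding rep_def by (rule someI[of "\<lambda>k. k \<in> cls h", OF cls_self[OF h]])
  then show "rep (cls h) \<in> L2_fun \<mu>" "AE x in \<mu>. h x = rep (cls h) x" by (auto simp: mem_cls h)
qed

lemma cls_rep: "h \<in> L2_fun \<mu> \<Longrightarrow> cls (rep (cls h)) = cls h"
  by (rule cls_eqI[symmetric]) (auto simp: rep_cls)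

lemma ip2_rep: "h \<in> L2_fun \<mu> \<Longrightarrow> k \<in> L2_fun \<mu> \<Longrightarrow> ip2 \<mu> (rep (cls h)) k = ip2 \<mu> h k"
  by (rule ip2_cong_AE[symmetric]) (auto simp: rep_cls)

abbreviation ops :: "(('g \<Rightarrow> complex) set \<Rightarrow> ('g \<Rightarrow> complex) set) set" where
  "ops \<equiv> bounded_ops (L2_space \<mu>) (L2_space \<mu>)"

text \<open>The bounded operators on \<open>L\<^sup>2\<close> as a normed space.\<close>

abbreviation Bop :: "(('g \<Rightarrow> complex) set \<Rightarrow> ('g \<Rightarrow> complex) set) cnormed" where
  "Bop \<equiv> op_space (L2_space \<mu>) (L2_space \<mu>)"

text \<open>The action of an operator on functions, by choice of representatives; it is linear up to null functions.\<close>

definition act :: "(('g \<Rightarrow> complex) set \<Rightarrow> ('g \<Rightarrow> complex) set) \<Rightarrow> ('g \<Rightarrow> complex) \<Rightarrow> ('g \<Rightarrow> complex)" where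
  "act T h = rep (T (cls h))"

lemma
  assumes T: "T \<in> ops" and h: "h \<in> L2_fun \<mu>"
  shows act_mem: "act T h \<in> L2_fun \<mu>" and act_cls: "T (cls h) = cls (act T h)"
proof -
  have "T (cls h) \<in> points (L2_space \<mu>)" using T cls_mem[OF h] by (auto simp: bounded_ops_def)
  then obtain k where k: "k \<in> L2_fun \<mu>" "T (cls h) = cls k" by (auto simp: L2_points)
  then show "act T h \<in> L2_fun \<mu>" "T (cls h) = cls (act T h)"
    by (simp_all add: act_def rep_cls cls_rep)
qed

lemma ip2_act:
  assumes "T (cls h) = cls k" "k \<in> L2_fun \<mu>" "l \<in> L2_fun \<mu>"
  shows "ip2 \<mu> (act T h) l = ip2 \<mu> k l"
  using assms by (simp add: act_def ip2_rep)

lemma nrm_act: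
  assumes T: "T \<in> ops" and h: "h \<in> L2_fun \<mu>"
  shows "L2.nrm (act T h) = norm_of (L2_space \<mu>) (T (cls h))"
  by (simp add: act_cls[OF T h] L2_norm act_mem[OF T h])

lemma act_add:
  assumes T: "T \<in> ops" and h: "h \<in> L2_fun \<mu>" and k: "k \<in> L2_fun \<mu>" and l: "l \<in> L2_fun \<mu>"
  shows "ip2 \<mu> (act T (\<lambda>x. h x + k x)) l = ip2 \<mu> (act T h) l + ip2 \<mu> (act T k) l"
proof -
  have "T (cls (\<lambda>x. h x + k x)) = cls (\<lambda>x. act T h x + act T k x)"
    using T cls_mem[OF h] cls_mem[OF k]
    by (simp add: L2_plus[OF h k, symmetric] L2_plus[OF act_mem[OF T h] act_mem[OF T k], symmetric]
        act_cls[OF T h, symmetric] act_cls[OF T k, symmetric] bounded_ops_def)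
  then show ?thesis
    using ip2_act[OF _ L2.add_mem[OF act_mem[OF T h] act_mem[OF T k]] l]
      L2.ip_add[OF act_mem[OF T h] act_mem[OF T k] l] by simp
qed

lemma act_scale:
  assumes T: "T \<in> ops" and h: "h \<in> L2_fun \<mu>" and l: "l \<in> L2_fun \<mu>"
  shows "ip2 \<mu> (act T (\<lambda>x. c * h x)) l = c * ip2 \<mu> (act T h) l"
proof -
  have "T (cls (\<lambda>x. c * h x)) = cls (\<lambda>x. c * act T h x)"
    using T cls_mem[OF h]
    by (simp add: L2_scale[OF h, symmetric] L2_scale[OF act_mem[OF T h], symmetric]
        act_cls[OF T h, symmetric] bounded_ops_def)
  then show ?thesis
    using ip2_act[OF _ L2.scale_mem[OF act_mem[OF T h]] l] L2.ip_scale[OF act_mem[OF T h] l] by simp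
qed

lemma act_bounded:
  assumes T: "T \<in> ops"
  shows "\<exists>K\<ge>0. \<forall>h\<in>L2_fun \<mu>. L2.nrm (act T h) \<le> K * L2.nrm h"
proof -
  obtain K where K: "\<And>H. H \<in> points (L2_space \<mu>) \<Longrightarrow> norm_of (L2_space \<mu>) (T H) \<le> K * norm_of (L2_space \<mu>) H"
    using T unfolding bounded_ops_def by blast
  have "L2.nrm (act T h) \<le> \<bar>K\<bar> * L2.nrm h" if h: "h \<in> L2_fun \<mu>" for h
    using K[OF cls_mem[OF h]] mult_right_mono[OF abs_ge_self[of K] L2.nrm_nonneg[OF h]]
    by (simp add: nrm_act[OF T h] L2_norm[OF h])
  then show ?thesis by (intro exI[of _ "\<bar>K\<bar>"]) auto
qed

lemma Bop_plus_cls: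
  assumes "T \<in> ops" "U \<in> ops" "h \<in> L2_fun \<mu>"
  shows "plus_of Bop T U (cls h) = cls (\<lambda>x. act T h x + act U h x)"
  using assms cls_mem[of h] by (simp add: op_space_def act_cls L2_plus act_mem)

lemma Bop_scale_cls:
  assumes "T \<in> ops" "h \<in> L2_fun \<mu>"
  shows "scale_of Bop c T (cls h) = cls (\<lambda>x. c * act T h x)"
  using assms cls_mem[of h] by (simp add: op_space_def act_cls L2_scale act_mem)

lemma ip2_act_plus:
  assumes T: "T \<in> ops" and U: "U \<in> ops" and h: "h \<in> L2_fun \<mu>" and l: "l \<in> L2_fun \<mu>"
  shows "ip2 \<mu> (act (plus_of Bop T U) h) l = ip2 \<mu> (act T h) l + ip2 \<mu> (act U h) l"
  unfolding act_def[of "plus_of Bop T U"] Bop_plus_cls[OF T U h]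
  by (simp add: ip2_rep L2.add_mem L2.ip_add act_mem T U h l)

lemma ip2_act_scale:
  assumes T: "T \<in> ops" and h: "h \<in> L2_fun \<mu>" and l: "l \<in> L2_fun \<mu>"
  shows "ip2 \<mu> (act (scale_of Bop c T) h) l = c * ip2 \<mu> (act T h) l"
  unfolding act_def[of "scale_of Bop c T"] Bop_scale_cls[OF T h]
  by (simp add: ip2_rep L2.scale_mem L2.ip_scale act_mem T h l)

lemma Bop_plus_mem:
  assumes T: "T \<in> ops" and U: "U \<in> ops"
  shows "plus_of Bop T U \<in> ops"
proof -
  obtain K1 K2 where K: "\<And>h. h \<in> L2_fun \<mu> \<Longrightarrow> L2.nrm (act T h) \<le> K1 * L2.nrm h"
      "\<And>h. h \<in> L2_fun \<mu> \<Longrightarrow> L2.nrm (act U h) \<le> K2 * L2.nrm h"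
    using act_bounded[OF T] act_bounded[OF U] by blast
  show ?thesis
  proof (rule bounded_opsI[where S = "\<lambda>h x. act T h x + act U h x" and B = "K1 + K2"])
    show "plus_of Bop T U \<in> extensional (points (L2_space \<mu>))" by (simp add: op_space_def)
    fix h assume h: "h \<in> L2_fun \<mu>"
    note m = act_mem[OF T h] act_mem[OF U h]
    show "plus_of Bop T U (cls h) = cls (\<lambda>x. act T h x + act U h x)" by (rule Bop_plus_cls[OF T U h])
    show "(\<lambda>x. act T h x + act U h x) \<in> L2_fun \<mu>" by (rule L2.add_mem[OF m])
    show "L2.nrm (\<lambda>x. act T h x + act U h x) \<le> (K1 + K2) * L2.nrm h"
      using L2.nrm_triangle[OF m] K[OF h] by (simp add: algebra_simps)
    fix l assume l: "l \<in> L2_fun \<mu>"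
    show "ip2 \<mu> (\<lambda>x. act T (\<lambda>x. c * h x) x + act U (\<lambda>x. c * h x) x) l = c * ip2 \<mu> (\<lambda>x. act T h x + act U h x) l" for c
      using act_mem[OF T L2.scale_mem[OF h, of c]] act_mem[OF U L2.scale_mem[OF h, of c]] m l h T U
      by (simp add: L2.ip_add act_scale algebra_simps)
    fix k assume k: "k \<in> L2_fun \<mu>"
    show "ip2 \<mu> (\<lambda>x. act T (\<lambda>x. h x + k x) x + act U (\<lambda>x. h x + k x) x) l =
        ip2 \<mu> (\<lambda>x. act T h x + act U h x) l + ip2 \<mu> (\<lambda>x. act T k x + act U k x) l" if "k \<in> L2_fun \<mu>" for k
      using act_mem[OF T L2.add_mem[OF h that]] act_mem[OF U L2.add_mem[OF h that]] m l h T U that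
      by (simp add: L2.ip_add act_add act_mem)
  qed
qed

lemma Bop_scale_mem:
  assumes T: "T \<in> ops"
  shows "scale_of Bop c T \<in> ops"
proof -
  obtain K where K: "\<And>h. h \<in> L2_fun \<mu> \<Longrightarrow> L2.nrm (act T h) \<le> K * L2.nrm h"
    using act_bounded[OF T] by blast
  show ?thesis
  proof (rule bounded_opsI[where S = "\<lambda>h x. c * act T h x" and B = "cmod c * K"])
    show "scale_of Bop c T \<in> extensional (points (L2_space \<mu>))" by (simp add: op_space_def)
    fix h assume h: "h \<in> L2_fun \<mu>"
    note m = act_mem[OF T h]
    show "scale_of Bop c T (cls h) = cls (\<lambda>x. c * act T h x)" by (rule Bop_scale_cls[OF T h])
    show "(\<lambda>x. c * act T h x) \<in> L2_fun \<mu>" by (rule L2.scale_mem[OF m])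
    show "L2.nrm (\<lambda>x. c * act T h x) \<le> cmod c * K * L2.nrm h"
      using K[OF h] by (simp add: L2.nrm_scale[OF m] mult_left_mono mult.assoc)
    fix l assume l: "l \<in> L2_fun \<mu>"
    show "ip2 \<mu> (\<lambda>x. c * act T (\<lambda>x. d * h x) x) l = d * ip2 \<mu> (\<lambda>x. c * act T h x) l" for d
      using act_mem[OF T L2.scale_mem[OF h, of d]] m l h T by (simp add: L2.ip_scale act_scale)
    show "ip2 \<mu> (\<lambda>x. c * act T (\<lambda>x. h x + k x) x) l = ip2 \<mu> (\<lambda>x. c * act T h x) l + ip2 \<mu> (\<lambda>x. c * act T k x) l"
      if "k \<in> L2_fun \<mu>" for k
      using act_mem[OF T L2.add_mem[OF h that]] m l h T that
      by (simp add: L2.ip_scale act_add act_mem algebra_simps)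
  qed
qed

lemma op_norm_upper:
  assumes T: "T \<in> ops" and h: "h \<in> L2_fun \<mu>" "L2.nrm h \<le> 1"
  shows "L2.nrm (act T h) \<le> norm_of Bop T"
proof -
  obtain K where K: "K \<ge> 0" "\<And>h. h \<in> L2_fun \<mu> \<Longrightarrow> L2.nrm (act T h) \<le> K * L2.nrm h"
    using act_bounded[OF T] by blast
  have "bdd_above {norm_of (L2_space \<mu>) (T H) | H. H \<in> points (L2_space \<mu>) \<and> norm_of (L2_space \<mu>) H \<le> 1}"
  proof (rule bdd_aboveI[of _ K], clarify)
    fix H assume H: "H \<in> points (L2_space \<mu>)" "norm_of (L2_space \<mu>) H \<le> 1"
    then obtain g where g: "g \<in> L2_fun \<mu>" "H = cls g" by (auto simp: L2_points)
    have "L2.nrm (act T g) \<le> K * 1"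
      using K(2)[OF g(1)] mult_left_mono[OF _ K(1), of "L2.nrm g" 1] H(2) by (simp add: g L2_norm)
    then show "norm_of (L2_space \<mu>) (T H) \<le> K" by (simp add: g nrm_act[OF T])
  qed
  then show ?thesis using h cls_mem[OF h(1)]
    by (auto simp: op_space_def L2_norm nrm_act[OF T] intro!: cSup_upper)
qed

lemma op_norm_le:
  assumes T: "T \<in> ops" and "\<And>h. h \<in> L2_fun \<mu> \<Longrightarrow> L2.nrm h \<le> 1 \<Longrightarrow> L2.nrm (act T h) \<le> C"
  shows "norm_of Bop T \<le> C"
proof -
  have z: "cls (\<lambda>x. 0) \<in> points (L2_space \<mu>) \<and> norm_of (L2_space \<mu>) (cls (\<lambda>x. 0)) \<le> 1"
    using L2.nrm_scale[OF L2.zero_mem, of 0] cls_mem[OF L2.zero_mem] by (simp add: L2_norm[OF L2.zero_mem])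
  have "Sup {norm_of (L2_space \<mu>) (T H) | H. H \<in> points (L2_space \<mu>) \<and> norm_of (L2_space \<mu>) H \<le> 1} \<le> C"
  proof (rule cSup_least)
    fix y assume "y \<in> {norm_of (L2_space \<mu>) (T H) | H. H \<in> points (L2_space \<mu>) \<and> norm_of (L2_space \<mu>) H \<le> 1}"
    then obtain h where "h \<in> L2_fun \<mu>" "L2.nrm h \<le> 1" "y = norm_of (L2_space \<mu>) (T (cls h))"
      by (auto simp: L2_points L2_norm)
    then show "y \<le> C" using assms(2) by (simp add: nrm_act[OF T])
  qed (use z in blast)
  then show ?thesis by (simp add: op_space_def)
qed

lemma nrm_act_diff:
  assumes T: "T \<in> ops" and U: "U \<in> ops" and h: "h \<in> L2_fun \<mu>"
  shows "L2.nrm (act (plus_of Bop T (scale_of Bop (- 1) U)) h) = L2.nrm (\<lambda>x. act T h x - act U h x)"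
proof (rule L2.nrm_cong)
  note V = Bop_scale_mem[OF U, of "- 1"]
  note m = act_mem[OF T h] act_mem[OF U h] act_mem[OF V h]
  fix l assume l: "l \<in> L2_fun \<mu>"
  have "ip2 \<mu> (act (plus_of Bop T (scale_of Bop (- 1) U)) h) l = ip2 \<mu> (act T h) l + - 1 * ip2 \<mu> (act U h) l"
    unfolding ip2_act_plus[OF T V h l] ip2_act_scale[OF U h l] ..
  also have "\<dots> = ip2 \<mu> (\<lambda>x. act T h x - act U h x) l" using L2.ip_diff[OF m(1,2) l, of 1] by simp
  finally show "ip2 \<mu> (act (plus_of Bop T (scale_of Bop (- 1) U)) h) l = ip2 \<mu> (\<lambda>x. act T h x - act U h x) l" .
qed (intro act_mem Bop_plus_mem Bop_scale_mem T U h L2.sub_mem)+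

lemma dist_upper:
  assumes "T \<in> ops" "U \<in> ops" "h \<in> L2_fun \<mu>" "L2.nrm h \<le> 1"
  shows "L2.nrm (\<lambda>x. act T h x - act U h x) \<le> dist_of Bop T U"
  using op_norm_upper[OF Bop_plus_mem[OF assms(1) Bop_scale_mem[OF assms(2)]] assms(3,4), of "- 1"]
  by (simp add: dist_of_def nrm_act_diff[OF assms(1-3)])

lemma dist_le:
  assumes T: "T \<in> ops" and U: "U \<in> ops"
    and "\<And>h. h \<in> L2_fun \<mu> \<Longrightarrow> L2.nrm h \<le> 1 \<Longrightarrow> L2.nrm (\<lambda>x. act T h x - act U h x) \<le> C"
  shows "dist_of Bop T U \<le> C"
  unfolding dist_of_def
  by (rule op_norm_le[OF Bop_plus_mem[OF T Bop_scale_mem[OF U]]]) (simp add: nrm_act_diff[OF T U] assms(3))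

lemma dist_plus:
  assumes ops: "T \<in> ops" "U \<in> ops" "T' \<in> ops" "U' \<in> ops"
  shows "dist_of Bop (plus_of Bop T U) (plus_of Bop T' U') \<le> dist_of Bop T T' + dist_of Bop U U'"
proof (rule dist_le)
  fix h assume h: "h \<in> L2_fun \<mu>" "L2.nrm h \<le> 1"
  note m = act_mem[OF ops(1) h(1)] act_mem[OF ops(2) h(1)] act_mem[OF ops(3) h(1)] act_mem[OF ops(4) h(1)]
  note p = Bop_plus_mem[OF ops(1,2)] Bop_plus_mem[OF ops(3,4)]
  have "L2.nrm (\<lambda>x. act (plus_of Bop T U) h x - act (plus_of Bop T' U') h x)
     = L2.nrm (\<lambda>x. (act T h x - act T' h x) + (act U h x - act U' h x))"
  proof (rule L2.nrm_cong)
    fix l assume l: "l \<in> L2_fun \<mu>"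
    have 1: "ip2 \<mu> (act (plus_of Bop T U) h) l = ip2 \<mu> (act T h) l + ip2 \<mu> (act U h) l"
      by (rule ip2_act_plus[OF ops(1,2) h(1) l])
    have 2: "ip2 \<mu> (act (plus_of Bop T' U') h) l = ip2 \<mu> (act T' h) l + ip2 \<mu> (act U' h) l"
      by (rule ip2_act_plus[OF ops(3,4) h(1) l])
    have d: "ip2 \<mu> (\<lambda>x. f x - g x) l = ip2 \<mu> f l - ip2 \<mu> g l" if "f \<in> L2_fun \<mu>" "g \<in> L2_fun \<mu>" for f g
      using L2.ip_diff[OF that l, of 1] by simp
    show "ip2 \<mu> (\<lambda>x. act (plus_of Bop T U) h x - act (plus_of Bop T' U') h x) l
      = ip2 \<mu> (\<lambda>x. (act T h x - act T' h x) + (act U h x - act U' h x)) l"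
      using p m l h by (simp add: d L2.ip_add L2.sub_mem act_mem 1 2)
  qed (intro act_mem p h L2.sub_mem L2.add_mem m)+
  also have "\<dots> \<le> L2.nrm (\<lambda>x. act T h x - act T' h x) + L2.nrm (\<lambda>x. act U h x - act U' h x)"
    by (intro L2.nrm_triangle L2.sub_mem m)
  also have "\<dots> \<le> dist_of Bop T T' + dist_of Bop U U'"
    by (intro add_mono dist_upper ops h)
  finally show "L2.nrm (\<lambda>x. act (plus_of Bop T U) h x - act (plus_of Bop T' U') h x) \<le> dist_of Bop T T' + dist_of Bop U U'" .
qed (intro Bop_plus_mem ops)+

lemma dist_scale:
  assumes ops: "T \<in> ops" "T' \<in> ops"
  shows "dist_of Bop (scale_of Bop c T) (scale_of Bop c T') \<le> cmod c * dist_of Bop T T'"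
proof (rule dist_le)
  fix h assume h: "h \<in> L2_fun \<mu>" "L2.nrm h \<le> 1"
  note m = act_mem[OF ops(1) h(1)] act_mem[OF ops(2) h(1)]
  note p = Bop_scale_mem[OF ops(1), of c] Bop_scale_mem[OF ops(2), of c]
  have "L2.nrm (\<lambda>x. act (scale_of Bop c T) h x - act (scale_of Bop c T') h x) = L2.nrm (\<lambda>x. c * (act T h x - act T' h x))"
  proof (rule L2.nrm_cong)
    fix l assume l: "l \<in> L2_fun \<mu>"
    have 1: "ip2 \<mu> (act (scale_of Bop c T) h) l = c * ip2 \<mu> (act T h) l"
      by (rule ip2_act_scale[OF ops(1) h(1) l])
    have 2: "ip2 \<mu> (act (scale_of Bop c T') h) l = c * ip2 \<mu> (act T' h) l"
      by (rule ip2_act_scale[OF ops(2) h(1) l])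
    have d: "ip2 \<mu> (\<lambda>x. f x - g x) l = ip2 \<mu> f l - ip2 \<mu> g l" if "f \<in> L2_fun \<mu>" "g \<in> L2_fun \<mu>" for f g
      using L2.ip_diff[OF that l, of 1] by simp
    show "ip2 \<mu> (\<lambda>x. act (scale_of Bop c T) h x - act (scale_of Bop c T') h x) l = ip2 \<mu> (\<lambda>x. c * (act T h x - act T' h x)) l"
      unfolding L2.ip_scale[OF L2.sub_mem[OF m] l]
      using p l h by (simp add: d m act_mem 1 2 right_diff_distrib)
  qed (intro act_mem p h L2.sub_mem L2.scale_mem m)+
  also have "\<dots> = cmod c * L2.nrm (\<lambda>x. act T h x - act T' h x)" by (rule L2.nrm_scale[OF L2.sub_mem[OF m]])
  also have "\<dots> \<le> cmod c * dist_of Bop T T'" by (intro mult_left_mono dist_upper ops h) simp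
  finally show "L2.nrm (\<lambda>x. act (scale_of Bop c T) h x - act (scale_of Bop c T') h x) \<le> cmod c * dist_of Bop T T'" .
qed (intro Bop_scale_mem ops)+

lemma ip2_convolution_add_left:
  assumes f: "f \<in> L1_fun \<mu>" and g: "g \<in> L1_fun \<mu>" and h: "h \<in> L2_fun \<mu>" and l: "l \<in> L2_fun \<mu>"
  shows "ip2 \<mu> (convolution \<mu> (\<lambda>x. f x + c * g x) h) l = ip2 \<mu> (convolution \<mu> f h) l + c * ip2 \<mu> (convolution \<mu> g h) l"
proof -
  have fg: "(\<lambda>x. f x + c * g x) \<in> L1_fun \<mu>" using f g by (auto simp: L1_fun_def)
  have i: "integrable \<mu> (\<lambda>y. f y * ip2 \<mu> (Lt y h) l)" if "f \<in> L1_fun \<mu>" for f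
    by (rule L1_bounded_integrable[OF that ip2_Lt_measurable[OF h l] ip2_Lt_bound[OF h l]])
  have "(LINT y|\<mu>. (f y + c * g y) * ip2 \<mu> (Lt y h) l) =
      (LINT y|\<mu>. f y * ip2 \<mu> (Lt y h) l + c * (g y * ip2 \<mu> (Lt y h) l))"
    by (simp add: algebra_simps)
  also have "\<dots> = (LINT y|\<mu>. f y * ip2 \<mu> (Lt y h) l) + c * (LINT y|\<mu>. g y * ip2 \<mu> (Lt y h) l)"
    using i[OF f] i[OF g] by simp
  finally show ?thesis unfolding ip2_convolution[OF fg h l] ip2_convolution[OF f h l] ip2_convolution[OF g h l] .
qed

lemma left_regular_eqI:
  assumes f: "f \<in> L1_fun \<mu>" and T: "T \<in> ops"
    and "\<And>h l. h \<in> L2_fun \<mu> \<Longrightarrow> l \<in> L2_fun \<mu> \<Longrightarrow> ip2 \<mu> (convolution \<mu> f h) l = ip2 \<mu> (act T h) l"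
  shows "left_regular \<mu> f = T"
proof
  fix H
  show "left_regular \<mu> f H = T H"
  proof (cases "H \<in> points (L2_space \<mu>)")
    case True
    then obtain h where h: "h \<in> L2_fun \<mu>" "H = cls h" by (auto simp: L2_points)
    show ?thesis
      unfolding h(2) left_regular_cls[OF f h(1)] act_cls[OF T h(1)]
      by (rule cls_eqI_ip) (auto simp: assms(3) h convolution_L2 f act_mem T)
  next
    case False
    then show ?thesis using T by (auto simp: left_regular_def bounded_ops_def PiE_def extensional_def)
  qed
qed

lemma ip2_act_left_regular:
  assumes f: "f \<in> L1_fun \<mu>" and h: "h \<in> L2_fun \<mu>" and l: "l \<in> L2_fun \<mu>"
  shows "ip2 \<mu> (act (left_regular \<mu> f) h) l = ip2 \<mu> (convolution \<mu> f h) l"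
  unfolding act_def left_regular_cls[OF f h] by (rule ip2_rep[OF convolution_L2[OF f h] l])

lemma left_regular_add:
  assumes f: "f \<in> L1_fun \<mu>" and g: "g \<in> L1_fun \<mu>"
  shows "left_regular \<mu> (\<lambda>x. f x + g x) = plus_of Bop (left_regular \<mu> f) (left_regular \<mu> g)"
proof (rule left_regular_eqI)
  show "(\<lambda>x. f x + g x) \<in> L1_fun \<mu>" using f g by (auto simp: L1_fun_def)
  note b = left_regular_bounded[OF f] left_regular_bounded[OF g]
  show "plus_of Bop (left_regular \<mu> f) (left_regular \<mu> g) \<in> ops" by (rule Bop_plus_mem[OF b])
  fix h l assume h: "h \<in> L2_fun \<mu>" and l: "l \<in> L2_fun \<mu>"
  note m = act_mem[OF b(1) h] act_mem[OF b(2) h]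
  show "ip2 \<mu> (convolution \<mu> (\<lambda>x. f x + g x) h) l = ip2 \<mu> (act (plus_of Bop (left_regular \<mu> f) (left_regular \<mu> g)) h) l"
    using ip2_act_plus[OF b h l]
      ip2_convolution_add_left[OF f g h l, of 1] ip2_act_left_regular[OF f h l] ip2_act_left_regular[OF g h l] by simp
qed

lemma left_regular_scale:
  assumes f: "f \<in> L1_fun \<mu>"
  shows "left_regular \<mu> (\<lambda>x. c * f x) = scale_of Bop c (left_regular \<mu> f)"
proof (rule left_regular_eqI)
  show cf: "(\<lambda>x. c * f x) \<in> L1_fun \<mu>" using f by (auto simp: L1_fun_def)
  note b = left_regular_bounded[OF f]
  show "scale_of Bop c (left_regular \<mu> f) \<in> ops" by (rule Bop_scale_mem[OF b])
  fix h l assume h: "h \<in> L2_fun \<mu>" and l: "l \<in> L2_fun \<mu>"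
  note m = act_mem[OF b h]
  have "ip2 \<mu> (convolution \<mu> (\<lambda>x. c * f x) h) l = c * ip2 \<mu> (convolution \<mu> f h) l"
    unfolding ip2_convolution[OF cf h l] ip2_convolution[OF f h l] by (simp add: mult.assoc)
  then show "ip2 \<mu> (convolution \<mu> (\<lambda>x. c * f x) h) l = ip2 \<mu> (act (scale_of Bop c (left_regular \<mu> f)) h) l"
    using ip2_act_scale[OF b h l] ip2_act_left_regular[OF f h l] by simp
qed

lemma reduced_cstar_simps:
  "plus_of (reduced_cstar \<mu>) = plus_of Bop"
  "scale_of (reduced_cstar \<mu>) = scale_of Bop"
  "norm_of (reduced_cstar \<mu>) = norm_of Bop"
  "points (reduced_cstar \<mu>) = norm_closure_of Bop (left_regular \<mu> ` L1_fun \<mu>)"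
  by (simp_all add: reduced_cstar_def Let_def)

lemma reduced_cstar_iff:
  "T \<in> points (reduced_cstar \<mu>) \<longleftrightarrow> T \<in> ops \<and> (\<forall>e>0. \<exists>f\<in>L1_fun \<mu>. dist_of Bop T (left_regular \<mu> f) < e)"
proof -
  have "points Bop = ops" by (simp add: op_space_def)
  then show ?thesis by (simp add: reduced_cstar_simps norm_closure_of_def)
qed

lemma left_regular_mem:
  assumes f: "f \<in> L1_fun \<mu>"
  shows "left_regular \<mu> f \<in> points (reduced_cstar \<mu>)"
proof -
  note b = left_regular_bounded[OF f]
  have "dist_of Bop (left_regular \<mu> f) (left_regular \<mu> f) \<le> 0"
    using L2.nrm_scale[OF L2.zero_mem, of 0] by (intro dist_le[OF b b]) simp
  then show ?thesis unfolding reduced_cstar_iff using b f by (auto intro!: bexI[of _ f] simp: order_le_less_trans)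
qed

text \<open>The carrier is closed under the operations.  This matters because a functional in the dual is \<open>undefined\<close> off the
  carrier, so that additivity could fail for sums that leave it.\<close>

lemma reduced_cstar_plus:
  assumes T: "T \<in> points (reduced_cstar \<mu>)" and U: "U \<in> points (reduced_cstar \<mu>)"
  shows "plus_of Bop T U \<in> points (reduced_cstar \<mu>)"
  unfolding reduced_cstar_iff
proof (intro conjI allI impI)
  have o: "T \<in> ops" "U \<in> ops" using T U by (auto simp: reduced_cstar_iff)
  then show "plus_of Bop T U \<in> ops" by (rule Bop_plus_mem)
  fix e :: real assume "e > 0"
  then have "e / 2 > 0" by simp
  then obtain f g where f: "f \<in> L1_fun \<mu>" "dist_of Bop T (left_regular \<mu> f) < e / 2"
    and g: "g \<in> L1_fun \<mu>" "dist_of Bop U (left_regular \<mu> g) < e / 2"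
    using T U unfolding reduced_cstar_iff by meson
  have "dist_of Bop (plus_of Bop T U) (left_regular \<mu> (\<lambda>x. f x + g x)) < e"
    using dist_plus[OF o left_regular_bounded[OF f(1)] left_regular_bounded[OF g(1)]] f g
    by (simp add: left_regular_add)
  moreover have "(\<lambda>x. f x + g x) \<in> L1_fun \<mu>" using f g by (auto simp: L1_fun_def)
  ultimately show "\<exists>f\<in>L1_fun \<mu>. dist_of Bop (plus_of Bop T U) (left_regular \<mu> f) < e" by blast
qed

lemma reduced_cstar_scale:
  assumes T: "T \<in> points (reduced_cstar \<mu>)"
  shows "scale_of Bop c T \<in> points (reduced_cstar \<mu>)"
  unfolding reduced_cstar_iff
proof (intro conjI allI impI)
  have o: "T \<in> ops" using T by (auto simp: reduced_cstar_iff)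
  then show "scale_of Bop c T \<in> ops" by (rule Bop_scale_mem)
  fix e :: real assume e: "e > 0"
  define d where "d = e / (cmod c + 1)"
  have c1: "0 < cmod c + 1" using norm_ge_zero[of c] by linarith
  then have d: "d > 0" using e by (simp add: d_def)
  obtain f where f: "f \<in> L1_fun \<mu>" "dist_of Bop T (left_regular \<mu> f) < d"
    using T d unfolding reduced_cstar_iff by meson
  have "dist_of Bop (scale_of Bop c T) (left_regular \<mu> (\<lambda>x. c * f x)) \<le> cmod c * dist_of Bop T (left_regular \<mu> f)"
    using dist_scale[OF o left_regular_bounded[OF f(1)]] by (simp add: left_regular_scale[OF f(1)])
  also have "\<dots> \<le> cmod c * d" using f(2) by (intro mult_left_mono) auto
  also have "\<dots> < (cmod c + 1) * d" using d by simp
  also have "\<dots> = e" using c1 by (simp add: d_def)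
  finally have "dist_of Bop (scale_of Bop c T) (left_regular \<mu> (\<lambda>x. c * f x)) < e" .
  moreover have "(\<lambda>x. c * f x) \<in> L1_fun \<mu>" using f by (auto simp: L1_fun_def)
  ultimately show "\<exists>f\<in>L1_fun \<mu>. dist_of Bop (scale_of Bop c T) (left_regular \<mu> f) < e" by blast
qed

text \<open>The functional \<open>T \<mapsto> \<langle>T \<xi>, \<xi>\<rangle>\<close> on the reduced C*-algebra.\<close>

definition vector_state :: "('g \<Rightarrow> complex) \<Rightarrow> (('g \<Rightarrow> complex) set \<Rightarrow> ('g \<Rightarrow> complex) set) \<Rightarrow> complex" where
  "vector_state \<xi> = restrict (\<lambda>T. ip2 \<mu> (act T \<xi>) \<xi>) (points (reduced_cstar \<mu>))"

lemma vector_state_mem: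
  assumes \<xi>: "\<xi> \<in> L2_fun \<mu>" and n: "L2.nrm \<xi> = 1"
  shows "vector_state \<xi> \<in> unit_dual (reduced_cstar \<mu>)"
  unfolding unit_dual_def reduced_cstar_simps(1-3)
proof (intro CollectI conjI ballI allI)
  show "vector_state \<xi> \<in> points (reduced_cstar \<mu>) \<rightarrow>\<^sub>E UNIV" by (simp add: vector_state_def)
  fix T assume T: "T \<in> points (reduced_cstar \<mu>)"
  then have To: "T \<in> ops" by (simp add: reduced_cstar_iff)
  note m = act_mem[OF To \<xi>]
  have "cmod (ip2 \<mu> (act T \<xi>) \<xi>) \<le> norm_of Bop T * 1"
    using L2.Cauchy_Schwarz[OF m \<xi>] op_norm_upper[OF To \<xi>] n by simp
  then show "cmod (vector_state \<xi> T) \<le> norm_of Bop T" using T by (simp add: vector_state_def)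
  show "vector_state \<xi> (scale_of Bop c T) = c * vector_state \<xi> T" for c
    using T reduced_cstar_scale[OF T] ip2_act_scale[OF To \<xi> \<xi>]
    by (simp add: vector_state_def)
  fix U assume U: "U \<in> points (reduced_cstar \<mu>)"
  then have Uo: "U \<in> ops" by (simp add: reduced_cstar_iff)
  note m' = act_mem[OF Uo \<xi>]
  show "vector_state \<xi> (plus_of Bop T U) = vector_state \<xi> T + vector_state \<xi> U"
    using T U reduced_cstar_plus[OF T U] ip2_act_plus[OF To Uo \<xi> \<xi>]
    by (simp add: vector_state_def)
qed

end

context averaging
begin

text \<open>The convolution powers of \<open>\<Phi>\<close>; the operator of \<open>G n\<close> is \<open>b\<^bsup>n+1\<^esup>\<close>.\<close>

primrec G :: "nat \<Rightarrow> 'a \<Rightarrow> complex" where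
  "G 0 = (\<lambda>x. of_real (\<Phi> x))"
| "G (Suc n) = convolution \<mu> (\<lambda>x. of_real (\<Phi> x)) (G n)"

lemma G_L1: "G n \<in> L1_fun \<mu>"
  by (induction n) (auto intro: \<Phi>_L1 convolution_L1)

lemma G_power:
  assumes h: "h \<in> L2_fun \<mu>" and l: "l \<in> L2_fun \<mu>"
  shows "ip2 \<mu> (convolution \<mu> (G n) h) l = ip2 \<mu> ((b ^^ Suc n) h) l"
  using l
proof (induction n arbitrary: l)
  case 0
  then show ?case by (simp add: b_def)
next
  case (Suc n)
  have "ip2 \<mu> (convolution \<mu> (G (Suc n)) h) l = ip2 \<mu> (b (convolution \<mu> (G n) h)) l"
    unfolding b_def G.simps by (rule ip2_convolution_assoc[OF \<Phi>_L1 G_L1 h Suc.prems])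
  also have "\<dots> = ip2 \<mu> (convolution \<mu> (G n) h) (b l)"
    by (rule O.b_sa[OF convolution_L2[OF G_L1 h] Suc.prems])
  also have "\<dots> = ip2 \<mu> ((b ^^ Suc n) h) (b l)" by (rule Suc.IH[OF O.b_mem[OF Suc.prems]])
  also have "\<dots> = ip2 \<mu> (b ((b ^^ Suc n) h)) l" by (rule O.b_sa[OF O.funpow_mem[OF h] Suc.prems, symmetric])
  finally show ?case by simp
qed

text \<open>The convolution kernel of the operator \<open>b p(b)\<close>.\<close>

definition kernel :: "complex poly \<Rightarrow> 'a \<Rightarrow> complex" where
  "kernel p x = (\<Sum>k\<le>degree p. coeff p k * G k x)"

lemma kernel_eq: "degree p \<le> n \<Longrightarrow> kernel p x = (\<Sum>k\<le>n. coeff p k * G k x)"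
  unfolding kernel_def by (intro sum.mono_neutral_left) (auto simp: coeff_eq_0)

lemma kernel_L1: "kernel p \<in> L1_fun \<mu>"
  using G_L1 unfolding L1_fun_def kernel_def[abs_def] by auto

lemma kernel_add: "kernel (p + q) = (\<lambda>x. kernel p x + kernel q x)"
proof
  fix x
  show "kernel (p + q) x = kernel p x + kernel q x"
    by (simp add: kernel_eq[where n = "max (degree p) (degree q)"] degree_add_le sum.distrib algebra_simps)
qed

lemma kernel_smult: "kernel (smult c p) = (\<lambda>x. c * kernel p x)"
  by (rule ext) (simp add: kernel_eq[where n = "degree p"] degree_smult_le sum_distrib_left mult.assoc)

lemma ip2_convolution_sum:
  assumes h: "h \<in> L2_fun \<mu>" and l: "l \<in> L2_fun \<mu>"
  shows "ip2 \<mu> (convolution \<mu> (\<lambda>x. \<Sum>k\<le>n. c k * G k x) h) l = (\<Sum>k\<le>n. c k * ip2 \<mu> (convolution \<mu> (G k) h) l)"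
proof -
  have L1: "(\<lambda>x. \<Sum>k\<le>n. c k * G k x) \<in> L1_fun \<mu>"
    using G_L1 unfolding L1_fun_def by auto
  have i: "integrable \<mu> (\<lambda>y. G k y * ip2 \<mu> (Lt y h) l)" for k
    by (rule L1_bounded_integrable[OF G_L1 ip2_Lt_measurable[OF h l] ip2_Lt_bound[OF h l]])
  show ?thesis
    unfolding ip2_convolution[OF L1 h l] ip2_convolution[OF G_L1 h l] sum_distrib_right mult.assoc
    using i by (subst Bochner_Integration.integral_sum) auto
qed

lemma ip2_kernel:
  assumes h: "h \<in> L2_fun \<mu>" and l: "l \<in> L2_fun \<mu>"
  shows "ip2 \<mu> (convolution \<mu> (kernel p) h) l = ip2 \<mu> (O.polyop (pCons 0 p) h) l"
proof -
  have "ip2 \<mu> (convolution \<mu> (kernel p) h) l = (\<Sum>k\<le>degree p. coeff p k * ip2 \<mu> ((b ^^ Suc k) h) l)"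
    unfolding kernel_def[abs_def] ip2_convolution_sum[OF h l] G_power[OF h l] ..
  also have "\<dots> = (\<Sum>k\<le>degree p. coeff p k * ip2 \<mu> ((b ^^ k) h) (b l))"
    using O.b_sa[OF O.funpow_mem[OF h] l] by simp
  also have "\<dots> = ip2 \<mu> (O.polyop (pCons 0 p) h) l"
    using O.ip_polyop_pCons[OF h l, of 0 p] O.ip_polyop[OF h O.b_mem[OF l] order_refl, of p] by simp
  finally show ?thesis .
qed

sublocale R: poly_repr "reduced_cstar \<mu>" "\<lambda>p. left_regular \<mu> (kernel p)" "Sup O.aspec"
proof
  fix p q :: "complex poly" and c :: complex
  show "left_regular \<mu> (kernel p) \<in> points (reduced_cstar \<mu>)" by (rule left_regular_mem[OF kernel_L1])
  show "left_regular \<mu> (kernel (p + q)) = plus_of (reduced_cstar \<mu>) (left_regular \<mu> (kernel p)) (left_regular \<mu> (kernel q))"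
    unfolding kernel_add reduced_cstar_simps by (rule left_regular_add[OF kernel_L1 kernel_L1])
  show "left_regular \<mu> (kernel (smult c p)) = scale_of (reduced_cstar \<mu>) c (left_regular \<mu> (kernel p))"
    unfolding kernel_smult reduced_cstar_simps by (rule left_regular_scale[OF kernel_L1])
  show "0 \<le> Sup O.aspec" using Sup_aspec_pos by simp
  fix C assume C: "\<And>t. 0 \<le> t \<Longrightarrow> t \<le> Sup O.aspec \<Longrightarrow> cmod (of_real t * poly p (of_real t)) \<le> C"
  have C0: "0 \<le> C" using C[of 0] Sup_aspec_pos by simp
  show "norm_of (reduced_cstar \<mu>) (left_regular \<mu> (kernel p)) \<le> C"
    unfolding reduced_cstar_simps
  proof (rule op_norm_le[OF left_regular_bounded[OF kernel_L1]])
    fix h assume h: "h \<in> L2_fun \<mu>" "L2.nrm h \<le> 1"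
    have "L2.nrm (act (left_regular \<mu> (kernel p)) h) = L2.nrm (O.polyop (pCons 0 p) h)"
    proof (rule L2.nrm_cong)
      fix l assume l: "l \<in> L2_fun \<mu>"
      show "ip2 \<mu> (act (left_regular \<mu> (kernel p)) h) l = ip2 \<mu> (O.polyop (pCons 0 p) h) l"
        unfolding ip2_act_left_regular[OF kernel_L1 h(1) l] by (rule ip2_kernel[OF h(1) l])
    qed (intro act_mem left_regular_bounded kernel_L1 h O.polyop_mem)+
    also have "\<dots> \<le> C * L2.nrm h"
    proof (rule O.polyop_le_spectral[OF C0 _ h(1)])
      fix t assume t: "t \<in> O.aspec"
      show "cmod (poly (pCons 0 p) (of_real t)) \<le> C"
        using C[OF O.aspec_nonneg[OF t] aspec_le_Sup[OF t]] by simp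
    qed
    also have "\<dots> \<le> C" using h(2) C0 by (simp add: mult_left_le)
    finally show "L2.nrm (act (left_regular \<mu> (kernel p)) h) \<le> C" .
  qed
qed

text \<open>Vector states of normalised approximate eigenvectors.\<close>

lemma approximate_states:
  assumes t: "t \<in> O.aspec"
  shows "\<exists>\<phi>. (\<forall>j. \<phi> j \<in> unit_dual (reduced_cstar \<mu>)) \<and>
    (\<forall>p. (\<lambda>j::nat. \<phi> j (left_regular \<mu> (kernel p))) \<longlonglongrightarrow> of_real t * poly p (of_real t))"
proof -
  have "\<exists>\<xi>. \<xi> \<in> L2_fun \<mu> \<and> L2.nrm \<xi> = 1 \<and> L2.nrm (\<lambda>x. b \<xi> x - of_real t * \<xi> x) \<le> 1 / Suc j" for j
  proof -
    have "(0::real) < 1 / Suc j" by simp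
    then obtain h where h: "h \<in> L2_fun \<mu>" and hl: "L2.nrm (\<lambda>x. b h x - of_real t * h x) < 1 / Suc j * L2.nrm h"
      using t unfolding O.aspec_def by blast
    have hp: "0 < L2.nrm h"
    proof -
      have "0 < 1 / Suc j * L2.nrm h"
        using hl L2.nrm_nonneg[OF L2.diff_mem[OF O.b_mem[OF h] h, of "of_real t"]] by linarith
      then show ?thesis by (simp add: zero_less_divide_iff)
    qed
    define c where "c = complex_of_real (1 / L2.nrm h)"
    have c: "cmod c = 1 / L2.nrm h" using hp unfolding c_def norm_of_real by simp
    let ?\<xi> = "\<lambda>x. c * h x"
    have \<xi>: "?\<xi> \<in> L2_fun \<mu>" by (rule L2.scale_mem[OF h])
    have "L2.nrm (\<lambda>x. b ?\<xi> x - of_real t * ?\<xi> x) = L2.nrm (\<lambda>x. c * (b h x - of_real t * h x))"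
    proof (rule L2.nrm_cong)
      fix l assume l: "l \<in> L2_fun \<mu>"
      have "ip2 \<mu> (b ?\<xi>) l = c * ip2 \<mu> (b h) l"
        using O.b_sa[OF \<xi> l] O.b_sa[OF h l] L2.ip_scale[OF h O.b_mem[OF l], of c] by simp
      then show "ip2 \<mu> (\<lambda>x. b ?\<xi> x - of_real t * ?\<xi> x) l = ip2 \<mu> (\<lambda>x. c * (b h x - of_real t * h x)) l"
        unfolding L2.ip_diff[OF O.b_mem[OF \<xi>] \<xi> l] L2.ip_scale[OF L2.diff_mem[OF O.b_mem[OF h] h] l]
          L2.ip_diff[OF O.b_mem[OF h] h l] L2.ip_scale[OF h l]
        by (simp add: algebra_simps)
    qed (intro L2.diff_mem L2.scale_mem O.b_mem h)+
    also have "\<dots> = L2.nrm (\<lambda>x. b h x - of_real t * h x) / L2.nrm h"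
      unfolding L2.nrm_scale[OF L2.diff_mem[OF O.b_mem[OF h] h]] c by simp
    also have "\<dots> \<le> 1 / Suc j" using hl hp by (simp add: divide_le_eq)
    finally have "L2.nrm (\<lambda>x. b ?\<xi> x - of_real t * ?\<xi> x) \<le> 1 / Suc j" .
    moreover have "L2.nrm ?\<xi> = 1" using hp by (simp add: L2.nrm_scale[OF h] c)
    ultimately show ?thesis using \<xi> by blast
  qed
  then have "\<forall>j. \<exists>\<xi>. \<xi> \<in> L2_fun \<mu> \<and> L2.nrm \<xi> = 1 \<and> L2.nrm (\<lambda>x. b \<xi> x - of_real t * \<xi> x) \<le> 1 / Suc j" by blast
  from choice[OF this] obtain \<xi> where \<xi>: "\<And>j. \<xi> j \<in> L2_fun \<mu>" "\<And>j. L2.nrm (\<xi> j) = 1"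
    "\<And>j. L2.nrm (\<lambda>x. b (\<xi> j) x - of_real t * \<xi> j x) \<le> 1 / Suc j" by blast
  have "(\<lambda>j. vector_state (\<xi> j) (left_regular \<mu> (kernel p))) \<longlonglongrightarrow> of_real t * poly p (of_real t)" for p
  proof -
    let ?p = "pCons 0 p" and ?z = "complex_of_real t"
    obtain C where C: "C \<ge> 0" "\<And>h. h \<in> L2_fun \<mu> \<Longrightarrow>
        L2.nrm (\<lambda>x. O.polyop ?p h x - poly ?p ?z * h x) \<le> C * L2.nrm (\<lambda>x. b h x - ?z * h x)"
      using O.polyop_near_eigenvector[of ?p ?z] by blast
    have le: "cmod (vector_state (\<xi> j) (left_regular \<mu> (kernel p)) - poly ?p ?z) \<le> C * (1 / Suc j)" for j
    proof -
      have d: "(\<lambda>x. O.polyop ?p (\<xi> j) x - poly ?p ?z * \<xi> j x) \<in> L2_fun \<mu>"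
        by (intro L2.diff_mem O.polyop_mem \<xi>)
      have "vector_state (\<xi> j) (left_regular \<mu> (kernel p)) = ip2 \<mu> (O.polyop ?p (\<xi> j)) (\<xi> j)"
        using left_regular_mem[OF kernel_L1, of p] ip2_kernel[OF \<xi>(1,1), of p j j]
        by (simp add: vector_state_def ip2_act_left_regular[OF kernel_L1 \<xi>(1) \<xi>(1)])
      then have "vector_state (\<xi> j) (left_regular \<mu> (kernel p)) - poly ?p ?z
          = ip2 \<mu> (\<lambda>x. O.polyop ?p (\<xi> j) x - poly ?p ?z * \<xi> j x) (\<xi> j)"
        using L2.ip_self[OF \<xi>(1), of j] \<xi>(2)[of j]
        by (simp add: L2.ip_diff[OF O.polyop_mem[OF \<xi>(1)] \<xi>(1) \<xi>(1)])
      also have "cmod \<dots> \<le> L2.nrm (\<lambda>x. O.polyop ?p (\<xi> j) x - poly ?p ?z * \<xi> j x) * 1"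
        using L2.Cauchy_Schwarz[OF d \<xi>(1)[of j]] \<xi>(2)[of j] by simp
      also have "\<dots> \<le> C * (1 / Suc j)"
        using C(2)[OF \<xi>(1)[of j]] mult_left_mono[OF \<xi>(3)[of j] C(1)] by linarith
      finally show ?thesis .
    qed
    have "(\<lambda>j. 1 / real (Suc j)) \<longlonglongrightarrow> 0"
      using LIMSEQ_inverse_real_of_nat by (simp add: inverse_eq_divide)
    then have "(\<lambda>j. C * (1 / real (Suc j))) \<longlonglongrightarrow> 0" by (rule tendsto_mult_right_zero)
    then have "(\<lambda>j. vector_state (\<xi> j) (left_regular \<mu> (kernel p)) - poly ?p ?z) \<longlonglongrightarrow> 0"
      by (rule Lim_null_comparison[OF always_eventually[OF allI[OF le]]])
    then show ?thesis by (simp add: LIM_zero_iff)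
  qed
  then show ?thesis using vector_state_mem[OF \<xi>(1,2)] by (intro exI[of _ "\<lambda>j. vector_state (\<xi> j)"]) blast
qed

theorem fpp_imp_finite:
  assumes fpp: "dual_has_weak_star_fpp (reduced_cstar \<mu>)"
  shows "emeasure \<mu> UNIV < \<infinity>"
proof (rule ccontr)
  assume inf: "\<not> emeasure \<mu> UNIV < \<infinity>"
  let ?r = "Sup O.aspec"
  have dense: "\<exists>t\<in>O.aspec. s < t \<and> t < ?r" if "s < ?r" for s
  proof (rule ccontr)
    assume "\<not> (\<exists>t\<in>O.aspec. s < t \<and> t < ?r)"
    then have "emeasure \<mu> UNIV < \<infinity>" using that by (intro gap_imp_finite[of "?r - s"]) auto
    then show False using inf by blast
  qed
  have "\<exists>f. \<forall>n::nat. (f n \<in> O.aspec \<and> 0 < f n \<and> f n < ?r) \<and> f n < f (Suc n)"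
  proof (rule dependent_nat_choice)
    show "\<exists>x. x \<in> O.aspec \<and> 0 < x \<and> x < ?r" using dense[OF Sup_aspec_pos] by blast
    fix x :: real and n :: nat assume "x \<in> O.aspec \<and> 0 < x \<and> x < ?r"
    then show "\<exists>y. (y \<in> O.aspec \<and> 0 < y \<and> y < ?r) \<and> x < y" using dense[of x] by fastforce
  qed
  then obtain lam where lam: "\<And>n::nat. lam n \<in> O.aspec" "\<And>n. 0 < lam n" "\<And>n. lam n < ?r" "\<And>n. lam n < lam (Suc n)"
    by blast
  have "\<not> dual_has_weak_star_fpp (reduced_cstar \<mu>)"
    by (rule R.no_weak_star_fpp[where lam = lam, OF lam(4) lam(2) less_imp_le[OF lam(3)] approximate_states[OF lam(1)]])
  then show False using fpp by blast
qed

end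

theorem theorem3p1:
  fixes \<mu> :: "'g::{topological_group_add, t2_space, second_countable_topology} measure"
  assumes "locally_compact_space (euclidean :: 'g topology)"
    and "left_haar_measure \<mu>"
    and "dual_has_weak_star_fpp (reduced_cstar \<mu>)"
  shows "compact (UNIV :: 'g set)"
proof -
  interpret haar \<mu> by unfold_locales (rule assms)+
  obtain f :: "'g \<Rightarrow> real" where f: "f \<in> borel_measurable borel" "\<And>x. 0 \<le> f x" "AE x in \<mu>. 0 < f x"
    "integrable \<mu> f" "distr (density \<mu> f) borel uminus = density \<mu> f"
    by (rule symmetric_density) blast
  interpret averaging \<mu> f by unfold_locales (rule f)+
  show ?thesis using fpp_imp_finite[OF assms(3)] by (intro finite_imp_compact) simp
qed

end
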